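(* Let $\mathbb{F}=\mathbb{R}$ or $\mathbb{F}=\mathbb{C}$, let $m,n$ be positive integers, and let $\underline{d}=(d_1,\ldots,d_m)$ be a list of nonnegative integers with $\max_{1\le i\le m} d_i>0$. Let $k'=\left\lceil \frac{\sum_{i=1}^m d_i}{n}\right\rceil$ and let $t$ be defined by $nk'=\sum_{i=1}^m d_i+t$, where $0\le t<n$. Let $\rho$ be the Euclidean distance in $\mathbb{F}[\lambda]^{m\times(m+n)}_{\underline{d}}$ and let $\mathrm{TSyl}[\lambda]^{m\times(m+n)}_{\underline{d}}\subset\mathbb{F}[\lambda]^{m\times(m+n)}_{\underline{d}}$ be the set of full-trimmed-Sylvester-rank polynomial matrices. Then the following statements hold. (a) For every $M(\lambda)\in\mathbb{F}[\lambda]^{m\times(m+n)}_{\underline{d}}$ and every $\epsilon>0$, there exists a polynomial matrix $\widetilde M(\lambda)\in\mathrm{TSyl}[\lambda]^{m\times(m+n)}_{\underline{d}}$ such that $\rho(M,\widetilde M)<\epsilon$, which, therefore, satisfies: (a1) $\widetilde M(\lambda)$ is a minimal basis with full row rank leading row-wise coefficient matrix, and with row degrees exactly equal to $d_1,d_2,\ldots,d_m$; (a2) $\widetilde M(\lambda)$ has $n$ right minimal indices, $t$ of them equal to $k'-1$ and $n-t$ equal to $k'$. (b) For every $\widetilde M(\lambda)\in\mathrm{TSyl}[\lambda]^{m\times(m+n)}_{\underline{d}}$, there exists a number $\epsilon>0$ such that every polynomial matrix $M(\lambda)\in\mathbb{F}[\lambda]^{m\times(m+n)}_{\underline{d}}$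 satisfying $\rho(M,\widetilde M)<\epsilon$ has full-trimmed-Sylvester-rank.
   Context: Space: $\mathbb{F}[\lambda]^{m\times(m+n)}_{\underline{d}}$ is the $\mathbb{F}$-linear space of $m\times(m+n)$ polynomial matrices $M(\lambda)$ whose $i$th row has the form $R_i(\lambda)=R_{i,0}+R_{i,1}\lambda+\cdots+R_{i,d_i}\lambda^{d_i}$ with $R_{i,j}\in\mathbb{F}^{1\times(m+n)}$, $i=1,\ldots,m$. The leading row-wise coefficient matrix of $M(\lambda)$ is the $m\times(m+n)$ constant matrix $M_{\underline{d}}$ whose $i$th row is $R_{i,d_i}$. Row degrees are the degrees of the rows (maximum degree of the entries). Metric: $\rho(M,\widetilde M)=\sqrt{\sum_{i=1}^m\sum_{j=0}^{d_i}\|R_{i,j}-\widetilde R_{i,j}\|_2^2}$. Trimmed Sylvester matrices: put $d=\max_i d_i$ and write $M(\lambda)=M_0+M_1\lambda+\cdots+M_d\lambda^d$. For $k\ge1$, the $k$th Sylvester matrix $S_k(M)\in\mathbb{F}^{(k+d)m\times k(m+n)}$ is the block matrix with $k+d$ block rows (indexed $0,\ldots,k+d-1$) and $k$ block columns (indexed $0,\ldots,k-1$) whose $(p,q)$ block is $M_{p-q}$ if $0\le p-q\le d$ and $0$ otherwise. The $k$th trimmed Sylvester matrix $T_k(M)\in\mathbb{F}^{(km+\sum_{i=1}^m d_i)\times k(m+n)}$ is obtained from $S_k(M)$ by deleting, for every $i=1,\ldots,m$, the $i$th row of each of the last $d-d_i$ block rows (these rows are always zero), keeping the order of the remaining rows.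 $M(\lambda)$ has full-trimmed-Sylvester-rank if $\operatorname{rank} T_k(M)=\min\{km+\sum_{i=1}^m d_i,\;k(m+n)\}$ for all $k=1,2,\ldots$. Minimal bases and indices: a minimal basis of a subspace $\mathcal V\subseteq\mathbb{F}(\lambda)^{q}$ is a basis of $\mathcal V$ consisting of polynomial vectors with minimal sum of degrees among all polynomial bases of $\mathcal V$; the ordered list of degrees of the vectors in any minimal basis is the same, and these degrees are the minimal indices of $\mathcal V$. A polynomial matrix with more columns than rows is called a minimal basis if its rows form a minimal basis of the rational subspace they span. The right minimal indices of $M(\lambda)$ are the minimal indices of its right null space over $\mathbb{F}(\lambda)$. *)

theory Defs
  imports
    "Jordan_Normal_Form.Matrix_Kernel"
    "Jordan_Normal_Form.DL_Rank"
    "Jordan_Normal_Form.DL_Submatrix"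
    "HOL-Computational_Algebra.Polynomial_Factorial"
    "HOL-Analysis.L2_Norm"
begin

text \<open>Everything is indexed from 0: row \<open>i\<close> (with \<open>i < m\<close>) here is row \<open>i + 1\<close> of the usual
  convention. The list \<open>d\<close> of length \<open>m\<close> contains the bounds on the row degrees. As \<open>degree 0 = 0\<close>,
  a zero row is allowed whatever its bound.\<close>

definition row_bounded_mats :: "nat \<Rightarrow> nat \<Rightarrow> nat list \<Rightarrow> 'a::zero poly mat set" where
  "row_bounded_mats m n d =
     {M \<in> carrier_mat m (m + n). \<forall>i<m. \<forall>j<m + n. degree (M $$ (i, j)) \<le> d ! i}"

definition leading_row_coeff_mat :: "nat list \<Rightarrow> 'a::zero poly mat \<Rightarrow> 'a mat" where
  "leading_row_coeff_mat d M =
     mat (dim_row M) (dim_col M) (\<lambda>(i, j). coeff (M $$ (i, j)) (d ! i))"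

definition poly_mat_dist :: "nat list \<Rightarrow> 'a::real_normed_field poly mat \<Rightarrow> 'a poly mat \<Rightarrow> real" where
  "poly_mat_dist d M M' =
     sqrt (\<Sum>i<dim_row M. \<Sum>j\<le>d ! i.
       (L2_set (\<lambda>l. norm (coeff (M $$ (i, l)) j - coeff (M' $$ (i, l)) j)) {..<dim_col M})\<^sup>2)"

definition mat_rank :: "'a::field mat \<Rightarrow> nat" where
  "mat_rank A = vec_space.rank (dim_row A) A"

text \<open>Row \<open>r\<close> of the Sylvester matrix is row \<open>r mod m\<close> of block row \<open>r div m\<close>, and similarly for
  columns. The grade \<open>D\<close> (in the application \<open>D = Max (set d)\<close>) is a parameter: it may exceed the
  actual degree of \<open>M\<close>.\<close>

definition sylvester_mat :: "nat \<Rightarrow> nat \<Rightarrow> 'a::zero poly mat \<Rightarrow> 'a mat" where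
  "sylvester_mat D k M =
     (let m = dim_row M; q = dim_col M in
      mat ((k + D) * m) (k * q) (\<lambda>(r, c).
        if c div q \<le> r div m \<and> r div m - c div q \<le> D
        then coeff (M $$ (r mod m, c mod q)) (r div m - c div q) else 0))"

text \<open>Deleted are the rows \<open>i\<close> of the last \<open>D - d ! i\<close> of the \<open>k + D\<close> block rows, that is, of the block
  rows with index at least \<open>k + D - (D - d ! i)\<close>.\<close>

definition trimmed_sylvester_mat :: "nat list \<Rightarrow> nat \<Rightarrow> 'a::zero poly mat \<Rightarrow> 'a mat" where
  "trimmed_sylvester_mat d k M =
     (let m = dim_row M; D = Max (set d) in
      submatrix (sylvester_mat D k M) {r. r div m < k + D - (D - d ! (r mod m))} UNIV)"

definition full_trimmed_sylvester_rank :: "nat list \<Rightarrow> 'a::field poly mat \<Rightarrow> bool" where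
  "full_trimmed_sylvester_rank d M \<longleftrightarrow>
     (\<forall>k\<ge>1. mat_rank (trimmed_sylvester_mat d k M) =
        min (k * dim_row M + sum_list d) (k * dim_col M))"

definition TSyl :: "nat \<Rightarrow> nat \<Rightarrow> nat list \<Rightarrow> 'a::field poly mat set" where
  "TSyl m n d = {M \<in> row_bounded_mats m n d. full_trimmed_sylvester_rank d M}"

definition vec_degree :: "'a::zero poly vec \<Rightarrow> nat" where
  "vec_degree v = Max {degree (v $ i) | i. i < dim_vec v}"

text \<open>The field of rational functions over \<open>'a\<close> is \<open>'a poly fract\<close>. Below, \<open>V\<close> is a subspace of the
  space of rational vectors of length \<open>q\<close>; a polynomial basis of \<open>V\<close> is a list of polynomial vectors.\<close>

definition polynomial_basis :: "nat \<Rightarrow> 'a::field poly fract vec set \<Rightarrow> 'a poly vec list \<Rightarrow> bool" where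
  "polynomial_basis q V B \<longleftrightarrow> distinct B \<and>
     vectorspace.basis class_ring (module_vec TYPE('a poly fract) q \<lparr>carrier := V\<rparr>)
       (map_vec to_fract ` set B)"

definition minimal_basis :: "nat \<Rightarrow> 'a::field poly fract vec set \<Rightarrow> 'a poly vec list \<Rightarrow> bool" where
  "minimal_basis q V B \<longleftrightarrow> polynomial_basis q V B \<and>
     (\<forall>C. polynomial_basis q V C \<longrightarrow>
        sum_list (map vec_degree B) \<le> sum_list (map vec_degree C))"

text \<open>The description below is a proper one because all minimal bases of a subspace have the same
  ordered list of degrees.\<close>

definition minimal_indices :: "nat \<Rightarrow> 'a::field poly fract vec set \<Rightarrow> nat list" where
  "minimal_indices q V = (THE ds. \<exists>B. minimal_basis q V B \<and> ds = sort (map vec_degree B))"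

definition right_minimal_indices :: "'a::field poly mat \<Rightarrow> nat list" where
  "right_minimal_indices M = minimal_indices (dim_col M) (mat_kernel (map_mat to_fract M))"

definition is_minimal_basis_mat :: "'a::field poly mat \<Rightarrow> bool" where
  "is_minimal_basis_mat M \<longleftrightarrow> dim_row M < dim_col M \<and>
     minimal_basis (dim_col M) (vec_space.row_space (dim_col M) (map_mat to_fract M)) (rows M)"

end

theory Submission
  imports Defs "HOL-Library.Function_Algebras"
begin

text \<open>Multiplication by \<open>M\<close> maps the polynomial vectors of degree less than \<open>k\<close> into the vectors
  whose \<open>i\<close>th entry has degree less than \<open>k + d ! i\<close>, and the trimmed Sylvester matrix of order
  \<open>k\<close> is the matrix of this linear map. Surjectivity passes from \<open>k \<ge> 1\<close> to \<open>k + 1\<close> and injectivity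
  from \<open>k\<close> to \<open>k - 1\<close>, so full trimmed Sylvester rank means: surjective for \<open>k = k'\<close> and injective
  for \<open>k = k' - 1\<close>.

  Surjectivity yields a polynomial right inverse and a leading row coefficient matrix of full row
  rank. Together they make the rows of \<open>M\<close> a generating system with independent leading coefficients
  of all polynomial vectors in the row space, which is therefore a minimal basis. The kernel vectors of
  degree \<open>k' - 1\<close> form a space of dimension \<open>t\<close>, and every vector in the kernel of the leading
  row coefficient matrix, which has dimension \<open>n\<close>, is the coefficient at degree \<open>k'\<close> of a kernel vector of
  degree at most \<open>k'\<close>. Choosing such vectors for a basis of that space which extends the leading coefficients
  of the kernel vectors of degree \<open>k' - 1\<close> gives a minimal basis of the kernel.

  Openness and density follow because the two conditions are nonvanishing conditions on
  determinants that are polynomial in the coefficients, once one matrix with both properties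
  is known; a matrix with few monomial entries does this.\<close>

subsection \<open>Polynomial vectors with independent leading coefficients\<close>

text \<open>\<open>k'\<close> is the least order at which the trimmed Sylvester matrix has at least
  as many columns as rows: the excess of columns is \<open>k * n - sum_list d\<close>, which is
  \<open>t\<close> at \<open>k'\<close>. What no dimension count supplies is one matrix of full rank
  for arbitrary \<open>d\<close>. It is built backwards from the indices wanted. Modulo the columns
  \<lambda>^(d_i) e_i - e_(i+1), polynomial vectors collapse to a single copy of the polynomials in
  which e_i becomes \<lambda>^(s_i), s_i = d_0 + ... + d_(i-1). The n + 1 columns still available
  become powers with exponents \<epsilon>_0 <= ... <= \<epsilon>_n. Surjectivity of order k follows
  once the intervals [\<epsilon>_j, \<epsilon>_j + k) cover [0, sum d + k), injectivity of order k -
  1 once the intervals [\<epsilon>_j, \<epsilon>_j + k - 1) are disjoint. Gaps of k - 1 or k between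
  neighbours achieve both, and t gaps k - 1 with n - t gaps k add up to n k - t = sum d. The gaps
  are thus the minimal indices to be realised.\<close>

text \<open>The terms with maximal \<open>degree (c i) + e i\<close> contribute, at that degree, a
  combination of the independent vectors of leading coefficients, so they cannot cancel (the
  predictable degree property). The bound \<open>D\<close> is strict, so that \<open>D = 0\<close>
  expresses a vanishing combination and zero polynomials need no special treatment.\<close>

lemma predictable_degree:
  fixes b :: "'i \<Rightarrow> 'l \<Rightarrow> 'a::field poly"
  assumes fin: "finite I"
    and deg: "\<And>i l. i \<in> I \<Longrightarrow> l \<in> L \<Longrightarrow> degree (b i l) \<le> e i"
    and lead: "\<And>a. (\<And>l. l \<in> L \<Longrightarrow> (\<Sum>i\<in>I. a i * coeff (b i l) (e i)) = 0) \<Longrightarrow> \<forall>i\<in>I. a i = 0"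
    and small: "\<And>l j. l \<in> L \<Longrightarrow> j \<ge> D \<Longrightarrow> coeff (\<Sum>i\<in>I. c i * b i l) j = 0"
    and i: "i \<in> I" "c i \<noteq> 0"
  shows "degree (c i) + e i < D"
proof (rule ccontr)
  assume neg: "\<not> degree (c i) + e i < D"
  define S where "S = {i \<in> I. c i \<noteq> 0}"
  have S: "finite S" "S \<noteq> {}" using fin i by (auto simp: S_def)
  define E where "E = Max ((\<lambda>i. degree (c i) + e i) ` S)"
  have le: "degree (c i) + e i \<le> E" if "i \<in> I" "c i \<noteq> 0" for i
    unfolding E_def using that S by (intro Max_ge) (auto simp: S_def)
  have "E \<in> (\<lambda>i. degree (c i) + e i) ` S" unfolding E_def using S by (intro Max_in) auto
  then obtain m where m: "m \<in> I" "c m \<noteq> 0" "E = degree (c m) + e m" by (auto simp: S_def)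
  have DE: "D \<le> E" using neg le[OF i] by linarith
  \<comment> \<open>The coefficient of \<open>c i\<close> that meets degree \<open>e i\<close> in
    degree \<open>E\<close>; for a nonzero \<open>c i\<close> it is nonzero exactly if
    \<open>c i\<close> attains the maximum \<open>E\<close>.\<close>
  define a where "a i = (if e i \<le> E then coeff (c i) (E - e i) else 0)" for i
  have top: "coeff (c i * b i l) E = a i * coeff (b i l) (e i)" if "i \<in> I" "l \<in> L" for i l
  proof (cases "c i = 0")
    case True
    then show ?thesis by (simp add: a_def)
  next
    case False
    have ce: "degree (c i) + e i \<le> E" using le that(1) False by blast
    have db: "degree (b i l) \<le> e i" using deg that by blast
    show ?thesis
    proof (cases "degree (c i) + e i = E \<and> degree (b i l) = e i")
      case True
      then have "coeff (c i * b i l) (degree (c i) + degree (b i l)) = coeff (c i) (E - e i) * coeff (b i l) (e i)"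
        by (subst coeff_mult_degree_sum) auto
      then show ?thesis using True ce by (simp add: a_def)
    next
      case F: False
      have "degree (c i * b i l) \<le> degree (c i) + degree (b i l)" by (rule degree_mult_le)
      with F ce db have "degree (c i * b i l) < E" by linarith
      then have "coeff (c i * b i l) E = 0" by (rule coeff_eq_0)
      moreover have "a i * coeff (b i l) (e i) = 0"
      proof (cases "degree (b i l) = e i")
        case True
        with F ce have "degree (c i) < E - e i" by linarith
        then show ?thesis by (simp add: a_def coeff_eq_0)
      next
        case False
        with db show ?thesis by (simp add: coeff_eq_0)
      qed
      ultimately show ?thesis by simp
    qed
  qed
  have "\<forall>i\<in>I. a i = 0"
  proof (rule lead)
    fix l assume l: "l \<in> L"
    have "(\<Sum>i\<in>I. a i * coeff (b i l) (e i)) = coeff (\<Sum>i\<in>I. c i * b i l) E"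
      using top l by (simp add: coeff_sum)
    then show "(\<Sum>i\<in>I. a i * coeff (b i l) (e i)) = 0" using small[OF l DE] by simp
  qed
  with m show False by (auto simp: a_def)
qed

lemma reduced_imp_poly_independent:
  fixes b :: "'i \<Rightarrow> 'l \<Rightarrow> 'a::field poly"
  assumes "finite I"
    and "\<And>i l. i \<in> I \<Longrightarrow> l \<in> L \<Longrightarrow> degree (b i l) \<le> e i"
    and "\<And>a. (\<And>l. l \<in> L \<Longrightarrow> (\<Sum>i\<in>I. a i * coeff (b i l) (e i)) = 0) \<Longrightarrow> \<forall>i\<in>I. a i = 0"
    and "\<And>l. l \<in> L \<Longrightarrow> (\<Sum>i\<in>I. c i * b i l) = 0"
  shows "\<forall>i\<in>I. c i = 0"
proof (rule ccontr)
  assume "\<not> (\<forall>i\<in>I. c i = 0)"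
  then obtain i where i: "i \<in> I" "c i \<noteq> 0" by blast
  have "degree (c i) + e i < 0"
    by (rule predictable_degree[of I L b e 0 c]) (use assms i in simp_all)
  then show False by simp
qed

text \<open>Independence of the \<open>C j\<close> makes the square matrix \<open>U\<close>
  nonsingular, so some term of the Leibniz expansion of its determinant is nonzero. Its permutation
  pairs every \<open>C j\<close> with a \<open>b i\<close> that occurs in it with nonzero
  coefficient, and predictable degrees bound the degree of \<open>C j\<close> from below by
  \<open>e i\<close>. Comparing the degrees one by one, not only their sums, later gives uniqueness
  of the degree list.\<close>

lemma combination_degree_permutation:
  fixes b :: "nat \<Rightarrow> nat \<Rightarrow> 'a::field poly"
  assumes deg: "\<And>i l. i < N \<Longrightarrow> l < q \<Longrightarrow> degree (b i l) \<le> e i"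
    and lead: "\<And>a. (\<And>l. l < q \<Longrightarrow> (\<Sum>i<N. a i * coeff (b i l) (e i)) = 0) \<Longrightarrow> \<forall>i<N. a i = 0"
    and comb: "\<And>j l. j < N \<Longrightarrow> l < q \<Longrightarrow> C j l = (\<Sum>i<N. U j i * b i l)"
    and indep: "\<And>a. (\<And>l. l < q \<Longrightarrow> (\<Sum>j<N. a j * C j l) = 0) \<Longrightarrow> \<forall>j<N. a j = 0"
  shows "\<exists>\<sigma>. \<sigma> permutes {..<N} \<and> (\<forall>j<N. \<forall>D. (\<forall>l<q. degree (C j l) < D) \<longrightarrow> e (\<sigma> j) < D)"
proof -
  define A where "A = mat N N (\<lambda>(j, i). U i j)"
  have A: "A \<in> carrier_mat N N" by (simp add: A_def)
  have "det A \<noteq> 0"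
  proof
    assume "det A = 0"
    then obtain v where v: "v \<in> carrier_vec N" "v \<noteq> 0\<^sub>v N" "A *\<^sub>v v = 0\<^sub>v N"
      using det_0_iff_vec_prod_zero[OF A] by blast
    have z: "(\<Sum>j<N. v $ j * U j i) = 0" if "i < N" for i
    proof -
      have "(A *\<^sub>v v) $ i = 0" using v that by simp
      then have "(\<Sum>j = 0..<N. U j i * v $ j) = 0" using that v(1) by (simp add: A_def scalar_prod_def)
      then show ?thesis by (simp add: lessThan_atLeast0 mult.commute)
    qed
    have "\<forall>j<N. v $ j = 0"
    proof (rule indep)
      fix l assume l: "l < q"
      have "(\<Sum>j<N. v $ j * C j l) = (\<Sum>j<N. \<Sum>i<N. v $ j * U j i * b i l)"
        using comb l by (simp add: sum_distrib_left mult.assoc)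
      also have "\<dots> = (\<Sum>i<N. (\<Sum>j<N. v $ j * U j i) * b i l)"
        by (subst sum.swap) (simp add: sum_distrib_right)
      also have "\<dots> = 0" using z by simp
      finally show "(\<Sum>j<N. v $ j * C j l) = 0" .
    qed
    with v show False by (auto simp: vec_eq_iff)
  qed
  then have "(\<Sum>p\<in>{p. p permutes {0..<N}}. signof p * (\<Prod>i = 0..<N. A $$ (i, p i))) \<noteq> 0"
    by (simp add: det_def'[OF A])
  then obtain p where "p \<in> {p. p permutes {0..<N}}" "signof p * (\<Prod>i = 0..<N. A $$ (i, p i)) \<noteq> 0"
    by (rule sum.not_neutral_contains_not_neutral)
  then have p: "p permutes {0..<N}" "(\<Prod>i = 0..<N. A $$ (i, p i)) \<noteq> 0" by auto
  let ?s = "Hilbert_Choice.inv p"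
  have s: "?s permutes {..<N}" using permutes_inv[OF p(1)] by (simp add: lessThan_atLeast0)
  have nz: "U j (?s j) \<noteq> 0" if "j < N" for j
  proof -
    have sj: "?s j < N" using permutes_in_image[OF s] that by auto
    then have "A $$ (?s j, p (?s j)) \<noteq> 0" using p(2) by (auto simp: prod_zero_iff)
    moreover have "p (?s j) = j" using permutes_inverses(1)[OF p(1)] by simp
    ultimately show ?thesis using sj that by (simp add: A_def)
  qed
  have "e (?s j) < D" if j: "j < N" and D: "\<forall>l<q. degree (C j l) < D" for j D
  proof -
    have sj: "?s j < N" using permutes_in_image[OF s] j by auto
    have "degree (U j (?s j)) + e (?s j) < D"
    proof (rule predictable_degree[of "{..<N}" "{..<q}" b e D "U j"])
      fix l k assume l: "l \<in> {..<q}" and "k \<ge> D"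
      then have "degree (C j l) < k" using D less_le_trans by blast
      then have "coeff (C j l) k = 0" by (rule coeff_eq_0)
      then show "coeff (\<Sum>i<N. U j i * b i l) k = 0" using comb[OF j] l by simp
    next
      fix a assume "\<And>l. l \<in> {..<q} \<Longrightarrow> (\<Sum>i<N. a i * coeff (b i l) (e i)) = 0"
      then have "\<forall>i<N. a i = 0" by (intro lead) simp
      then show "\<forall>i\<in>{..<N}. a i = 0" by simp
    qed (use deg sj nz j in simp_all)
    then show ?thesis by simp
  qed
  with s show ?thesis by blast
qed

subsection \<open>Polynomial bases of rational subspaces\<close>

text \<open>Lets a linear relation over the rational functions be replaced by one with polynomial
  coefficients; the criteria for independence and span below both rest on it.\<close>

lemma common_denominator:
  fixes f :: "'i \<Rightarrow> 'a::idom fract"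
  assumes "finite S"
  shows "\<exists>s g. s \<noteq> 0 \<and> (\<forall>x\<in>S. to_fract s * f x = to_fract (g x))"
  using assms
proof (induction S rule: finite_induct)
  case empty
  show ?case by (rule exI[of _ 1]) simp
next
  case (insert x S)
  then obtain s g where s: "s \<noteq> 0" "\<And>y. y \<in> S \<Longrightarrow> to_fract s * f y = to_fract (g y)" by blast
  obtain a b where ab: "f x = Fract a b" "b \<noteq> 0" by (cases "f x") auto
  have fx: "to_fract b * f x = to_fract a" using ab by (simp add: to_fract_def eq_fract)
  have "to_fract (b * s) * f y = to_fract ((if y = x then s * a else b * g y))" if "y \<in> insert x S" for y
  proof (cases "y = x")
    case True
    then show ?thesis using fx by (simp add: mult.commute mult.left_commute)
  next
    case False
    then show ?thesis using s(2) that by (simp add: mult.assoc)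
  qed
  then show ?case using s(1) ab(2)
    by (intro exI[of _ "b * s"] exI[of _ "\<lambda>y. if y = x then s * a else b * g y"]) auto
qed

lemma map_vec_to_fract_inj: "map_vec to_fract v = map_vec to_fract w \<Longrightarrow> v = w"
  by (auto simp: vec_eq_iff)

lemma sum_map_vec_to_fract:
  assumes "distinct B"
  shows "(\<Sum>x\<in>map_vec to_fract ` set B. h x) = (\<Sum>j<length B. h (map_vec to_fract (B ! j)))"
proof -
  have "inj_on (map_vec to_fract) (set B)" by (intro inj_onI) (rule map_vec_to_fract_inj)
  then have "(\<Sum>x\<in>map_vec to_fract ` set B. h x) = (\<Sum>x\<in>set B. h (map_vec to_fract x))"
    by (simp add: sum.reindex)
  also have "\<dots> = (\<Sum>j<length B. h (map_vec to_fract (B ! j)))"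
    by (rule sum.reindex_bij_betw[symmetric]) (use bij_betw_nth[OF assms] in auto)
  finally show ?thesis .
qed

lemma polynomial_basis_iff:
  fixes V :: "'a::field poly fract vec set"
  assumes "submodule class_ring V (module_vec TYPE('a poly fract) q)"
  shows "polynomial_basis q V B \<longleftrightarrow> distinct B \<and> map_vec to_fract ` set B \<subseteq> V \<and>
    \<not> LinearCombinations.module.lin_dep class_ring (module_vec TYPE('a poly fract) q) (map_vec to_fract ` set B) \<and>
    LinearCombinations.module.span class_ring (module_vec TYPE('a poly fract) q) (map_vec to_fract ` set B) = V"
proof -
  interpret vec_space "TYPE('a poly fract)" q .
  have vs: "vectorspace class_ring (vs V)"
    using assms by (intro subspace_is_vs) (simp add: VectorSpace.subspace_def vectorspace_axioms)
  show ?thesis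
    unfolding polynomial_basis_def vectorspace.basis_def[OF vs]
    using span_li_not_depend[OF _ assms, of "map_vec to_fract ` set B"] by auto
qed

lemma polynomial_lin_indpt_iff:
  fixes B :: "'a::field poly vec list"
  assumes B: "distinct B" "set B \<subseteq> carrier_vec q"
  shows "\<not> LinearCombinations.module.lin_dep class_ring (module_vec TYPE('a poly fract) q) (map_vec to_fract ` set B) \<longleftrightarrow>
    (\<forall>a. (\<forall>l<q. (\<Sum>j<length B. a j * B ! j $ l) = 0) \<longrightarrow> (\<forall>j<length B. a j = 0))"
proof -
  interpret vec_space "TYPE('a poly fract)" q .
  let ?W = "map_vec to_fract ` set B"
  have W: "?W \<subseteq> carrier_vec q" "finite ?W" using B by auto
  have dimB: "dim_vec (B ! j) = q" if "j < length B" for j using B that by (auto dest!: nth_mem)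
  have lc: "lincomb a ?W $ l = (\<Sum>j<length B. a (map_vec to_fract (B ! j)) * to_fract (B ! j $ l))"
    if "l < q" for a l
    unfolding lincomb_index[OF that W(1)] sum_map_vec_to_fract[OF B(1)]
    using dimB that by (intro sum.cong) auto
  have lcc: "lincomb a ?W \<in> carrier_vec q" for a using W by (intro lincomb_closed) auto
  show ?thesis
  proof (intro iffI allI impI)
    fix a j
    assume ind: "lin_indpt ?W" and a: "\<forall>l<q. (\<Sum>j<length B. a j * B ! j $ l) = 0" and j: "j < length B"
    \<comment> \<open>\<open>lincomb\<close> takes coefficients indexed by vectors, the list has
      them by position. The position is well defined because \<open>B\<close> is distinct and the
      embedding into the fractions is injective.\<close>
    define g where "g x = to_fract (a (THE j. j < length B \<and> map_vec to_fract (B ! j) = x))" for x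
    have g: "g (map_vec to_fract (B ! j)) = to_fract (a j)" if "j < length B" for j
    proof -
      have "(THE i. i < length B \<and> map_vec to_fract (B ! i) = map_vec to_fract (B ! j)) = j"
        using that B(1) by (intro the_equality) (auto dest!: map_vec_to_fract_inj simp: nth_eq_iff_index_eq)
      then show ?thesis by (simp add: g_def)
    qed
    have "lincomb g ?W = 0\<^sub>v q"
    proof (rule eq_vecI)
      fix l assume "l < dim_vec (0\<^sub>v q :: 'a poly fract vec)"
      then have l: "l < q" by simp
      have "lincomb g ?W $ l = (\<Sum>j<length B. to_fract (a j * B ! j $ l))"
        unfolding lc[OF l] using g by (intro sum.cong) auto
      also have "\<dots> = to_fract (\<Sum>j<length B. a j * B ! j $ l)" by (simp only: to_fract_sum)
      also have "\<dots> = 0" using a l by simp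
      finally show "lincomb g ?W $ l = 0\<^sub>v q $ l" using l by simp
    qed (use lcc in auto)
    then have "g x = 0" if "x \<in> ?W" for x
      using ind that lin_dep_crit[OF W(2) subset_refl, where a = g and v = x] by auto
    from this[of "map_vec to_fract (B ! j)"] show "a j = 0" using g j by simp
  next
    assume a: "\<forall>a. (\<forall>l<q. (\<Sum>j<length B. a j * B ! j $ l) = 0) \<longrightarrow> (\<forall>j<length B. a j = 0)"
    show "lin_indpt ?W"
    proof
      assume "lin_dep ?W"
      then obtain f x where f: "lincomb f ?W = 0\<^sub>v q" "x \<in> ?W" "f x \<noteq> 0"
        using finite_lin_dep[OF W(2) _ W(1)] by blast
      obtain s g where s: "s \<noteq> 0" "\<And>x. x \<in> ?W \<Longrightarrow> to_fract s * f x = to_fract (g x)"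
        using common_denominator[OF W(2), of f] by blast
      have "\<forall>j<length B. g (map_vec to_fract (B ! j)) = 0"
      proof (rule a[THEN spec, THEN mp], intro allI impI)
        fix l assume l: "l < q"
        have "to_fract (\<Sum>j<length B. g (map_vec to_fract (B ! j)) * B ! j $ l)
            = (\<Sum>j<length B. to_fract (g (map_vec to_fract (B ! j))) * to_fract (B ! j $ l))"
          by (simp add: to_fract_sum)
        also have "\<dots> = (\<Sum>j<length B. to_fract s * f (map_vec to_fract (B ! j)) * to_fract (B ! j $ l))"
          using s(2) by (intro sum.cong) auto
        also have "\<dots> = to_fract s * lincomb f ?W $ l"
          unfolding lc[OF l] by (simp add: sum_distrib_left mult.assoc)
        also have "\<dots> = 0" using f(1) l by simp
        finally show "(\<Sum>j<length B. g (map_vec to_fract (B ! j)) * B ! j $ l) = 0"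
          by (simp only: to_fract_eq_0_iff)
      qed
      moreover obtain j where "j < length B" "x = map_vec to_fract (B ! j)"
        using f(2) by (auto simp: in_set_conv_nth)
      ultimately have "to_fract s * f x = 0" using s(2)[OF f(2)] by simp
      with f(3) s(1) show False by simp
    qed
  qed
qed

text \<open>\<open>s\<close> is a common denominator of the coefficients, so membership in the
  rational span becomes an identity with a polynomial right-hand side.\<close>

lemma polynomial_span_iff:
  fixes B :: "'a::field poly vec list"
  assumes B: "distinct B" "set B \<subseteq> carrier_vec q"
  shows "v \<in> LinearCombinations.module.span class_ring (module_vec TYPE('a poly fract) q) (map_vec to_fract ` set B) \<longleftrightarrow>
    v \<in> carrier_vec q \<and>
    (\<exists>s c. s \<noteq> 0 \<and> (\<forall>l<q. to_fract s * v $ l = to_fract (\<Sum>j<length B. c j * B ! j $ l)))"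
proof -
  interpret vec_space "TYPE('a poly fract)" q .
  let ?W = "map_vec to_fract ` set B"
  have W: "?W \<subseteq> carrier_vec q" "finite ?W" using B by auto
  have dimB: "dim_vec (B ! j) = q" if "j < length B" for j using B that by (auto dest!: nth_mem)
  have lc: "lincomb a ?W $ l = (\<Sum>j<length B. a (map_vec to_fract (B ! j)) * to_fract (B ! j $ l))"
    if "l < q" for a l
    unfolding lincomb_index[OF that W(1)] sum_map_vec_to_fract[OF B(1)]
    using dimB that by (intro sum.cong) auto
  have lcc: "lincomb a ?W \<in> carrier_vec q" for a using W by (intro lincomb_closed) auto
  have span: "span ?W = {lincomb a ?W |a. True}" using finite_span[OF W(2,1)] by simp
  show ?thesis
  proof (intro iffI conjI; (elim conjE exE)?)
    assume v: "v \<in> span ?W"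
    then obtain f where f: "v = lincomb f ?W" unfolding span by blast
    show "v \<in> carrier_vec q" using f lcc by simp
    obtain s g where s: "s \<noteq> 0" "\<And>x. x \<in> ?W \<Longrightarrow> to_fract s * f x = to_fract (g x)"
      using common_denominator[OF W(2), of f] by blast
    have "to_fract s * v $ l = to_fract (\<Sum>j<length B. g (map_vec to_fract (B ! j)) * B ! j $ l)" if l: "l < q" for l
    proof -
      have "to_fract (\<Sum>j<length B. g (map_vec to_fract (B ! j)) * B ! j $ l)
          = (\<Sum>j<length B. to_fract (g (map_vec to_fract (B ! j))) * to_fract (B ! j $ l))"
        by (simp add: to_fract_sum)
      also have "\<dots> = (\<Sum>j<length B. to_fract s * f (map_vec to_fract (B ! j)) * to_fract (B ! j $ l))"
        using s(2) by (intro sum.cong) auto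
      also have "\<dots> = to_fract s * v $ l"
        unfolding f lc[OF l] by (simp add: sum_distrib_left mult.assoc)
      finally show ?thesis by (rule sym)
    qed
    with s(1) show "\<exists>s c. s \<noteq> 0 \<and> (\<forall>l<q. to_fract s * v $ l = to_fract (\<Sum>j<length B. c j * B ! j $ l))"
      by (intro exI[of _ s] exI[of _ "\<lambda>j. g (map_vec to_fract (B ! j))"]) simp
  next
    fix s c
    assume v: "v \<in> carrier_vec q" and s: "s \<noteq> 0"
      and c: "\<forall>l<q. to_fract s * v $ l = to_fract (\<Sum>j<length B. c j * B ! j $ l)"
    define g where "g x = to_fract (c (THE j. j < length B \<and> map_vec to_fract (B ! j) = x)) / to_fract s" for x
    have g: "g (map_vec to_fract (B ! j)) = to_fract (c j) / to_fract s" if "j < length B" for j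
    proof -
      have "(THE i. i < length B \<and> map_vec to_fract (B ! i) = map_vec to_fract (B ! j)) = j"
        using that B(1) by (intro the_equality) (auto dest!: map_vec_to_fract_inj simp: nth_eq_iff_index_eq)
      then show ?thesis by (simp add: g_def)
    qed
    have cancel: "x * (y / x * z) = y * z" if "x \<noteq> 0" for x y z :: "'a poly fract"
      using that by (metis mult.assoc nonzero_mult_div_cancel_left times_divide_eq_right)
    have "v = lincomb g ?W"
    proof (rule eq_vecI)
      fix l assume "l < dim_vec (lincomb g ?W)"
      then have l: "l < q" using carrier_vecD[OF lcc[of g]] by simp
      have "to_fract s * lincomb g ?W $ l = (\<Sum>j<length B. to_fract s * (to_fract (c j) / to_fract s * to_fract (B ! j $ l)))"
        unfolding lc[OF l] sum_distrib_left using g by (intro sum.cong refl) (simp only: lessThan_iff)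
      also have "\<dots> = (\<Sum>j<length B. to_fract (c j * B ! j $ l))"
        unfolding to_fract_mult using s by (intro sum.cong refl cancel) simp
      also have "\<dots> = to_fract s * v $ l" using c[rule_format, OF l] unfolding to_fract_sum ..
      finally have "to_fract s * lincomb g ?W $ l = to_fract s * v $ l" .
      moreover have "to_fract s \<noteq> 0" using s by simp
      ultimately show "v $ l = lincomb g ?W $ l" by (metis mult_left_cancel)
    qed (use carrier_vecD[OF lcc[of g]] carrier_vecD[OF v] in simp)
    then show "v \<in> span ?W" unfolding span by blast
  qed
qed

section \<open>Minimality criterion for polynomial bases\<close>

lemma vec_degree_less_iff:
  assumes "dim_vec v > 0"
  shows "vec_degree v < D \<longleftrightarrow> (\<forall>l<dim_vec v. degree (v $ l) < D)"
proof -
  have "{degree (v $ i) | i. i < dim_vec v} = (\<lambda>i. degree (v $ i)) ` {..<dim_vec v}" by auto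
  then show ?thesis using assms by (subst vec_degree_def, subst Max_less_iff) (auto simp: lessThan_empty_iff)
qed

lemma sort_eq_iff_mset_eq: "sort xs = sort ys \<longleftrightarrow> mset xs = mset ys"
proof
  assume "mset xs = mset ys"
  then show "sort xs = sort ys" by (intro properties_for_sort) simp_all
qed (metis mset_sort)

text \<open>The decisive hypothesis is \<open>gen\<close>: polynomial vectors of \<open>V\<close>
  are combinations with polynomial, not just rational, coefficients. Any other polynomial basis is
  then a polynomial matrix times \<open>bs\<close>, and its degrees dominate the \<open>e i\<close>
  after a permutation. Summing gives minimality; equality of the sums forces equality term by term,
  which is the uniqueness that the description in \<open>minimal_indices\<close> needs.\<close>

theorem reduced_generators_minimal:
  fixes V :: "'a::field poly fract vec set" and bs :: "'a poly vec list"
  defines "N \<equiv> length bs"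
  assumes V: "submodule class_ring V (module_vec TYPE('a poly fract) q)" and q: "q > 0"
    and bs: "set bs \<subseteq> carrier_vec q" "map_vec to_fract ` set bs \<subseteq> V"
    and deg: "\<And>i l. i < N \<Longrightarrow> l < q \<Longrightarrow> degree (bs ! i $ l) \<le> e i"
    and lead: "\<And>a. (\<And>l. l < q \<Longrightarrow> (\<Sum>i<N. a i * coeff (bs ! i $ l) (e i)) = 0) \<Longrightarrow> \<forall>i<N. a i = 0"
    and gen: "\<And>v. v \<in> carrier_vec q \<Longrightarrow> map_vec to_fract v \<in> V \<Longrightarrow> \<exists>c. \<forall>l<q. v $ l = (\<Sum>i<N. c i * bs ! i $ l)"
  shows "minimal_basis q V bs" and "minimal_indices q V = sort (map e [0..<N])"
    and "\<And>i. i < N \<Longrightarrow> vec_degree (bs ! i) = e i"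
proof -
  interpret vec_space "TYPE('a poly fract)" q .
  have Vc: "V \<subseteq> carrier_vec q" using V by (auto simp: submodule_def)
  have vs: "vectorspace class_ring (vs V)"
    using V by (intro subspace_is_vs) (simp add: VectorSpace.subspace_def vectorspace_axioms)
  have lead': "\<forall>i\<in>{..<N}. a i = 0" if "\<And>l. l \<in> {..<q} \<Longrightarrow> (\<Sum>i<N. a i * coeff (bs ! i $ l) (e i)) = 0" for a
    using lead[of a] that by simp
  have dimbs: "dim_vec (bs ! i) = q" if "i < N" for i using bs(1) that by (auto simp: N_def dest!: nth_mem)
  have deg_bs: "vec_degree (bs ! i) = e i" if i: "i < N" for i
  proof (rule antisym)
    have "vec_degree (bs ! i) < Suc (e i)"
      using dimbs[OF i] q deg[OF i] by (subst vec_degree_less_iff) (auto simp: less_Suc_eq_le)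
    then show "vec_degree (bs ! i) \<le> e i" by simp
    show "e i \<le> vec_degree (bs ! i)"
    proof (rule ccontr)
      assume "\<not> e i \<le> vec_degree (bs ! i)"
      then have "\<forall>l<q. degree (bs ! i $ l) < e i"
        using dimbs[OF i] q by (subst (asm) not_le, subst (asm) vec_degree_less_iff) auto
      then have "\<forall>l<q. coeff (bs ! i $ l) (e i) = 0" by (auto intro: coeff_eq_0)
      then have "\<forall>j<N. (if j = i then 1 else 0 :: 'a) = 0"
        by (intro lead) (auto intro!: sum.neutral)
      with i show False by auto
    qed
  qed
  have ind: "\<forall>j<N. a j = 0" if "\<forall>l<q. (\<Sum>j<N. a j * bs ! j $ l) = 0" for a
    using reduced_imp_poly_independent[of "{..<N}" "{..<q}" "\<lambda>i l. bs ! i $ l" e a, OF _ _ lead'] deg that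
    by simp
  have dist: "distinct bs"
  proof (rule ccontr)
    assume "\<not> distinct bs"
    then obtain i j where ij: "i < N" "j < N" "i \<noteq> j" "bs ! i = bs ! j"
      by (auto simp: distinct_conv_nth N_def)
    define a where "a = (\<lambda>k. if k = i then 1 else if k = j then -1 else 0 :: 'a poly)"
    have "(\<Sum>k<N. a k * bs ! k $ l) = 0" for l
    proof -
      have "(\<Sum>k<N. a k * bs ! k $ l) = (\<Sum>k\<in>{i, j}. a k * bs ! k $ l)"
        using ij by (intro sum.mono_neutral_right) (auto simp: a_def)
      also have "\<dots> = 0" using ij by (simp add: a_def)
      finally show ?thesis .
    qed
    then have "a i = 0" using ind[of a] ij(1) by blast
    then show False by (simp add: a_def)
  qed
  have span_le: "span (map_vec to_fract ` set bs) \<subseteq> V" using span_is_subset[OF bs(2) V] .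
  have le_span: "V \<subseteq> span (map_vec to_fract ` set bs)"
  proof
    fix v assume v: "v \<in> V"
    obtain s g where s: "s \<noteq> 0" "\<And>l. l < q \<Longrightarrow> to_fract s * v $ l = to_fract (g l)"
      using common_denominator[of "{..<q}" "\<lambda>l. v $ l"] by auto
    have "map_vec to_fract (vec q g) = to_fract s \<cdot>\<^sub>v v"
      using s(2) v Vc by (auto simp: vec_eq_iff)
    also have "\<dots> \<in> V" using V v by (auto simp: submodule_def module_vec_simps class_ring_simps)
    finally obtain c where c: "\<forall>l<q. vec q g $ l = (\<Sum>i<N. c i * bs ! i $ l)"
      using gen[of "vec q g"] by auto
    show "v \<in> span (map_vec to_fract ` set bs)"
      unfolding polynomial_span_iff[OF dist bs(1)]
    proof (intro conjI exI allI impI)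
      fix l assume l: "l < q"
      have "g l = (\<Sum>i<N. c i * bs ! i $ l)" using c l by simp
      then show "to_fract s * v $ l = to_fract (\<Sum>j<length bs. c j * bs ! j $ l)"
        using s(2)[OF l] unfolding N_def by simp
    qed (use s v Vc in auto)
  qed
  have pb: "polynomial_basis q V bs"
    unfolding polynomial_basis_iff[OF V] polynomial_lin_indpt_iff[OF dist bs(1)]
    by (intro conjI allI impI dist bs(2) subset_antisym span_le le_span)
      (use ind in \<open>simp only: N_def\<close>)
  \<comment> \<open>All bases of \<open>V\<close> have the same cardinality; this makes the
    transition matrix \<open>U\<close> below square.\<close>
  have basis_card: "card (set C) = vectorspace.dim class_ring (vs V)" if "polynomial_basis q V C" for C
  proof -
    have "vectorspace.basis class_ring (vs V) (map_vec to_fract ` set C)"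
      using that by (simp add: polynomial_basis_def)
    then have "vectorspace.dim class_ring (vs V) = card (map_vec to_fract ` set C)"
      by (intro vectorspace.dim_basis[OF vs]) auto
    also have "\<dots> = card (set C)"
      by (intro card_image inj_onI) (rule map_vec_to_fract_inj)
    finally show ?thesis by simp
  qed
  have compare: "\<exists>\<sigma>. \<sigma> permutes {..<N} \<and> length C = N \<and> (\<forall>j<N. e (\<sigma> j) \<le> vec_degree (C ! j))"
    if C: "polynomial_basis q V C" for C
  proof -
    have C': "distinct C" "map_vec to_fract ` set C \<subseteq> V" using C by (auto simp: polynomial_basis_iff[OF V])
    have Cc: "set C \<subseteq> carrier_vec q"
    proof
      fix v assume "v \<in> set C"
      then have "map_vec to_fract v \<in> carrier_vec q" using C'(2) Vc by blast
      from carrier_vecD[OF this] show "v \<in> carrier_vec q" by (intro carrier_vecI) simp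
    qed
    have len: "length C = N"
      using trans[OF basis_card[OF C] basis_card[OF pb, symmetric]]
      unfolding distinct_card[OF C'(1)] distinct_card[OF dist] N_def .
    have dimC: "dim_vec (C ! j) = q" if "j < N" for j using Cc that len nth_mem[of j C] by (auto intro!: carrier_vecD)
    have Cind: "\<forall>j<N. a j = 0" if "\<And>l. l < q \<Longrightarrow> (\<Sum>j<N. a j * C ! j $ l) = 0" for a
    proof -
      have "\<forall>a. (\<forall>l<q. (\<Sum>j<N. a j * C ! j $ l) = 0) \<longrightarrow> (\<forall>j<N. a j = 0)"
        using polynomial_basis_iff[OF V, THEN iffD1, OF C]
        by (intro polynomial_lin_indpt_iff[OF C'(1) Cc, unfolded len, THEN iffD1]) (elim conjE)
      from this[rule_format, OF that] show ?thesis by blast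
    qed
    have "\<exists>c. \<forall>l<q. C ! j $ l = (\<Sum>i<N. c i * bs ! i $ l)" if "j < N" for j
    proof (rule gen)
      have "C ! j \<in> set C" using that len by simp
      then show "C ! j \<in> carrier_vec q" "map_vec to_fract (C ! j) \<in> V" using Cc C'(2) by blast+
    qed
    note ex = this
    define U where "U j = (SOME c. \<forall>l<q. C ! j $ l = (\<Sum>i<N. c i * bs ! i $ l))" for j
    have U: "C ! j $ l = (\<Sum>i<N. U j i * bs ! i $ l)" if "j < N" "l < q" for j l
      using someI_ex[OF ex[OF that(1)]] that(2) unfolding U_def by blast
    have "\<exists>\<sigma>. \<sigma> permutes {..<N} \<and> (\<forall>j<N. \<forall>D. (\<forall>l<q. degree (C ! j $ l) < D) \<longrightarrow> e (\<sigma> j) < D)"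
      by (rule combination_degree_permutation[of N q "\<lambda>i l. bs ! i $ l" e "\<lambda>j l. C ! j $ l" U, OF deg lead U Cind])
    then obtain \<sigma> where \<sigma>: "\<sigma> permutes {..<N}" "\<forall>j<N. \<forall>D. (\<forall>l<q. degree (C ! j $ l) < D) \<longrightarrow> e (\<sigma> j) < D"
      by (elim exE conjE)
    have "e (\<sigma> j) \<le> vec_degree (C ! j)" if j: "j < N" for j
    proof -
      have "\<forall>l<q. degree (C ! j $ l) < Suc (vec_degree (C ! j))"
        using vec_degree_less_iff[of "C ! j" "Suc (vec_degree (C ! j))"] dimC[OF j] q by auto
      from \<sigma>(2)[rule_format, OF j this[rule_format]] show ?thesis by simp
    qed
    with \<sigma>(1) len show ?thesis by blast
  qed
  have sum_deg: "sum_list (map vec_degree C) = (\<Sum>j<N. vec_degree (C ! j))" if "length C = N" for C :: "'a poly vec list"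
    using that by (simp add: sum_list_sum_nth lessThan_atLeast0)
  have sum_perm: "(\<Sum>j<N. e (\<sigma> j)) = (\<Sum>j<N. e j)" if "\<sigma> permutes {..<N}" for \<sigma>
    using sum.permute[OF that, of e] by (simp add: comp_def)
  have sum_bs: "sum_list (map vec_degree bs) = (\<Sum>j<N. e j)"
    using deg_bs by (subst sum_deg) (auto simp: N_def)
  have "sum_list (map vec_degree bs) \<le> sum_list (map vec_degree C)" if "polynomial_basis q V C" for C
  proof -
    obtain \<sigma> where \<sigma>: "\<sigma> permutes {..<N}" "length C = N" "\<And>j. j < N \<Longrightarrow> e (\<sigma> j) \<le> vec_degree (C ! j)"
      using compare[OF \<open>polynomial_basis q V C\<close>] by blast
    have "(\<Sum>j<N. e (\<sigma> j)) \<le> (\<Sum>j<N. vec_degree (C ! j))" using \<sigma>(3) by (intro sum_mono) auto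
    then show ?thesis using sum_perm[OF \<sigma>(1)] sum_bs sum_deg[OF \<sigma>(2)] by simp
  qed
  with pb show mb: "minimal_basis q V bs" by (simp add: minimal_basis_def)
  have uniq: "sort (map vec_degree C) = sort (map e [0..<N])" if C: "minimal_basis q V C" for C
  proof -
    obtain \<sigma> where \<sigma>: "\<sigma> permutes {..<N}" "length C = N" "\<And>j. j < N \<Longrightarrow> e (\<sigma> j) \<le> vec_degree (C ! j)"
      using compare C unfolding minimal_basis_def by blast
    have "sum_list (map vec_degree C) \<le> sum_list (map vec_degree bs)"
      using C pb by (simp add: minimal_basis_def)
    then have le: "(\<Sum>j<N. vec_degree (C ! j)) \<le> (\<Sum>j<N. e (\<sigma> j))"
      using sum_perm[OF \<sigma>(1)] sum_bs sum_deg[OF \<sigma>(2)] by simp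
    have eq: "vec_degree (C ! j) = e (\<sigma> j)" if j: "j < N" for j
    proof (rule ccontr)
      assume "vec_degree (C ! j) \<noteq> e (\<sigma> j)"
      then have "e (\<sigma> j) < vec_degree (C ! j)" using \<sigma>(3)[OF j] by simp
      then have "(\<Sum>j<N. e (\<sigma> j)) < (\<Sum>j<N. vec_degree (C ! j))"
        using \<sigma>(3) j by (intro sum_strict_mono_ex1) auto
      with le show False by simp
    qed
    have "map vec_degree C = map (\<lambda>j. e (\<sigma> j)) [0..<N]"
      using eq \<sigma>(2) by (intro nth_equalityI) simp_all
    then have "mset (map vec_degree C) = mset (map (\<lambda>j. e (\<sigma> j)) [0..<N])" by simp
    also have "\<dots> = image_mset e (image_mset \<sigma> (mset_set {..<N}))"
      by (simp add: multiset.map_comp comp_def lessThan_atLeast0)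
    also have "image_mset \<sigma> (mset_set {..<N}) = mset_set {..<N}"
      using image_mset_mset_set[OF permutes_inj_on[OF \<sigma>(1)], of "{..<N}"] permutes_image[OF \<sigma>(1)] by simp
    also have "image_mset e (mset_set {..<N}) = mset (map e [0..<N])" by (simp add: lessThan_atLeast0)
    finally show ?thesis by (simp only: sort_eq_iff_mset_eq)
  qed
  show "minimal_indices q V = sort (map e [0..<N])"
    unfolding minimal_indices_def
  proof (rule the_equality)
    show "\<exists>B. minimal_basis q V B \<and> sort (map e [0..<N]) = sort (map vec_degree B)"
      by (intro exI[of _ bs] conjI mb uniq[OF mb, symmetric])
  next
    fix ds assume "\<exists>B. minimal_basis q V B \<and> ds = sort (map vec_degree B)"
    then show "ds = sort (map e [0..<N])" using uniq by fast
  qed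
  show "\<And>i. i < N \<Longrightarrow> vec_degree (bs ! i) = e i" by (rule deg_bs)
qed

subsection \<open>Vectors of polynomials with bounded degrees\<close>

lemma sum_fun_apply: "(\<Sum>i\<in>A. f i) x = (\<Sum>i\<in>A. f i x)"
  by (induction A rule: infinite_finite_induct) simp_all

text \<open>A basis of the kernel in \<open>S\<close> is extended to a basis of \<open>S\<close>;
  the added vectors are mapped injectively onto a basis of the image. The ambient space is
  infinite-dimensional in the application, hence the restriction to a subspace \<open>S\<close>
  inside a finite span.\<close>

theorem (in vector_space_pair) rank_nullity:
  assumes f: "Vector_Spaces.linear s1 s2 f" and S: "vs1.subspace S" and fin: "finite T" "S \<subseteq> vs1.span T"
  shows "vs1.dim S = vs1.dim {x \<in> S. f x = 0} + vs2.dim (f ` S)"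
proof -
  let ?K = "{x \<in> S. f x = 0}"
  obtain A where A: "A \<subseteq> ?K" "vs1.independent A" "?K \<subseteq> vs1.span A"
    using vs1.maximal_independent_subset[of ?K] by auto
  obtain B where B: "A \<subseteq> B" "B \<subseteq> S" "vs1.independent B" "S \<subseteq> vs1.span B"
    using vs1.maximal_independent_subset_extend[of A S] A by auto
  have finB: "finite B"
    using vs1.independent_span_bound[OF fin(1) B(3)] B(2) fin(2) by auto
  then have finA: "finite A" using B(1) finite_subset by blast
  let ?C = "B - A"
  have zero: "u c = 0" if u: "(\<Sum>c\<in>?C. s2 (u c) (f c)) = 0" and c: "c \<in> ?C" for u c
  proof -
    define x where "x = (\<Sum>c\<in>?C. s1 (u c) c)"
    have "f x = 0" unfolding x_def using u by (simp add: linear_sum[OF f] linear_scale[OF f])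
    moreover have "x \<in> S" unfolding x_def using B(2)
      by (intro vs1.subspace_sum[OF S] vs1.subspace_scale[OF S]) auto
    ultimately have "x \<in> vs1.span A" using A(3) by auto
    then obtain w where w: "x = (\<Sum>a\<in>A. s1 (w a) a)"
      unfolding vs1.span_finite[OF finA] by auto
    define v where "v b = (if b \<in> A then - w b else u b)" for b
    have "(\<Sum>b\<in>B. s1 (v b) b) = (\<Sum>b\<in>?C. s1 (v b) b) + (\<Sum>b\<in>A. s1 (v b) b)"
      using sum.subset_diff[OF B(1) finB] .
    also have "(\<Sum>b\<in>?C. s1 (v b) b) = x" unfolding x_def by (intro sum.cong) (auto simp: v_def)
    also have "(\<Sum>b\<in>A. s1 (v b) b) = - x" unfolding w by (simp add: v_def sum_negf)
    finally have "(\<Sum>b\<in>B. s1 (v b) b) = 0" by simp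
    then have "v c = 0" using B(3) c finB unfolding vs1.independent_explicit_finite_subsets by blast
    then show ?thesis using c by (simp add: v_def)
  qed
  have inj: "inj_on f ?C"
  proof (rule inj_onI, rule ccontr)
    fix a b assume ab: "a \<in> ?C" "b \<in> ?C" "f a = f b" "a \<noteq> b"
    define u :: "_ \<Rightarrow> 'a" where "u c = (if c = a then 1 else if c = b then -1 else 0)" for c
    have "(\<Sum>c\<in>?C. s2 (u c) (f c)) = (\<Sum>c\<in>{a, b}. s2 (u c) (f c))"
      using ab finB by (intro sum.mono_neutral_right) (auto simp: u_def)
    also have "\<dots> = 0" using ab by (simp add: u_def)
    finally have "u a = 0" using ab(1) by (rule zero)
    then show False by (simp add: u_def)
  qed
  have indep: "vs2.independent (f ` ?C)"
  proof (rule vs2.independent_if_scalars_zero)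
    show "finite (f ` ?C)" using finB by simp
    fix u y assume u: "(\<Sum>y\<in>f ` ?C. s2 (u y) y) = 0" and y: "y \<in> f ` ?C"
    have "(\<Sum>c\<in>?C. s2 (u (f c)) (f c)) = 0" using u by (simp add: sum.reindex[OF inj])
    then show "u y = 0" using zero[of "\<lambda>c. u (f c)"] y by auto
  qed
  have "f ` S \<subseteq> vs2.span (f ` ?C)"
  proof
    fix y assume "y \<in> f ` S"
    then obtain x where x: "x \<in> vs1.span B" "y = f x" using B(4) by auto
    have "y \<in> vs2.span (f ` B)" using x linear_span_image[OF f, of B] by auto
    also have "f ` B \<subseteq> insert 0 (f ` ?C)" using A(1) by auto
    then have "vs2.span (f ` B) \<subseteq> vs2.span (insert 0 (f ` ?C))" by (rule vs2.span_mono)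
    finally show "y \<in> vs2.span (f ` ?C)" by simp
  qed
  then have "vs2.dim (f ` S) = card (f ` ?C)"
    using indep B(2) by (intro vs2.dim_unique[of "f ` ?C"]) auto
  then have "vs2.dim (f ` S) = card ?C" by (simp add: card_image[OF inj])
  moreover have "vs1.dim ?K = card A" using A by (intro vs1.dim_unique[of A]) auto
  moreover have "vs1.dim S = card B" using B by (intro vs1.dim_unique[of B]) auto
  moreover have "card B = card A + card ?C"
    using B(1) finB finA by (simp add: card_Diff_subset card_mono)
  ultimately show ?thesis by simp
qed

text \<open>Only constants act as scalars: the dimensions to be counted are those of spaces of
  bounded degree over \<open>'a\<close>. Vectors are functions on all of \<open>nat\<close>, so that
  vectors of every length share one space and \<open>pv.dim\<close> applies to all of them.\<close>

definition pscale :: "'a::field \<Rightarrow> (nat \<Rightarrow> 'a poly) \<Rightarrow> nat \<Rightarrow> 'a poly" where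
  "pscale c x = (\<lambda>i. Polynomial.smult c (x i))"

interpretation pv: vector_space pscale
  by standard (auto simp: pscale_def fun_eq_iff smult_add_right smult_add_left)

interpretation pvp: vector_space_pair pscale pscale ..

text \<open>The bounds are strict and stated through coefficients: bound 0 then forces the zero
  polynomial, which \<open>degree\<close> cannot express as \<open>degree 0 = 0\<close>, and the
  dimension is just the sum of the bounds.\<close>

definition bounded_vecs :: "nat \<Rightarrow> (nat \<Rightarrow> nat) \<Rightarrow> (nat \<Rightarrow> 'a::zero poly) set" where
  "bounded_vecs q b = {x. \<forall>i j. i \<ge> q \<or> j \<ge> b i \<longrightarrow> coeff (x i) j = 0}"

definition monom_vec :: "nat \<Rightarrow> nat \<Rightarrow> nat \<Rightarrow> 'a::{zero,one} poly" where
  "monom_vec i j = (\<lambda>l. if l = i then monom 1 j else 0)"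

lemma coeff_sum_monom_vec:
  assumes "finite S"
  shows "coeff ((\<Sum>(i, j)\<in>S. pscale (a i j) (monom_vec i j)) l) k = (if (l, k) \<in> S then a l k else 0)"
proof -
  have "coeff ((\<Sum>(i, j)\<in>S. pscale (a i j) (monom_vec i j)) l) k
      = (\<Sum>p\<in>S. coeff ((case p of (i, j) \<Rightarrow> pscale (a i j) (monom_vec i j)) l) k)"
    by (simp add: sum_fun_apply coeff_sum)
  also have "\<dots> = (\<Sum>p\<in>S. if p = (l, k) then a l k else 0)"
    by (intro sum.cong) (auto simp: pscale_def monom_vec_def split: prod.splits)
  also have "\<dots> = (if (l, k) \<in> S then a l k else 0)" using assms by simp
  finally show ?thesis .
qed

lemma subspace_bounded_vecs: "pv.subspace (bounded_vecs q b)"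
  by (auto simp: pv.subspace_def bounded_vecs_def pscale_def)

lemma bounded_vecs_eq_sum:
  assumes "x \<in> bounded_vecs q b"
  shows "x = (\<Sum>(i, j)\<in>(SIGMA i:{..<q}. {..<b i}). pscale (coeff (x i) j) (monom_vec i j))"
  using assms by (intro ext poly_eqI) (auto simp: coeff_sum_monom_vec bounded_vecs_def)

lemma monom_vec_bounded: "i < q \<Longrightarrow> j < b i \<Longrightarrow> monom_vec i j \<in> bounded_vecs q b"
  by (auto simp: bounded_vecs_def monom_vec_def)

lemma bounded_vecs_basis:
  fixes q b defines "B \<equiv> (\<lambda>(i, j). monom_vec i j) ` (SIGMA i:{..<q}. {..<b i})"
  shows "finite B" "pv.independent B" "bounded_vecs q b = pv.span B" "card B = (\<Sum>i<q. b i)"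
proof -
  let ?S = "SIGMA i:{..<q}. {..<b i}"
  have inj: "inj_on (\<lambda>(i, j). monom_vec i j :: nat \<Rightarrow> 'a poly) ?S"
  proof (rule inj_onI, clarify)
    fix i j i' j' assume eq: "(monom_vec i j :: nat \<Rightarrow> 'a poly) = monom_vec i' j'"
    have "coeff ((monom_vec i j :: nat \<Rightarrow> 'a poly) i) j = coeff ((monom_vec i' j' :: nat \<Rightarrow> 'a poly) i) j"
      by (simp only: eq)
    then show "i = i' \<and> j = j'" by (auto simp: monom_vec_def split: if_splits)
  qed
  show fin: "finite B" by (simp add: B_def)
  show "card B = (\<Sum>i<q. b i)" unfolding B_def by (simp add: card_image[OF inj])
  show "pv.independent B"
  proof (rule pv.independent_if_scalars_zero[OF fin])
    fix f x assume f: "(\<Sum>x\<in>B. pscale (f x) x) = 0" and x: "x \<in> B"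
    obtain i j where ij: "i < q" "j < b i" "x = monom_vec i j" using x by (auto simp: B_def)
    have "(\<Sum>x\<in>B. pscale (f x) x) = (\<Sum>(i, j)\<in>?S. pscale (f (monom_vec i j)) (monom_vec i j))"
      unfolding B_def by (subst sum.reindex[OF inj]) (auto intro!: sum.cong)
    then have "coeff ((\<Sum>(i, j)\<in>?S. pscale (f (monom_vec i j)) (monom_vec i j)) i) j = 0"
      using f by simp
    then show "f x = 0" using ij by (simp add: coeff_sum_monom_vec)
  qed
  show "bounded_vecs q b = pv.span B"
  proof
    show "pv.span B \<subseteq> bounded_vecs q b"
      by (rule pv.span_minimal[OF _ subspace_bounded_vecs]) (auto simp: B_def intro: monom_vec_bounded)
    show "bounded_vecs q b \<subseteq> pv.span B"
    proof
      fix x :: "nat \<Rightarrow> 'a poly" assume "x \<in> bounded_vecs q b"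
      from bounded_vecs_eq_sum[OF this] show "x \<in> pv.span B"
        by (rule ssubst) (rule pv.span_sum, clarify, rule pv.span_scale, rule pv.span_base, auto simp: B_def)
    qed
  qed
qed

lemma dim_bounded_vecs: "pv.dim (bounded_vecs q b) = (\<Sum>i<q. b i)"
  unfolding bounded_vecs_basis(3) pv.dim_span_eq_card_independent[OF bounded_vecs_basis(2)] bounded_vecs_basis(4) ..

subsection \<open>Matrices of full row or column rank\<close>

lemma mat_rank_eq_dim_row_iff:
  fixes A :: "'a::field mat"
  shows "mat_rank A = dim_row A \<longleftrightarrow>
    (\<forall>y\<in>carrier_vec (dim_row A). \<exists>x\<in>carrier_vec (dim_col A). A *\<^sub>v x = y)"
proof -
  let ?n = "dim_row A"
  interpret vec_space "TYPE('a)" ?n .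
  have A: "A \<in> carrier_mat ?n (dim_col A)" by simp
  have C: "set (cols A) \<subseteq> carrier_vec ?n" using cols_dim[of A] .
  have span: "span (set (cols A)) = {y\<in>carrier_vec ?n. \<exists>x\<in>carrier_vec (dim_col A). A *\<^sub>v x = y}"
    using col_space_eq[OF A] by (simp add: col_space_def)
  have "rank A = ?n \<longleftrightarrow> span (set (cols A)) = carrier_vec ?n"
  proof
    assume r: "rank A = ?n"
    obtain S where S: "maximal S (\<lambda>T. T \<subseteq> set (cols A) \<and> lin_indpt T)"
      using maximal_exists_superset[of "set (cols A)" "\<lambda>T. T \<subseteq> set (cols A) \<and> lin_indpt T" "{}"]
        finite_lin_indpt2[of "{}"] by auto
    then have S': "S \<subseteq> set (cols A)" "lin_indpt S" by (auto simp: maximal_def)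
    have "card S = dim" using rank_card_indpt[OF A S] r dim_is_n by simp
    moreover have "finite S" using S'(1) finite_subset by blast
    moreover have "S \<subseteq> carrier_vec ?n" using S'(1) C by (rule subset_trans)
    ultimately have "basis S" using S'(2) by (intro dim_li_is_basis) auto
    then have "span S = carrier_vec ?n" by (simp add: basis_def)
    then show "span (set (cols A)) = carrier_vec ?n"
      using span_is_monotone[OF S'(1)] span_is_subset2[OF C] by auto
  next
    assume s: "span (set (cols A)) = carrier_vec ?n"
    have V: "V\<lparr>carrier := carrier_vec ?n\<rparr> = V" by (simp add: module_vec_def)
    show "rank A = ?n" unfolding rank_def s V by (rule dim_is_n)
  qed
  then show ?thesis unfolding mat_rank_def span by auto
qed

lemma mat_rank_eq_dim_col_iff:
  fixes A :: "'a::field mat"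
  shows "mat_rank A = dim_col A \<longleftrightarrow>
    (\<forall>x\<in>carrier_vec (dim_col A). A *\<^sub>v x = 0\<^sub>v (dim_row A) \<longrightarrow> x = 0\<^sub>v (dim_col A))"
proof -
  let ?n = "dim_row A"
  interpret vec_space "TYPE('a)" ?n .
  have A: "A \<in> carrier_mat ?n (dim_col A)" by simp
  show ?thesis unfolding mat_rank_def
  proof
    assume r: "rank A = dim_col A"
    obtain S where S: "maximal S (\<lambda>T. T \<subseteq> set (cols A) \<and> lin_indpt T)"
      using maximal_exists_superset[of "set (cols A)" "\<lambda>T. T \<subseteq> set (cols A) \<and> lin_indpt T" "{}"]
        finite_lin_indpt2[of "{}"] by auto
    have "rank A \<le> card (set (cols A))"
      unfolding rank_card_indpt[OF A S] using S by (intro card_mono) (auto simp: maximal_def)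
    then have d: "distinct (cols A)"
      using r card_length[of "cols A"] by (intro card_distinct) simp
    show "\<forall>x\<in>carrier_vec (dim_col A). A *\<^sub>v x = 0\<^sub>v ?n \<longrightarrow> x = 0\<^sub>v (dim_col A)"
      using lin_depI[OF A _ _ _ d] full_rank_lin_indpt[OF A r d] by blast
  next
    assume ker: "\<forall>x\<in>carrier_vec (dim_col A). A *\<^sub>v x = 0\<^sub>v ?n \<longrightarrow> x = 0\<^sub>v (dim_col A)"
    \<comment> \<open>The rank is computed from the set of columns, in which a repeated column would
      disappear. Two equal columns would put the difference of two unit vectors into the
      kernel.\<close>
    have d: "distinct (cols A)"
    proof (rule ccontr)
      assume "\<not> distinct (cols A)"
      then obtain i j where ij: "i < dim_col A" "j < dim_col A" "i \<noteq> j" "col A i = col A j"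
        by (auto simp: distinct_conv_nth)
      let ?x = "unit_vec (dim_col A) i - unit_vec (dim_col A) j :: 'a vec"
      have eqA: "A $$ (r, i) = A $$ (r, j)" if "r < ?n" for r
        using arg_cong[OF ij(4), of "\<lambda>v. v $ r"] ij(1,2) that by simp
      have "A *\<^sub>v ?x = 0\<^sub>v ?n"
      proof (rule eq_vecI)
        fix r assume r: "r < dim_vec (0\<^sub>v ?n :: 'a vec)"
        have "(A *\<^sub>v ?x) $ r = row A r \<bullet> ?x" using r by simp
        also have "\<dots> = row A r \<bullet> unit_vec (dim_col A) i - row A r \<bullet> unit_vec (dim_col A) j"
          by (rule scalar_prod_minus_distrib[of _ "dim_col A"]) auto
        also have "\<dots> = 0" using ij eqA r by (simp add: scalar_prod_right_unit)
        finally show "(A *\<^sub>v ?x) $ r = 0\<^sub>v ?n $ r" using r by simp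
      qed simp
      then have "?x = 0\<^sub>v (dim_col A)" using ker by auto
      then have "?x $ i = 0" using ij by simp
      then show False using ij by simp
    qed
    show "rank A = dim_col A"
    proof (rule lin_indpt_full_rank[OF A d], rule notI)
      assume "lin_dep (set (cols A))"
      then obtain v where v: "v \<in> carrier_vec (dim_col A)" "v \<noteq> 0\<^sub>v (dim_col A)" "A *\<^sub>v v = 0\<^sub>v ?n"
        by (rule lin_depE[OF A _ d])
      show False using ker[rule_format, OF v(1,3)] v(2) by (rule notE[rotated])
    qed
  qed
qed

section \<open>One-sided inverses and determinant tests for full rank\<close>

lemma right_inverse_exists:
  fixes A :: "'a::field mat"
  assumes A: "A \<in> carrier_mat nr nc" and surj: "\<And>y. y \<in> carrier_vec nr \<Longrightarrow> \<exists>x\<in>carrier_vec nc. A *\<^sub>v x = y"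
  shows "\<exists>B\<in>carrier_mat nc nr. A * B = 1\<^sub>m nr"
proof -
  have "\<forall>i. \<exists>x. i < nr \<longrightarrow> x \<in> carrier_vec nc \<and> A *\<^sub>v x = unit_vec nr i" using surj by (meson unit_vec_carrier)
  then obtain f where f: "\<And>i. i < nr \<Longrightarrow> f i \<in> carrier_vec nc \<and> A *\<^sub>v f i = unit_vec nr i" by metis
  define B where "B = mat nc nr (\<lambda>(r, i). f i $ r)"
  have B: "B \<in> carrier_mat nc nr" by (simp add: B_def)
  have colB: "col B i = f i" if "i < nr" for i
    using f[OF that] that by (intro eq_vecI) (auto simp: B_def)
  have "A * B = 1\<^sub>m nr"
  proof (rule mat_col_eqI)
    fix i assume "i < dim_col (1\<^sub>m nr :: 'a mat)"
    then have i: "i < nr" by simp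
    have "col (A * B) i = unit_vec nr i" unfolding col_mult2[OF A B i] colB[OF i] using f[OF i] by simp
    then show "col (A * B) i = col (1\<^sub>m nr) i" using i by simp
  qed (use A B in auto)
  with B show ?thesis by blast
qed

lemma vector_space_fun: "vector_space (\<lambda>(c::'a::field) (f::nat \<Rightarrow> 'a) i. c * f i)"
  by standard (auto simp: fun_eq_iff algebra_simps)

text \<open>The matrix is read off from a linear left inverse \<open>g\<close> of the induced map on
  functions supported below \<open>nc\<close>: its columns are the images of the unit functions
  \<open>e j\<close>.\<close>

lemma left_inverse_exists:
  fixes A :: "'a::field mat"
  assumes A: "A \<in> carrier_mat nr nc"
    and inj: "\<And>x. x \<in> carrier_vec nc \<Longrightarrow> A *\<^sub>v x = 0\<^sub>v nr \<Longrightarrow> x = 0\<^sub>v nc"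
  shows "\<exists>B\<in>carrier_mat nc nr. B * A = 1\<^sub>m nc"
proof -
  define sc where "sc = (\<lambda>(c::'a) (f::nat \<Rightarrow> 'a) i. c * f i)"
  interpret v: vector_space sc unfolding sc_def by (rule vector_space_fun)
  interpret pair: vector_space_pair sc sc ..
  define f where "f x = (\<lambda>i. if i < nr then \<Sum>j<nc. A $$ (i, j) * x j else 0)" for x
  have f: "Vector_Spaces.linear sc sc f"
    unfolding Vector_Spaces.linear_iff using v.vector_space_axioms
    by (auto simp: f_def sc_def fun_eq_iff algebra_simps sum.distrib sum_distrib_left)
  let ?S = "{x. \<forall>j\<ge>nc. x j = 0}"
  have S: "v.subspace ?S" unfolding v.subspace_def by (simp add: sc_def)
  have "inj_on f ?S"
    unfolding pair.linear_inj_on_iff_eq_0[OF f S]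
  proof (intro ballI impI)
    fix x assume x: "x \<in> ?S" and fx: "f x = 0"
    have "A *\<^sub>v vec nc x = 0\<^sub>v nr"
    proof (rule eq_vecI)
      fix i assume i: "i < dim_vec (0\<^sub>v nr :: 'a vec)"
      have "(A *\<^sub>v vec nc x) $ i = f x i" using i A by (simp add: f_def scalar_prod_def lessThan_atLeast0)
      then show "(A *\<^sub>v vec nc x) $ i = 0\<^sub>v nr $ i" using fx i by simp
    qed (use A in auto)
    then have z: "vec nc x = 0\<^sub>v nc" by (intro inj) auto
    have "x j = 0" for j
    proof (cases "j < nc")
      case True
      then have "vec nc x $ j = 0" using z by simp
      then show ?thesis using True by simp
    qed (use x in auto)
    then show "x = 0" by (simp add: fun_eq_iff)
  qed
  then obtain g where g: "Vector_Spaces.linear sc sc g" "\<And>x. x \<in> ?S \<Longrightarrow> g (f x) = x"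
    using pair.linear_exists_left_inverse_on[OF f S] by blast
  define e where "e j = (\<lambda>i. if i = j then 1 else 0 :: 'a)" for j :: nat
  define B where "B = mat nc nr (\<lambda>(i, j). g (e j) i)"
  have "B * A = 1\<^sub>m nc"
  proof (rule eq_matI)
    fix i k assume ik: "i < dim_row (1\<^sub>m nc :: 'a mat)" "k < dim_col (1\<^sub>m nc :: 'a mat)"
    then have ik: "i < nc" "k < nc" by auto
    have "f (e k) = (\<Sum>j<nr. sc (A $$ (j, k)) (e j))"
    proof
      fix l
      have "(\<Sum>j<nr. sc (A $$ (j, k)) (e j)) l = (\<Sum>j<nr. if l = j then A $$ (j, k) else 0)"
        unfolding sum_fun_apply by (intro sum.cong) (auto simp: sc_def e_def)
      also have "\<dots> = (if l < nr then A $$ (l, k) else 0)" by simp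
      also have "\<dots> = f (e k) l"
        using ik by (auto simp: f_def e_def if_distrib[of "\<lambda>x. _ * x"] cong: if_cong)
      finally show "f (e k) l = (\<Sum>j<nr. sc (A $$ (j, k)) (e j)) l" by simp
    qed
    then have "g (f (e k)) = (\<Sum>j<nr. sc (A $$ (j, k)) (g (e j)))"
      by (simp add: pair.linear_sum[OF g(1)] pair.linear_scale[OF g(1)])
    moreover have "g (f (e k)) = e k" using ik by (intro g(2)) (auto simp: e_def)
    ultimately have "e k i = (\<Sum>j<nr. A $$ (j, k) * g (e j) i)"
      by (simp add: sum_fun_apply sc_def)
    moreover have "(B * A) $$ (i, k) = (\<Sum>j<nr. g (e j) i * A $$ (j, k))"
      using ik A by (simp add: B_def scalar_prod_def lessThan_atLeast0)
    ultimately show "(B * A) $$ (i, k) = 1\<^sub>m nc $$ (i, k)" using ik by (simp add: e_def mult.commute)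
  qed (use A in \<open>auto simp: B_def\<close>)
  then show ?thesis by (intro bexI[of _ B]) (simp_all add: B_def)
qed

text \<open>For a fixed \<open>B\<close> the condition is a single determinant, polynomial in the
  entries of \<open>A\<close>. In this form full rank survives small changes and can be studied
  along a line of matrices; \<open>mat_rank_eq_dim_colI\<close> is the counterpart for
  columns.\<close>

lemma mat_rank_eq_dim_rowI:
  fixes A :: "'a::field mat"
  assumes A: "A \<in> carrier_mat nr nc" and B: "B \<in> carrier_mat nc nr" and det: "det (A * B) \<noteq> 0"
  shows "mat_rank A = nr"
proof -
  have AB: "A * B \<in> carrier_mat nr nr" using A B by simp
  obtain C where C: "C \<in> carrier_mat nr nr" "(A * B) * C = 1\<^sub>m nr"
    using det_non_zero_imp_unit[OF AB det, of "()"]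
    unfolding Units_def ring_mat_simps by blast
  have "\<exists>x\<in>carrier_vec nc. A *\<^sub>v x = y" if y: "y \<in> carrier_vec nr" for y
  proof (rule bexI)
    have Cy: "C *\<^sub>v y \<in> carrier_vec nr" using C y by simp
    have "A *\<^sub>v (B *\<^sub>v (C *\<^sub>v y)) = (A * B) *\<^sub>v (C *\<^sub>v y)"
      by (rule assoc_mult_mat_vec[OF A B Cy, symmetric])
    also have "\<dots> = ((A * B) * C) *\<^sub>v y"
      by (rule assoc_mult_mat_vec[OF AB C(1) y, symmetric])
    also have "\<dots> = y" unfolding C(2) using y by simp
    finally show "A *\<^sub>v (B *\<^sub>v (C *\<^sub>v y)) = y" .
    show "B *\<^sub>v (C *\<^sub>v y) \<in> carrier_vec nc" using B Cy by simp
  qed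
  then show ?thesis using mat_rank_eq_dim_row_iff[of A] A by auto
qed

lemma mat_rank_eq_dim_colI:
  fixes A :: "'a::field mat"
  assumes A: "A \<in> carrier_mat nr nc" and B: "B \<in> carrier_mat nc nr" and det: "det (B * A) \<noteq> 0"
  shows "mat_rank A = nc"
proof -
  have BA: "B * A \<in> carrier_mat nc nc" using A B by simp
  have "x = 0\<^sub>v nc" if x: "x \<in> carrier_vec nc" "A *\<^sub>v x = 0\<^sub>v nr" for x
  proof (rule ccontr)
    assume nz: "x \<noteq> 0\<^sub>v nc"
    have "(B * A) *\<^sub>v x = B *\<^sub>v (A *\<^sub>v x)" using A B x by (simp add: assoc_mult_mat_vec)
    also have "\<dots> = 0\<^sub>v nc" unfolding x(2) using B by (intro eq_vecI) auto
    finally have "det (B * A) = 0"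
      unfolding det_0_iff_vec_prod_zero_field[OF BA] using x(1) nz by (intro exI[of _ x] conjI)
    with det show False by (rule notE)
  qed
  then show ?thesis using mat_rank_eq_dim_col_iff[of A] A by auto
qed

subsection \<open>Sylvester matrices as linear maps\<close>

definition mat_app :: "'a::comm_semiring_0 poly mat \<Rightarrow> (nat \<Rightarrow> 'a poly) \<Rightarrow> nat \<Rightarrow> 'a poly" where
  "mat_app M x = (\<lambda>i. if i < dim_row M then \<Sum>l<dim_col M. M $$ (i, l) * x l else 0)"

lemma smult_sum_right: "Polynomial.smult c (sum f A) = (\<Sum>x\<in>A. Polynomial.smult c (f x))"
  by (induction A rule: infinite_finite_induct) (simp_all add: smult_add_right)

lemma linear_mat_app: "Vector_Spaces.linear pscale pscale (mat_app M)"
  unfolding Vector_Spaces.linear_iff using pv.vector_space_axioms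
  by (auto simp: mat_app_def pscale_def fun_eq_iff algebra_simps sum.distrib smult_sum_right)

lemma mat_app_bounded:
  assumes M: "M \<in> row_bounded_mats m n d" and x: "x \<in> bounded_vecs (m + n) (\<lambda>_. k)"
  shows "mat_app M x \<in> bounded_vecs m (\<lambda>i. k + d ! i)"
proof -
  have dims: "dim_row M = m" "dim_col M = m + n" using M by (auto simp: row_bounded_mats_def)
  have "coeff (mat_app M x i) j = 0" if "i < m" "j \<ge> k + d ! i" for i j
  proof -
    have "coeff (M $$ (i, l) * x l) j = 0" if l: "l < m + n" for l
      unfolding coeff_mult
    proof (rule sum.neutral, rule ballI)
      fix s assume "s \<in> {..j}"
      have "degree (M $$ (i, l)) \<le> d ! i" using M \<open>i < m\<close> l by (auto simp: row_bounded_mats_def)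
      moreover have "coeff (x l) (j - s) = 0" if "j - s \<ge> k"
        using x that by (simp add: bounded_vecs_def)
      ultimately show "coeff (M $$ (i, l)) s * coeff (x l) (j - s) = 0"
        using \<open>j \<ge> k + d ! i\<close> by (cases "s \<le> d ! i") (auto simp: coeff_eq_0)
    qed
    then show ?thesis using \<open>i < m\<close> by (simp add: mat_app_def dims coeff_sum)
  qed
  then show ?thesis by (auto simp: bounded_vecs_def mat_app_def dims)
qed

lemma sum_div_mod:
  fixes f :: "nat \<Rightarrow> nat \<Rightarrow> 'b::comm_monoid_add"
  shows "(\<Sum>c<k * q. f (c div q) (c mod q)) = (\<Sum>j<k. \<Sum>l<q. f j l)"
proof (cases "q = 0")
  case False
  have "(\<Sum>j<k. \<Sum>l<q. f j l) = (\<Sum>(j, l)\<in>{..<k} \<times> {..<q}. f j l)"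
    by (simp add: sum.cartesian_product)
  also have "\<dots> = (\<Sum>c<k * q. f (c div q) (c mod q))"
  proof (rule sum.reindex_bij_witness[where j = "\<lambda>(j, l). j * q + l" and i = "\<lambda>c. (c div q, c mod q)"])
    fix a assume "a \<in> {..<k} \<times> {..<q}"
    then obtain j l where a: "a = (j, l)" "j < k" "l < q" by auto
    have "j * q + l < Suc j * q" using a by simp
    also have "\<dots> \<le> k * q" using a by (intro mult_right_mono) auto
    finally show "(case a of (j, l) \<Rightarrow> j * q + l) \<in> {..<k * q}" using a by simp
  qed (use False in \<open>auto simp: less_mult_imp_div_less\<close>)
  finally show ?thesis by simp
qed simp

text \<open>Block column \<open>j\<close> of the Sylvester matrix multiplies the coefficients at
  degree \<open>j\<close>, hence the index \<open>j * q + l\<close> for component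
  \<open>l\<close>.\<close>

definition vec_to_pvec :: "nat \<Rightarrow> nat \<Rightarrow> 'a::comm_monoid_add vec \<Rightarrow> nat \<Rightarrow> 'a poly" where
  "vec_to_pvec q k v = (\<lambda>l. if l < q then \<Sum>j<k. monom (v $ (j * q + l)) j else 0)"

lemma coeff_vec_to_pvec: "coeff (vec_to_pvec q k v l) j = (if l < q \<and> j < k then v $ (j * q + l) else 0)"
  by (simp add: vec_to_pvec_def coeff_sum)

lemma vec_to_pvec_bounded: "vec_to_pvec q k v \<in> bounded_vecs q (\<lambda>_. k)"
  by (auto simp: bounded_vecs_def coeff_vec_to_pvec)

lemma vec_to_pvec_inverse:
  assumes "x \<in> bounded_vecs q (\<lambda>_. k)"
  shows "vec_to_pvec q k (vec (k * q) (\<lambda>c. coeff (x (c mod q)) (c div q))) = x"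
proof (intro ext poly_eqI)
  fix l j
  show "coeff (vec_to_pvec q k (vec (k * q) (\<lambda>c. coeff (x (c mod q)) (c div q))) l) j = coeff (x l) j"
  proof (cases "l < q \<and> j < k")
    case True
    have "j * q + l < Suc j * q" using True by simp
    also have "\<dots> \<le> k * q" using True by (intro mult_right_mono) auto
    finally show ?thesis using True by (simp add: coeff_vec_to_pvec)
  next
    case False
    then show ?thesis using assms unfolding coeff_vec_to_pvec bounded_vecs_def by auto
  qed
qed

locale row_bounded =
  fixes m n :: nat and d :: "nat list" and M :: "'a::field poly mat"
  assumes M: "M \<in> row_bounded_mats m n d" and len: "length d = m"
begin

text \<open>Row \<open>j * m + i\<close> of the product is the coefficient at degree
  \<open>j\<close> of component \<open>i\<close>. The rows kept are those with
  \<open>j < k + d ! i\<close>, the degrees that can occur.\<close>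

definition rows_kept :: "nat \<Rightarrow> nat set" where
  "rows_kept k = {r. r div m < k + Max (set d) - (Max (set d) - d ! (r mod m))}"

lemma dims: "dim_row M = m" "dim_col M = m + n" using M by (auto simp: row_bounded_mats_def)

lemma d_le_Max: "i < m \<Longrightarrow> d ! i \<le> Max (set d)" using len by simp

lemma rows_kept_iff: "m > 0 \<Longrightarrow> r \<in> rows_kept k \<longleftrightarrow> r div m < k + d ! (r mod m)"
  using d_le_Max[of "r mod m"] by (auto simp: rows_kept_def)

lemma rows_kept_less:
  assumes "m > 0" "r \<in> rows_kept k"
  shows "r < (k + Max (set d)) * m"
proof -
  have "r div m < k + Max (set d)"
    using assms d_le_Max[of "r mod m"] rows_kept_iff by fastforce
  then show ?thesis using assms(1) by (simp add: div_less_iff_less_mult)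
qed

lemma finite_rows_kept: "m > 0 \<Longrightarrow> finite (rows_kept k)"
  by (rule finite_subset[of _ "{..<(k + Max (set d)) * m}"]) (auto dest: rows_kept_less)

lemma card_rows_kept:
  assumes m: "m > 0"
  shows "card (rows_kept k) = k * m + sum_list d"
proof -
  have "bij_betw (\<lambda>r. (r mod m, r div m)) (rows_kept k) (SIGMA i:{..<m}. {..<k + d ! i})"
    by (rule bij_betw_byWitness[where f' = "\<lambda>(i, j). j * m + i"]) (use m in \<open>auto simp: rows_kept_iff\<close>)
  then have "card (rows_kept k) = (\<Sum>i<m. k + d ! i)" by (simp add: bij_betw_same_card)
  also have "\<dots> = k * m + sum_list d"
    using len by (simp add: sum.distrib sum_list_sum_nth lessThan_atLeast0)
  finally show ?thesis .
qed

lemma trimmed_sylvester_mat_eq: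
  assumes m: "m > 0"
  shows "trimmed_sylvester_mat d k M = mat (card (rows_kept k)) (k * (m + n)) (\<lambda>(p, c).
    let a = pick (rows_kept k) p div m; i = pick (rows_kept k) p mod m; j = c div (m + n) in
    if j \<le> a \<and> a - j \<le> Max (set d) then coeff (M $$ (i, c mod (m + n))) (a - j) else 0)"
proof -
  have R: "{i. i < (k + Max (set d)) * m \<and> i \<in> rows_kept k} = rows_kept k"
    using rows_kept_less[OF m] by auto
  show ?thesis
    unfolding trimmed_sylvester_mat_def Let_def dims rows_kept_def[symmetric] submatrix_def
  proof (rule eq_matI)
    fix p c
    assume p: "p < dim_row (mat (card (rows_kept k)) (k * (m + n)) (\<lambda>(p, c).
        if c div (m + n) \<le> pick (rows_kept k) p div m \<and> pick (rows_kept k) p div m - c div (m + n) \<le> Max (set d)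
        then coeff (M $$ (pick (rows_kept k) p mod m, c mod (m + n))) (pick (rows_kept k) p div m - c div (m + n)) else 0))"
      and c: "c < dim_col (mat (card (rows_kept k)) (k * (m + n)) (\<lambda>(p, c).
        if c div (m + n) \<le> pick (rows_kept k) p div m \<and> pick (rows_kept k) p div m - c div (m + n) \<le> Max (set d)
        then coeff (M $$ (pick (rows_kept k) p mod m, c mod (m + n))) (pick (rows_kept k) p div m - c div (m + n)) else 0))"
    have "pick (rows_kept k) p \<in> rows_kept k" using p by (intro pick_in_set_le) simp
    then have "pick (rows_kept k) p < (k + Max (set d)) * m" by (rule rows_kept_less[OF m])
    then show "mat (card {i. i < dim_row (sylvester_mat (Max (set d)) k M) \<and> i \<in> rows_kept k})
         (card {j. j < dim_col (sylvester_mat (Max (set d)) k M) \<and> j \<in> UNIV})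
         (\<lambda>(i, j). sylvester_mat (Max (set d)) k M $$ (pick (rows_kept k) i, pick UNIV j)) $$ (p, c) =
         mat (card (rows_kept k)) (k * (m + n)) (\<lambda>(p, c).
        if c div (m + n) \<le> pick (rows_kept k) p div m \<and> pick (rows_kept k) p div m - c div (m + n) \<le> Max (set d)
        then coeff (M $$ (pick (rows_kept k) p mod m, c mod (m + n))) (pick (rows_kept k) p div m - c div (m + n)) else 0) $$ (p, c)"
      using p c by (simp add: sylvester_mat_def Let_def dims R pick_UNIV)
  qed (auto simp: sylvester_mat_def Let_def dims R)
qed

lemma dim_trimmed_sylvester_mat:
  assumes "m > 0"
  shows "dim_row (trimmed_sylvester_mat d k M) = card (rows_kept k)"
    "dim_col (trimmed_sylvester_mat d k M) = k * (m + n)"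
  by (simp_all add: trimmed_sylvester_mat_eq[OF assms])

text \<open>Row times vector is a convolution of coefficient sequences. The grade test
  \<open>a - j \<le> Max (set d)\<close> loses nothing, since by \<open>big\<close> the coefficients
  of \<open>M\<close> beyond it vanish.\<close>

lemma trimmed_sylvester_mult:
  assumes m: "m > 0" and v: "v \<in> carrier_vec (k * (m + n))" and p: "p < card (rows_kept k)"
  shows "(trimmed_sylvester_mat d k M *\<^sub>v v) $ p =
    coeff (mat_app M (vec_to_pvec (m + n) k v) (pick (rows_kept k) p mod m)) (pick (rows_kept k) p div m)"
proof -
  define a where "a = pick (rows_kept k) p div m"
  define i where "i = pick (rows_kept k) p mod m"
  let ?q = "m + n" and ?D = "Max (set d)"
  have i: "i < m" using m by (simp add: i_def)
  have big: "coeff (M $$ (i, l)) s = 0" if "l < ?q" "s > ?D" for l s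
  proof (rule coeff_eq_0)
    have "degree (M $$ (i, l)) \<le> d ! i" using M i that(1) by (auto simp: row_bounded_mats_def)
    then show "degree (M $$ (i, l)) < s" using d_le_Max[OF i] that(2) by linarith
  qed
  have "(trimmed_sylvester_mat d k M *\<^sub>v v) $ p = (\<Sum>c<k * ?q.
      (if c div ?q \<le> a \<and> a - c div ?q \<le> ?D then coeff (M $$ (i, c mod ?q)) (a - c div ?q) else 0) * v $ c)"
    unfolding a_def i_def using p v
    by (simp add: trimmed_sylvester_mat_eq[OF m] scalar_prod_def Let_def lessThan_atLeast0)
  also have "\<dots> = (\<Sum>c<k * ?q. (\<lambda>j l. (if j \<le> a then coeff (M $$ (i, l)) (a - j) else 0) * v $ (j * ?q + l)) (c div ?q) (c mod ?q))"
  proof (rule sum.cong[OF refl])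
    fix c assume "c \<in> {..<k * ?q}"
    have "c mod ?q < ?q" using m by simp
    then show "(if c div ?q \<le> a \<and> a - c div ?q \<le> ?D then coeff (M $$ (i, c mod ?q)) (a - c div ?q) else 0) * v $ c
      = (\<lambda>j l. (if j \<le> a then coeff (M $$ (i, l)) (a - j) else 0) * v $ (j * ?q + l)) (c div ?q) (c mod ?q)"
      using big[of "c mod ?q" "a - c div ?q"] by (auto simp: div_mult_mod_eq[of c ?q])
  qed
  also have "\<dots> = (\<Sum>j<k. \<Sum>l<?q. (if j \<le> a then coeff (M $$ (i, l)) (a - j) else 0) * v $ (j * ?q + l))"
    by (rule sum_div_mod)
  also have "\<dots> = (\<Sum>l<?q. \<Sum>j<k. (if j \<le> a then coeff (M $$ (i, l)) (a - j) else 0) * v $ (j * ?q + l))"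
    by (rule sum.swap)
  also have "\<dots> = (\<Sum>l<?q. coeff (M $$ (i, l) * vec_to_pvec ?q k v l) a)"
  proof (rule sum.cong[OF refl])
    fix l assume l: "l \<in> {..<?q}"
    have "coeff (M $$ (i, l) * vec_to_pvec ?q k v l) a
        = (\<Sum>j\<le>a. coeff (vec_to_pvec ?q k v l) j * coeff (M $$ (i, l)) (a - j))"
      by (subst mult.commute) (simp add: coeff_mult)
    also have "\<dots> = (\<Sum>j\<in>{..a} \<inter> {..<k}. v $ (j * ?q + l) * coeff (M $$ (i, l)) (a - j))"
      using l by (intro sum.mono_neutral_cong_right) (auto simp: coeff_vec_to_pvec)
    also have "\<dots> = (\<Sum>j<k. (if j \<le> a then coeff (M $$ (i, l)) (a - j) else 0) * v $ (j * ?q + l))"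
      by (intro sum.mono_neutral_cong_left) auto
    finally show "(\<Sum>j<k. (if j \<le> a then coeff (M $$ (i, l)) (a - j) else 0) * v $ (j * ?q + l))
        = coeff (M $$ (i, l) * vec_to_pvec ?q k v l) a" ..
  qed
  also have "\<dots> = coeff (mat_app M (vec_to_pvec ?q k v) i) a"
    using i by (simp add: mat_app_def dims coeff_sum)
  finally show ?thesis unfolding a_def i_def .
qed

definition syl_surj :: "nat \<Rightarrow> bool" where
  "syl_surj k \<longleftrightarrow> (\<forall>y\<in>bounded_vecs m (\<lambda>i. k + d ! i). \<exists>x\<in>bounded_vecs (m + n) (\<lambda>_. k). mat_app M x = y)"

definition syl_inj :: "nat \<Rightarrow> bool" where
  "syl_inj k \<longleftrightarrow> (\<forall>x\<in>bounded_vecs (m + n) (\<lambda>_. k). mat_app M x = 0 \<longrightarrow> x = 0)"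

text \<open>\<open>p\<close> counts the kept rows before row \<open>j * m + i\<close> and is
  therefore its position after the deletion, the inverse of \<open>pick\<close>.\<close>

lemma pick_rows_kept_index:
  assumes m: "m > 0" and "i < m" "j < k + d ! i"
  defines "p \<equiv> card {a \<in> rows_kept k. a < j * m + i}"
  shows "p < card (rows_kept k)" "pick (rows_kept k) p = j * m + i"
proof -
  have r: "j * m + i \<in> rows_kept k" using assms by (simp add: rows_kept_iff)
  show "pick (rows_kept k) p = j * m + i" unfolding p_def using r by (rule pick_card_in_set)
  have "{a \<in> rows_kept k. a < j * m + i} \<subset> rows_kept k" using r by auto
  then show "p < card (rows_kept k)" unfolding p_def by (rule psubset_card_mono[OF finite_rows_kept[OF m]])
qed

lemma bounded_vecs_eqI:
  assumes m: "m > 0" and x: "x \<in> bounded_vecs m (\<lambda>i. k + d ! i)" and y: "y \<in> bounded_vecs m (\<lambda>i. k + d ! i)"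
    and eq: "\<And>p. p < card (rows_kept k) \<Longrightarrow>
      coeff (x (pick (rows_kept k) p mod m)) (pick (rows_kept k) p div m) =
      coeff (y (pick (rows_kept k) p mod m)) (pick (rows_kept k) p div m)"
  shows "x = y"
proof (intro ext poly_eqI)
  fix i j
  show "coeff (x i) j = coeff (y i) j"
  proof (cases "i < m \<and> j < k + d ! i")
    case True
    then have "i < m" "j < k + d ! i" by auto
    from eq[OF pick_rows_kept_index(1)[OF m this]] pick_rows_kept_index(2)[OF m this] show ?thesis
      using \<open>i < m\<close> by simp
  next
    case False
    then have "coeff (x i) j = 0" "coeff (y i) j = 0" using x y unfolding bounded_vecs_def by auto
    then show ?thesis by simp
  qed
qed

lemma rank_trimmed_sylvester_row_iff:
  assumes m: "m > 0"
  shows "mat_rank (trimmed_sylvester_mat d k M) = k * m + sum_list d \<longleftrightarrow> syl_surj k"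
proof -
  let ?R = "rows_kept k" and ?T = "trimmed_sylvester_mat d k M" and ?q = "m + n"
  have "mat_rank ?T = k * m + sum_list d \<longleftrightarrow>
      (\<forall>y\<in>carrier_vec (card ?R). \<exists>v\<in>carrier_vec (k * ?q). ?T *\<^sub>v v = y)"
    using mat_rank_eq_dim_row_iff[of ?T] by (simp add: dim_trimmed_sylvester_mat[OF m] card_rows_kept[OF m])
  also have "\<dots> \<longleftrightarrow> syl_surj k"
    unfolding syl_surj_def
  proof (intro iffI ballI)
    fix y :: "nat \<Rightarrow> 'a poly" assume T: "\<forall>y\<in>carrier_vec (card ?R). \<exists>v\<in>carrier_vec (k * ?q). ?T *\<^sub>v v = y"
      and y: "y \<in> bounded_vecs m (\<lambda>i. k + d ! i)"
    obtain v where v: "v \<in> carrier_vec (k * ?q)"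
      "?T *\<^sub>v v = vec (card ?R) (\<lambda>p. coeff (y (pick ?R p mod m)) (pick ?R p div m))"
      using T[rule_format, of "vec (card ?R) (\<lambda>p. coeff (y (pick ?R p mod m)) (pick ?R p div m))"] by auto
    have "mat_app M (vec_to_pvec ?q k v) = y"
    proof (rule bounded_vecs_eqI[OF m mat_app_bounded[OF M vec_to_pvec_bounded] y])
      fix p assume p: "p < card ?R"
      show "coeff (mat_app M (vec_to_pvec ?q k v) (pick ?R p mod m)) (pick ?R p div m)
          = coeff (y (pick ?R p mod m)) (pick ?R p div m)"
        unfolding trimmed_sylvester_mult[OF m v(1) p, symmetric] v(2) using p by simp
    qed
    then show "\<exists>x\<in>bounded_vecs ?q (\<lambda>_. k). mat_app M x = y"
      by (intro bexI[of _ "vec_to_pvec ?q k v"] vec_to_pvec_bounded)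
  next
    fix y :: "'a vec" assume S: "\<forall>y\<in>bounded_vecs m (\<lambda>i. k + d ! i). \<exists>x\<in>bounded_vecs ?q (\<lambda>_. k). mat_app M x = y"
      and y: "y \<in> carrier_vec (card ?R)"
    define Y where "Y i = (if i < m then \<Sum>j<k + d ! i. monom (y $ card {a \<in> ?R. a < j * m + i}) j else 0)" for i
    have cY: "coeff (Y i) j = (if i < m \<and> j < k + d ! i then y $ card {a \<in> ?R. a < j * m + i} else 0)" for i j
      by (simp add: Y_def coeff_sum)
    have "Y \<in> bounded_vecs m (\<lambda>i. k + d ! i)" by (auto simp: bounded_vecs_def cY)
    then obtain x where x: "x \<in> bounded_vecs ?q (\<lambda>_. k)" "mat_app M x = Y" using S by blast
    let ?v = "vec (k * ?q) (\<lambda>c. coeff (x (c mod ?q)) (c div ?q))"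
    have v: "?v \<in> carrier_vec (k * ?q)" by simp
    have "?T *\<^sub>v ?v = y"
    proof (rule eq_vecI)
      fix p assume "p < dim_vec y"
      then have p: "p < card ?R" using y by simp
      have "pick ?R p \<in> ?R" by (rule pick_in_set_le[OF p])
      moreover have "card {a \<in> ?R. a < pick ?R p} = p" by (rule card_pick_le[OF p])
      ultimately have "coeff (Y (pick ?R p mod m)) (pick ?R p div m) = y $ p"
        using m by (simp add: cY rows_kept_iff)
      then show "(?T *\<^sub>v ?v) $ p = y $ p"
        unfolding trimmed_sylvester_mult[OF m v p] vec_to_pvec_inverse[OF x(1)] x(2) .
    qed (use y in \<open>simp add: dim_trimmed_sylvester_mat[OF m]\<close>)
    then show "\<exists>v\<in>carrier_vec (k * ?q). ?T *\<^sub>v v = y" using v by (intro bexI[of _ ?v])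
  qed
  finally show ?thesis .
qed

lemma rank_trimmed_sylvester_col_iff:
  assumes m: "m > 0"
  shows "mat_rank (trimmed_sylvester_mat d k M) = k * (m + n) \<longleftrightarrow> syl_inj k"
proof -
  let ?R = "rows_kept k" and ?T = "trimmed_sylvester_mat d k M" and ?q = "m + n"
  have eq: "?T *\<^sub>v v = 0\<^sub>v (card ?R) \<longleftrightarrow> mat_app M (vec_to_pvec ?q k v) = 0" if v: "v \<in> carrier_vec (k * ?q)" for v
  proof
    assume T: "?T *\<^sub>v v = 0\<^sub>v (card ?R)"
    show "mat_app M (vec_to_pvec ?q k v) = 0"
    proof (rule bounded_vecs_eqI[OF m mat_app_bounded[OF M vec_to_pvec_bounded] pv.subspace_0[OF subspace_bounded_vecs]])
      fix p assume p: "p < card ?R"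
      show "coeff (mat_app M (vec_to_pvec ?q k v) (pick ?R p mod m)) (pick ?R p div m)
          = coeff (0 (pick ?R p mod m)) (pick ?R p div m)"
        unfolding trimmed_sylvester_mult[OF m v p, symmetric] T using p by simp
    qed
  next
    assume "mat_app M (vec_to_pvec ?q k v) = 0"
    then show "?T *\<^sub>v v = 0\<^sub>v (card ?R)"
      using trimmed_sylvester_mult[OF m v] by (intro eq_vecI) (auto simp: dim_trimmed_sylvester_mat[OF m])
  qed
  have "mat_rank ?T = k * ?q \<longleftrightarrow>
      (\<forall>v\<in>carrier_vec (k * ?q). ?T *\<^sub>v v = 0\<^sub>v (card ?R) \<longrightarrow> v = 0\<^sub>v (k * ?q))"
    using mat_rank_eq_dim_col_iff[of ?T] by (simp add: dim_trimmed_sylvester_mat[OF m])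
  also have "\<dots> \<longleftrightarrow> syl_inj k"
    unfolding syl_inj_def
  proof (intro iffI ballI impI)
    fix x :: "nat \<Rightarrow> 'a poly"
    assume T: "\<forall>v\<in>carrier_vec (k * ?q). ?T *\<^sub>v v = 0\<^sub>v (card ?R) \<longrightarrow> v = 0\<^sub>v (k * ?q)"
      and x: "x \<in> bounded_vecs ?q (\<lambda>_. k)" "mat_app M x = 0"
    let ?v = "vec (k * ?q) (\<lambda>c. coeff (x (c mod ?q)) (c div ?q))"
    have v: "?v \<in> carrier_vec (k * ?q)" by simp
    have "?v = 0\<^sub>v (k * ?q)" using T v eq[OF v] vec_to_pvec_inverse[OF x(1)] x(2) by simp
    then have "vec_to_pvec ?q k ?v = vec_to_pvec ?q k (0\<^sub>v (k * ?q))" by (rule arg_cong)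
    also have "\<dots> = 0"
    proof (intro ext poly_eqI)
      fix l j
      have "j * ?q + l < k * ?q" if "l < ?q" "j < k"
      proof -
        have "j * ?q + l < Suc j * ?q" using that by simp
        also have "\<dots> \<le> k * ?q" using that by (intro mult_right_mono) auto
        finally show ?thesis .
      qed
      then show "coeff (vec_to_pvec ?q k (0\<^sub>v (k * ?q)) l) j = coeff (0 l) j"
        by (auto simp: coeff_vec_to_pvec)
    qed
    finally show "x = 0" unfolding vec_to_pvec_inverse[OF x(1)] .
  next
    fix v assume S: "\<forall>x\<in>bounded_vecs ?q (\<lambda>_. k). mat_app M x = 0 \<longrightarrow> x = 0"
      and v: "v \<in> carrier_vec (k * ?q)" "?T *\<^sub>v v = 0\<^sub>v (card ?R)"
    have z: "vec_to_pvec ?q k v = 0" using S eq[OF v(1)] v(2) vec_to_pvec_bounded by blast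
    show "v = 0\<^sub>v (k * ?q)"
    proof (rule eq_vecI)
      fix c assume "c < dim_vec (0\<^sub>v (k * ?q) :: 'a vec)"
      then have c: "c < k * ?q" by simp
      then have "c div ?q < k" "c mod ?q < ?q" using m by (auto simp: less_mult_imp_div_less)
      then have "coeff (vec_to_pvec ?q k v (c mod ?q)) (c div ?q) = v $ c"
        by (simp add: coeff_vec_to_pvec div_mult_mod_eq[of c ?q])
      then show "v $ c = 0\<^sub>v (k * ?q) $ c" using z c by simp
    qed (use v in simp)
  qed
  finally show ?thesis .
qed

end

section \<open>Dependence on the order and the two critical orders\<close>

lemma bounded_vecs_mono: "(\<And>i. i < q \<Longrightarrow> b i \<le> b' i) \<Longrightarrow> bounded_vecs q b \<subseteq> bounded_vecs q b'"
  unfolding bounded_vecs_def by (auto simp: not_le) (metis le_trans not_le)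

lemma mat_app_mult: "mat_app M (\<lambda>l. p * x l) = (\<lambda>i. p * mat_app M x i)"
  by (auto simp: mat_app_def fun_eq_iff sum_distrib_left mult.left_commute)

lemma mat_app_add: "mat_app M (x + y) = mat_app M x + mat_app M y"
  by (auto simp: mat_app_def fun_eq_iff sum.distrib distrib_left)

lemma monom_mult_bounded:
  fixes x :: "nat \<Rightarrow> 'a::comm_semiring_1 poly"
  assumes "x \<in> bounded_vecs q b"
  shows "(\<lambda>l. monom c s * x l) \<in> bounded_vecs q (\<lambda>i. b i + s)"
  using assms by (auto simp: bounded_vecs_def coeff_monom_mult)

context row_bounded
begin

lemma syl_inj_antimono: "k \<le> k' \<Longrightarrow> syl_inj k' \<Longrightarrow> syl_inj k"
  using bounded_vecs_mono[of "m + n" "\<lambda>_. k" "\<lambda>_. k'"] unfolding syl_inj_def by blast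

lemma syl_inj_0: "syl_inj 0"
  unfolding syl_inj_def bounded_vecs_def by (auto simp: fun_eq_iff poly_eq_iff)

text \<open>\<open>y\<close> is its constant part \<open>y0\<close> plus \<lambda> times the shift
  \<open>y1\<close>; both lie in the target of order \<open>k\<close> and are solved there.
  \<open>k \<ge> 1\<close> is what admits the constant part in rows with
  \<open>d ! i = 0\<close>.\<close>

lemma syl_surj_Suc:
  assumes "k \<ge> 1" "syl_surj k"
  shows "syl_surj (Suc k)"
  unfolding syl_surj_def
proof
  fix y :: "nat \<Rightarrow> 'a poly" assume y: "y \<in> bounded_vecs m (\<lambda>i. Suc k + d ! i)"
  define y0 where "y0 i = monom (coeff (y i) 0) 0" for i
  define y1 where "y1 i = poly_shift 1 (y i)" for i
  have c0: "coeff (y0 i) j = (if j = 0 then coeff (y i) 0 else 0)" for i j by (simp add: y0_def)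
  have c1: "coeff (y1 i) j = coeff (y i) (Suc j)" for i j by (simp add: y1_def coeff_poly_shift)
  have "y0 \<in> bounded_vecs m (\<lambda>i. k + d ! i)"
    using y \<open>k \<ge> 1\<close> by (auto simp: bounded_vecs_def c0)
  then obtain x0 where x0: "x0 \<in> bounded_vecs (m + n) (\<lambda>_. k)" "mat_app M x0 = y0"
    using assms(2) unfolding syl_surj_def by blast
  have "y1 \<in> bounded_vecs m (\<lambda>i. k + d ! i)"
    using y by (auto simp: bounded_vecs_def c1)
  then obtain x1 where x1: "x1 \<in> bounded_vecs (m + n) (\<lambda>_. k)" "mat_app M x1 = y1"
    using assms(2) unfolding syl_surj_def by blast
  let ?x = "x0 + (\<lambda>l. monom 1 1 * x1 l)"
  have "mat_app M ?x = y0 + (\<lambda>i. monom 1 1 * y1 i)"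
    by (simp only: mat_app_add mat_app_mult x0 x1)
  also have "\<dots> = y"
    by (intro ext poly_eqI) (auto simp: c0 c1 coeff_monom_mult)
  finally have "mat_app M ?x = y" .
  moreover have "x0 \<in> bounded_vecs (m + n) (\<lambda>_. Suc k)"
    using x0(1) bounded_vecs_mono[of "m + n" "\<lambda>_. k" "\<lambda>_. Suc k"] by auto
  then have "?x \<in> bounded_vecs (m + n) (\<lambda>_. Suc k)"
    using monom_mult_bounded[OF x1(1), of 1 1] by (intro pv.subspace_add[OF subspace_bounded_vecs]) simp_all
  ultimately show "\<exists>x\<in>bounded_vecs (m + n) (\<lambda>_. Suc k). mat_app M x = y" by (intro bexI[of _ ?x])
qed

lemma syl_surj_mono:
  assumes "k \<ge> 1" "syl_surj k" "k \<le> k'"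
  shows "syl_surj k'"
  using assms(3)
proof (induction k' rule: dec_induct)
  case (step j)
  then show ?case using assms(1) by (intro syl_surj_Suc) auto
qed (rule assms(2))

text \<open>The minimum in the definition is the number of rows exactly when
  \<open>sum_list d \<le> k * n\<close>, and full row rank is surjectivity, full column rank
  injectivity.\<close>

lemma full_trimmed_sylvester_rank_iff:
  assumes "m > 0"
  shows "full_trimmed_sylvester_rank d M \<longleftrightarrow>
    (\<forall>k\<ge>1. if sum_list d \<le> k * n then syl_surj k else syl_inj k)"
proof -
  have "mat_rank (trimmed_sylvester_mat d k M) = min (k * m + sum_list d) (k * (m + n)) \<longleftrightarrow>
      (if sum_list d \<le> k * n then syl_surj k else syl_inj k)" for k
    using rank_trimmed_sylvester_row_iff[OF assms, of k] rank_trimmed_sylvester_col_iff[OF assms, of k]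
    by (simp add: min_def add_mult_distrib2)
  then show ?thesis by (simp add: full_trimmed_sylvester_rank_def dims)
qed

text \<open>The bound on \<open>t\<close> makes \<open>k'\<close> the least order with
  \<open>sum_list d \<le> k * n\<close>. The infinitely many rank conditions thus follow from two:
  surjectivity spreads upwards from \<open>k'\<close>, injectivity downwards from
  \<open>k' - 1\<close>.\<close>

lemma full_trimmed_sylvester_rank_iff_critical:
  assumes "m > 0" "k' \<ge> 1" "n * k' = sum_list d + t" "t < n"
  shows "full_trimmed_sylvester_rank d M \<longleftrightarrow> syl_surj k' \<and> syl_inj (k' - 1)"
proof
  have less: "(k' - 1) * n < sum_list d"
    using assms by (cases k') (simp_all add: algebra_simps)
  assume full: "full_trimmed_sylvester_rank d M"
  have "sum_list d \<le> k' * n" using assms(3) by (simp add: mult.commute)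
  then have "syl_surj k'"
    using full assms(2) unfolding full_trimmed_sylvester_rank_iff[OF assms(1)] by metis
  moreover have "syl_inj (k' - 1)"
  \<comment> \<open>Order 0 is outside the definition of full rank; injectivity holds there because
    only the zero vector satisfies the degree bound 0.\<close>
  proof (cases "k' = 1")
    case True
    then show ?thesis using syl_inj_0 by simp
  next
    case False
    then have "k' - 1 \<ge> 1" using assms(2) by simp
    then show ?thesis
      using full less unfolding full_trimmed_sylvester_rank_iff[OF assms(1)] by (metis not_le)
  qed
  ultimately show "syl_surj k' \<and> syl_inj (k' - 1)" ..
next
  have less: "(k' - 1) * n < sum_list d"
    using assms by (cases k') (simp_all add: algebra_simps)
  have le: "sum_list d \<le> k' * n" using assms(3) by (simp add: mult.commute)
  assume crit: "syl_surj k' \<and> syl_inj (k' - 1)"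
  show "full_trimmed_sylvester_rank d M"
    unfolding full_trimmed_sylvester_rank_iff[OF assms(1)]
  proof (intro allI impI)
    fix k :: nat assume "k \<ge> 1"
    show "if sum_list d \<le> k * n then syl_surj k else syl_inj k"
    proof (cases "sum_list d \<le> k * n")
      case True
      then have "(k' - 1) * n < k * n" using less by linarith
      then have "k' - 1 < k" by simp
      then have "k' \<le> k" by linarith
      with crit assms(2) True show ?thesis by (simp add: syl_surj_mono)
    next
      case False
      then have "k * n < k' * n" using le by linarith
      then have "k < k'" by simp
      then have "k \<le> k' - 1" by linarith
      with crit False show ?thesis using syl_inj_antimono by simp
    qed
  qed
qed

end

subsection \<open>Kernel vectors\<close>

text \<open>Coefficients are kept as constant polynomials, so that these vectors live in the same
  space as the others and \<open>pv\<close> and \<open>mat_app\<close> apply to them.\<close>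

definition coeff_vec :: "nat \<Rightarrow> (nat \<Rightarrow> 'a::zero poly) \<Rightarrow> nat \<Rightarrow> 'a poly" where
  "coeff_vec k x = (\<lambda>l. [:coeff (x l) k:])"

lemma linear_coeff_vec: "Vector_Spaces.linear pscale pscale (coeff_vec k)"
  unfolding Vector_Spaces.linear_iff using pv.vector_space_axioms
  by (auto simp: coeff_vec_def pscale_def fun_eq_iff)

lemma coeff_vec_bounded: "x \<in> bounded_vecs q b \<Longrightarrow> coeff_vec k x \<in> bounded_vecs q (\<lambda>_. 1)"
  by (auto simp: bounded_vecs_def coeff_vec_def coeff_pCons split: nat.splits)

lemma coeff_mult_top:
  fixes p r :: "'a::comm_semiring_0 poly"
  assumes "degree p \<le> a" and "\<And>j. j > b \<Longrightarrow> coeff r j = 0"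
  shows "coeff (p * r) (b + a) = coeff p a * coeff r b"
proof -
  have "coeff (p * r) (b + a) = (\<Sum>s\<in>{a}. coeff p s * coeff r (b + a - s))"
    unfolding coeff_mult
  proof (rule sum.mono_neutral_right)
    show "\<forall>s\<in>{..b + a} - {a}. coeff p s * coeff r (b + a - s) = 0"
    proof
      fix s assume "s \<in> {..b + a} - {a}"
      then show "coeff p s * coeff r (b + a - s) = 0"
        using assms by (cases "s < a") (auto simp: coeff_eq_0)
    qed
  qed auto
  then show ?thesis by simp
qed

context row_bounded
begin

definition lead_mat :: "'a poly mat" where
  "lead_mat = map_mat (\<lambda>a. [:a:]) (leading_row_coeff_mat d M)"

lemma lead_mat_app:
  "mat_app lead_mat c = (\<lambda>i. if i < m then \<Sum>l<m + n. Polynomial.smult (coeff (M $$ (i, l)) (d ! i)) (c l) else 0)"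
  by (auto simp: mat_app_def lead_mat_def leading_row_coeff_mat_def dims fun_eq_iff)

lemma lead_mat_app_bounded:
  "c \<in> bounded_vecs (m + n) (\<lambda>_. 1) \<Longrightarrow> mat_app lead_mat c \<in> bounded_vecs m (\<lambda>_. 1)"
  by (auto simp: lead_mat_app bounded_vecs_def coeff_sum)

text \<open>Degree \<open>k + d ! i\<close> is the largest one possible in row \<open>i\<close>, and
  only products of two top coefficients reach it.\<close>

lemma coeff_mat_app_top:
  assumes "x \<in> bounded_vecs (m + n) (\<lambda>_. Suc k)" "i < m"
  shows "coeff (mat_app M x i) (k + d ! i) = coeff (mat_app lead_mat (coeff_vec k x) i) 0"
proof -
  have "coeff (M $$ (i, l) * x l) (k + d ! i) = coeff (M $$ (i, l)) (d ! i) * coeff (x l) k" if "l < m + n" for l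
  proof (rule coeff_mult_top)
    show "degree (M $$ (i, l)) \<le> d ! i" using M assms(2) that by (auto simp: row_bounded_mats_def)
    show "coeff (x l) j = 0" if "k < j" for j using assms(1) that by (auto simp: bounded_vecs_def)
  qed
  then show ?thesis
    using assms(2) by (simp add: mat_app_def[of M] dims lead_mat_app coeff_sum coeff_vec_def)
qed

text \<open>The values of \<open>y\<close> are prescribed as top coefficients, at degree
  \<open>k - 1 + d ! i\<close>. A preimage of degree below \<open>k\<close> then has the vector
  sought as its coefficient at \<open>k - 1\<close>.\<close>

lemma lead_mat_surj:
  assumes "syl_surj k" "k \<ge> 1" and y: "y \<in> bounded_vecs m (\<lambda>_. 1)"
  shows "\<exists>c\<in>bounded_vecs (m + n) (\<lambda>_. 1). mat_app lead_mat c = y"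
proof -
  define Y where "Y i = (if i < m then monom (coeff (y i) 0) (k - 1 + d ! i) else 0)" for i
  have "Y \<in> bounded_vecs m (\<lambda>i. k + d ! i)" using assms(2) by (auto simp: bounded_vecs_def Y_def)
  then obtain x where x: "x \<in> bounded_vecs (m + n) (\<lambda>_. k)" "mat_app M x = Y"
    using assms(1) unfolding syl_surj_def by blast
  have x': "x \<in> bounded_vecs (m + n) (\<lambda>_. Suc (k - 1))" using x(1) assms(2) by simp
  have c: "coeff_vec (k - 1) x \<in> bounded_vecs (m + n) (\<lambda>_. 1)" by (rule coeff_vec_bounded[OF x(1)])
  have "mat_app lead_mat (coeff_vec (k - 1) x) = y"
  proof (intro ext poly_eqI)
    fix i j
    have "mat_app lead_mat (coeff_vec (k - 1) x) \<in> bounded_vecs m (\<lambda>_. 1)" by (rule lead_mat_app_bounded[OF c])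
    moreover have "coeff (mat_app lead_mat (coeff_vec (k - 1) x) i) 0 = coeff (y i) 0" if "i < m"
      using coeff_mat_app_top[OF x' that] that by (simp add: x(2) Y_def)
    ultimately show "coeff (mat_app lead_mat (coeff_vec (k - 1) x) i) j = coeff (y i) j"
      using y by (cases "i < m \<and> j = 0") (auto simp: bounded_vecs_def)
  qed
  with c show ?thesis by (intro bexI[of _ "coeff_vec (k - 1) x"])
qed

definition lead_ker :: "(nat \<Rightarrow> 'a poly) set" where
  "lead_ker = {c \<in> bounded_vecs (m + n) (\<lambda>_. 1). mat_app lead_mat c = 0}"

definition syl_ker :: "nat \<Rightarrow> (nat \<Rightarrow> 'a poly) set" where
  "syl_ker k = {x \<in> bounded_vecs (m + n) (\<lambda>_. k). mat_app M x = 0}"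

lemma dim_lead_ker:
  assumes "syl_surj k" "k \<ge> 1"
  shows "pv.dim lead_ker = n"
proof -
  have img: "mat_app lead_mat ` bounded_vecs (m + n) (\<lambda>_. 1) = bounded_vecs m (\<lambda>_. 1)"
  proof (intro subset_antisym subsetI)
    fix y :: "nat \<Rightarrow> 'a poly" assume "y \<in> bounded_vecs m (\<lambda>_. 1)"
    from lead_mat_surj[OF assms this] show "y \<in> mat_app lead_mat ` bounded_vecs (m + n) (\<lambda>_. 1)" by blast
  qed (auto intro: lead_mat_app_bounded simp del: One_nat_def)
  have "pv.dim (bounded_vecs (m + n) (\<lambda>_. 1) :: (nat \<Rightarrow> 'a poly) set)
      = pv.dim lead_ker + pv.dim (mat_app lead_mat ` bounded_vecs (m + n) (\<lambda>_. 1))"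
    unfolding lead_ker_def
    by (rule pvp.rank_nullity[OF linear_mat_app subspace_bounded_vecs bounded_vecs_basis(1) eq_refl[OF bounded_vecs_basis(3)]])
  then show ?thesis unfolding img dim_bounded_vecs by simp
qed

lemma dim_syl_ker:
  assumes "syl_surj k" "n * k = sum_list d + t"
  shows "pv.dim (syl_ker k) = t"
proof -
  have img: "mat_app M ` bounded_vecs (m + n) (\<lambda>_. k) = bounded_vecs m (\<lambda>i. k + d ! i)"
  proof (intro subset_antisym subsetI)
    fix y :: "nat \<Rightarrow> 'a poly" assume "y \<in> bounded_vecs m (\<lambda>i. k + d ! i)"
    then obtain x where "x \<in> bounded_vecs (m + n) (\<lambda>_. k)" "mat_app M x = y"
      using assms(1) unfolding syl_surj_def by blast
    then show "y \<in> mat_app M ` bounded_vecs (m + n) (\<lambda>_. k)" by (intro image_eqI[of _ _ x]) simp_all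
  qed (auto intro: mat_app_bounded[OF M])
  have "pv.dim (bounded_vecs (m + n) (\<lambda>_. k) :: (nat \<Rightarrow> 'a poly) set)
      = pv.dim (syl_ker k) + pv.dim (mat_app M ` bounded_vecs (m + n) (\<lambda>_. k))"
    unfolding syl_ker_def
    by (rule pvp.rank_nullity[OF linear_mat_app subspace_bounded_vecs bounded_vecs_basis(1) eq_refl[OF bounded_vecs_basis(3)]])
  moreover have "(\<Sum>i<m. d ! i) = sum_list d" using len by (simp add: sum_list_sum_nth lessThan_atLeast0)
  ultimately show ?thesis
    using assms(2) unfolding img dim_bounded_vecs by (simp add: sum.distrib algebra_simps)
qed

lemma coeff_vec_syl_ker: "x \<in> syl_ker (Suc k) \<Longrightarrow> coeff_vec k x \<in> lead_ker"
proof -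
  assume x: "x \<in> syl_ker (Suc k)"
  then have x': "x \<in> bounded_vecs (m + n) (\<lambda>_. Suc k)" "mat_app M x = 0" by (auto simp: syl_ker_def)
  have c: "coeff_vec k x \<in> bounded_vecs (m + n) (\<lambda>_. 1)" by (rule coeff_vec_bounded[OF x'(1)])
  have "coeff (mat_app lead_mat (coeff_vec k x) i) j = 0" for i j
    using lead_mat_app_bounded[OF c] coeff_mat_app_top[OF x'(1), of i] x'(2)
    by (cases "i < m \<and> j = 0") (auto simp: bounded_vecs_def)
  then have "mat_app lead_mat (coeff_vec k x) = 0" by (intro ext poly_eqI) simp
  with c show ?thesis by (simp add: lead_ker_def)
qed

text \<open>\<lambda>^k times \<open>c\<close> misses the kernel only by an error whose coefficients
  at the degrees \<open>k + d ! i\<close> vanish, as \<open>c\<close> is annihilated by the leading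
  coefficients. The error therefore lies in the target of order \<open>k\<close> and is the image of
  some \<open>z\<close> of degree below \<open>k\<close>; subtracting \<open>z\<close> leaves the
  coefficient at \<open>k\<close> unchanged.\<close>

lemma lead_ker_lift:
  assumes "syl_surj k" "c \<in> lead_ker"
  shows "\<exists>x\<in>syl_ker (Suc k). coeff_vec k x = c"
proof -
  have c: "c \<in> bounded_vecs (m + n) (\<lambda>_. 1)" "mat_app lead_mat c = 0" using assms(2) by (auto simp: lead_ker_def)
  let ?x = "\<lambda>l. monom 1 k * c l"
  have x: "?x \<in> bounded_vecs (m + n) (\<lambda>_. Suc k)" using monom_mult_bounded[OF c(1), of 1 k] by simp
  have cx: "coeff_vec k ?x = c"
  proof (intro ext poly_eqI)
    fix l j show "coeff (coeff_vec k ?x l) j = coeff (c l) j"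
      using c(1) by (cases j) (auto simp: coeff_vec_def coeff_monom_mult bounded_vecs_def)
  qed
  have "mat_app M ?x \<in> bounded_vecs m (\<lambda>i. k + d ! i)"
  proof -
    have "coeff (mat_app M ?x i) (k + d ! i) = 0" if "i < m" for i
      using coeff_mat_app_top[OF x that] by (simp add: cx c(2))
    then have "coeff (mat_app M ?x i) j = 0" if "i \<ge> m \<or> j \<ge> k + d ! i" for i j
      using mat_app_bounded[OF M x] that
      by (cases "i < m \<and> j = k + d ! i") (auto simp: bounded_vecs_def)
    then show ?thesis unfolding bounded_vecs_def by blast
  qed
  then obtain z where z: "z \<in> bounded_vecs (m + n) (\<lambda>_. k)" "mat_app M z = mat_app M ?x"
    using assms(1) unfolding syl_surj_def by blast
  have z': "z \<in> bounded_vecs (m + n) (\<lambda>_. Suc k)"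
    using z(1) bounded_vecs_mono[of "m + n" "\<lambda>_. k" "\<lambda>_. Suc k"] by auto
  have "?x - z \<in> bounded_vecs (m + n) (\<lambda>_. Suc k)" by (rule pv.subspace_diff[OF subspace_bounded_vecs x z'])
  moreover have "mat_app M (?x - z) = 0"
    using pvp.linear_diff[OF linear_mat_app, of M ?x z] z(2) by simp
  moreover have "coeff_vec k (?x - z) = c"
  proof -
    have "coeff_vec k z = 0" using z(1) by (auto simp: coeff_vec_def bounded_vecs_def fun_eq_iff)
    then show ?thesis using pvp.linear_diff[OF linear_coeff_vec, of k ?x z] cx by simp
  qed
  ultimately show ?thesis unfolding syl_ker_def by (intro bexI[of _ "?x - z"]) auto
qed

end

lemma finite_independent_bounded_vecs:
  assumes "A \<subseteq> bounded_vecs q b" "pv.independent A"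
  shows "finite A"
  using pv.independent_span_bound[OF bounded_vecs_basis(1) assms(2) assms(1)[unfolded bounded_vecs_basis(3)]]
  by simp

context row_bounded
begin

lemma subspace_syl_ker: "pv.subspace (syl_ker k)"
  unfolding syl_ker_def Collect_conj_eq
  using pv.subspace_inter[OF subspace_bounded_vecs pvp.linear_subspace_kernel[OF linear_mat_app]]
  by (simp add: Int_def)

text \<open>\<open>coeff_vec (k - 1)\<close> is injective on \<open>syl_ker k\<close>, since a
  kernel vector without that coefficient has degree below \<open>k - 1\<close> and vanishes by
  \<open>syl_inj (k - 1)\<close>. The images of a basis of \<open>syl_ker k\<close> therefore are
  \<open>t\<close> independent vectors of \<open>lead_ker\<close>; the \<open>n - t\<close> vectors
  that complete them to a basis are lifted to kernel vectors of degree \<open>k\<close>.\<close>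

lemma lead_ker_basis:
  assumes surj: "syl_surj k" and k: "k \<ge> 1" and inj: "syl_inj (k - 1)"
    and t: "n * k = sum_list d + t" "t < n"
  defines "e \<equiv> \<lambda>i. if i < t then k - 1 else k"
  shows "\<exists>b. (\<forall>i<n. b i \<in> syl_ker (Suc (e i))) \<and>
    inj_on (\<lambda>i. coeff_vec (e i) (b i)) {..<n} \<and> pv.independent ((\<lambda>i. coeff_vec (e i) (b i)) ` {..<n}) \<and>
    lead_ker \<subseteq> pv.span ((\<lambda>i. coeff_vec (e i) (b i)) ` {..<n}) \<and>
    inj_on b {..<t} \<and> syl_ker k \<subseteq> pv.span (b ` {..<t})"
proof -
  have k': "Suc (k - 1) = k" using k by simp
  obtain A where A: "A \<subseteq> syl_ker k" "pv.independent A" "syl_ker k \<subseteq> pv.span A" "card A = t"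
    using pv.basis_exists[of "syl_ker k"] dim_syl_ker[OF surj t(1)] by metis
  have "A \<subseteq> bounded_vecs (m + n) (\<lambda>_. k)" using A(1) by (auto simp: syl_ker_def)
  then have finA: "finite A" using A(2) by (rule finite_independent_bounded_vecs)
  let ?f = "coeff_vec (k - 1)"
  have inj_f: "inj_on ?f (syl_ker k)"
    unfolding pvp.linear_inj_on_iff_eq_0[OF linear_coeff_vec subspace_syl_ker]
  proof (intro ballI impI)
    fix x assume x: "x \<in> syl_ker k" and z: "?f x = 0"
    have c: "coeff (x l) (k - 1) = 0" for l using fun_cong[OF z, of l] by (simp add: coeff_vec_def)
    have "coeff (x l) j = 0" if "l \<ge> m + n \<or> j \<ge> k - 1" for l j
      using x c[of l] that k by (cases "j = k - 1") (auto simp: syl_ker_def bounded_vecs_def)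
    then have "x \<in> bounded_vecs (m + n) (\<lambda>_. k - 1)" unfolding bounded_vecs_def by blast
    then show "x = 0" using inj x unfolding syl_inj_def syl_ker_def by blast
  qed
  have span_A: "pv.span A \<subseteq> syl_ker k" by (rule pv.span_minimal[OF A(1) subspace_syl_ker])
  have fA_ind: "pv.independent (?f ` A)"
    by (rule pvp.linear_independent_injective_image[OF linear_coeff_vec A(2) inj_on_subset[OF inj_f span_A]])
  have fA: "?f ` A \<subseteq> lead_ker" using A(1) coeff_vec_syl_ker[of _ "k - 1"] unfolding k' by blast
  obtain B where B: "?f ` A \<subseteq> B" "B \<subseteq> lead_ker" "pv.independent B" "lead_ker \<subseteq> pv.span B"
    using pv.maximal_independent_subset_extend[OF fA fA_ind] by blast
  have cardB: "card B = n"
    using pv.basis_card_eq_dim[OF B(2,4,3)] dim_lead_ker[OF surj k] by simp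
  have finB: "finite B" using cardB t(2) by (intro card_ge_0_finite) simp
  have card_fA: "card (?f ` A) = t" using A(4) card_image[OF inj_on_subset[OF inj_f A(1)]] by simp
  let ?C = "B - ?f ` A"
  have cardC: "card ?C = n - t" using cardB card_fA B(1) finA by (simp add: card_Diff_subset)
  obtain h where h: "bij_betw h {..<t} A"
    using ex_bij_betw_nat_finite[OF finA] A(4) by (auto simp: lessThan_atLeast0)
  obtain g where g: "bij_betw g {..<n - t} ?C"
    using ex_bij_betw_nat_finite[of ?C] finB cardC by (auto simp: lessThan_atLeast0)
  define w where "w c = (SOME x. x \<in> syl_ker (Suc k) \<and> coeff_vec k x = c)" for c
  have w: "w c \<in> syl_ker (Suc k) \<and> coeff_vec k (w c) = c" if c: "c \<in> lead_ker" for c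
  proof -
    obtain x where "x \<in> syl_ker (Suc k) \<and> coeff_vec k x = c" using lead_ker_lift[OF surj c] by blast
    from someI[where P = "\<lambda>x. x \<in> syl_ker (Suc k) \<and> coeff_vec k x = c", OF this]
    show ?thesis unfolding w_def .
  qed
  define b where "b i = (if i < t then h i else w (g (i - t)))" for i
  let ?F = "\<lambda>i. coeff_vec (e i) (b i)"
  have gC: "g (i - t) \<in> ?C" if "t \<le> i" "i < n" for i
    by (rule bij_betw_apply[OF g]) (use that in auto)
  have F1: "?F i = ?f (h i)" if "i < t" for i using that by (simp add: b_def e_def)
  have F2: "?F i = g (i - t)" if "t \<le> i" "i < n" for i
    using w[of "g (i - t)"] gC[OF that] B(2) that by (auto simp: b_def e_def)
  have "b i \<in> syl_ker (Suc (e i))" if i: "i < n" for i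
  proof (cases "i < t")
    case True
    then have "h i \<in> A" using bij_betw_apply[OF h] by simp
    then show ?thesis using True A(1) k by (auto simp: b_def e_def)
  next
    case False
    then have "g (i - t) \<in> lead_ker" using gC[of i] i B(2) by auto
    then show ?thesis using False w by (simp add: b_def e_def)
  qed
  moreover have img: "?F ` {..<n} = B"
  proof -
    have "?F ` {..<t} = ?f ` A" using h F1 unfolding bij_betw_def by (auto simp: image_iff)
    moreover have "?F ` {t..<n} = ?C"
    proof -
      have "?F ` {t..<n} = (\<lambda>i. g (i - t)) ` {t..<n}" using F2 by (intro image_cong) auto
      also have "\<dots> = g ` ((\<lambda>i. i - t) ` {t..<n})" by (simp add: image_image)
      also have "(\<lambda>i. i - t) ` {t..<n} = {..<n - t}"
      proof
        show "{..<n - t} \<subseteq> (\<lambda>i. i - t) ` {t..<n}"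
        proof
          fix x assume "x \<in> {..<n - t}"
          then show "x \<in> (\<lambda>i. i - t) ` {t..<n}" by (intro image_eqI[of _ _ "x + t"]) auto
        qed
      qed auto
      also have "g ` {..<n - t} = ?C" using g by (simp add: bij_betw_def)
      finally show ?thesis .
    qed
    moreover have "{..<n} = {..<t} \<union> {t..<n}" using t(2) by auto
    ultimately show ?thesis using B(1) by (simp only: image_Un) blast
  qed
  moreover have "inj_on ?F {..<n}" by (rule eq_card_imp_inj_on) (simp_all add: img cardB)
  moreover have bt: "b ` {..<t} = A" using h unfolding bij_betw_def by (auto simp: b_def image_iff)
  moreover have "inj_on b {..<t}" by (rule eq_card_imp_inj_on) (simp_all add: bt A(4))
  ultimately show ?thesis using A(3) B(3,4) by (intro exI[of _ b] conjI) simp_all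
qed

text \<open>Generation goes by induction on the degree bound. For \<open>D \<ge> k\<close> the
  coefficient at degree \<open>D\<close> of a vector in \<open>syl_ker (Suc D)\<close> lies in
  \<open>lead_ker\<close>, hence is a combination of the leading vectors, and subtracting the same
  combination of shifted generators lowers the bound. For bounds up to \<open>k\<close>, constant
  combinations of the first \<open>t\<close> generators suffice.\<close>

theorem right_minimal_generators:
  assumes surj: "syl_surj k" and k: "k \<ge> 1" and inj: "syl_inj (k - 1)"
    and t: "n * k = sum_list d + t" "t < n"
  defines "e \<equiv> \<lambda>i. if i < t then k - 1 else k"
  shows "\<exists>b. (\<forall>i<n. b i \<in> syl_ker (Suc (e i))) \<and>
    (\<forall>a. (\<Sum>i<n. pscale (a i) (coeff_vec (e i) (b i))) = 0 \<longrightarrow> (\<forall>i<n. a i = 0)) \<and>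
    (\<forall>D. \<forall>x\<in>syl_ker D. \<exists>c. \<forall>l. x l = (\<Sum>i<n. c i * b i l))"
proof -
  obtain b where b: "\<forall>i<n. b i \<in> syl_ker (Suc (e i))"
    and F: "inj_on (\<lambda>i. coeff_vec (e i) (b i)) {..<n}" "pv.independent ((\<lambda>i. coeff_vec (e i) (b i)) ` {..<n})"
      "lead_ker \<subseteq> pv.span ((\<lambda>i. coeff_vec (e i) (b i)) ` {..<n})"
    and bt: "inj_on b {..<t}" "syl_ker k \<subseteq> pv.span (b ` {..<t})"
    using lead_ker_basis[OF surj k inj t] unfolding e_def by blast
  let ?F = "\<lambda>i. coeff_vec (e i) (b i)"
  have ind: "\<forall>i<n. a i = 0" if a: "(\<Sum>i<n. pscale (a i) (?F i)) = 0" for a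
  proof -
    define u where "u = (\<lambda>v. a (the_inv_into {..<n} ?F v))"
    have u: "u (?F i) = a i" if "i < n" for i
      using the_inv_into_f_f[OF F(1), of i] that by (simp add: u_def)
    have "(\<Sum>v\<in>?F ` {..<n}. pscale (u v) v) = (\<Sum>i<n. pscale (u (?F i)) (?F i))"
      by (rule sum.reindex[OF F(1), unfolded comp_def])
    also have "\<dots> = (\<Sum>i<n. pscale (a i) (?F i))" by (rule sum.cong) (auto simp: u)
    finally have "(\<Sum>v\<in>?F ` {..<n}. pscale (u v) v) = 0" using a by simp
    then have "\<forall>v\<in>?F ` {..<n}. u v = 0"
      using F(2) unfolding pv.independent_explicit_finite_subsets by blast
    then show ?thesis using u by auto
  qed
  have "\<forall>x\<in>syl_ker D. \<exists>c. \<forall>l. x l = (\<Sum>i<n. c i * b i l)" for D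
  proof (induction D)
    case 0
    show ?case
    proof
      fix x assume "x \<in> syl_ker 0"
      then have "x = 0" using syl_inj_0 unfolding syl_ker_def syl_inj_def by blast
      then show "\<exists>c. \<forall>l. x l = (\<Sum>i<n. c i * b i l)" by (intro exI[of _ "\<lambda>_. 0"]) simp
    qed
  next
    case (Suc D)
    show ?case
    proof
      fix x assume x: "x \<in> syl_ker (Suc D)"
      show "\<exists>c. \<forall>l. x l = (\<Sum>i<n. c i * b i l)"
      proof (cases "Suc D \<le> k")
        case True
        then have "x \<in> syl_ker k"
          using x bounded_vecs_mono[of "m + n" "\<lambda>_. Suc D" "\<lambda>_. k"] by (auto simp: syl_ker_def)
        then have "x \<in> pv.span (b ` {..<t})" using bt(2) by blast
        then obtain u where "x = (\<Sum>v\<in>b ` {..<t}. pscale (u v) v)"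
          unfolding pv.span_finite[OF finite_imageI[OF finite_lessThan]] by blast
        also have "\<dots> = (\<Sum>i<t. pscale (u (b i)) (b i))"
          by (rule sum.reindex[OF bt(1), unfolded comp_def])
        finally have xl: "x l = (\<Sum>i<t. [:u (b i):] * b i l)" for l
          by (simp add: sum_fun_apply pscale_def)
        have "x l = (\<Sum>i<n. (if i < t then [:u (b i):] else 0) * b i l)" for l
          unfolding xl using t(2) by (intro sum.mono_neutral_cong_left) auto
        then show ?thesis by (intro exI[of _ "\<lambda>i. if i < t then [:u (b i):] else 0"] allI)
      next
        case False
        then have kD: "k \<le> D" by simp
        then have eD: "e i \<le> D" for i by (auto simp: e_def)
        have "coeff_vec D x \<in> pv.span (?F ` {..<n})" using coeff_vec_syl_ker[OF x] F(3) by blast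
        then obtain u where "coeff_vec D x = (\<Sum>v\<in>?F ` {..<n}. pscale (u v) v)"
          unfolding pv.span_finite[OF finite_imageI[OF finite_lessThan]] by blast
        also have "\<dots> = (\<Sum>i<n. pscale (u (?F i)) (?F i))"
          by (rule sum.reindex[OF F(1), unfolded comp_def])
        finally have top: "coeff_vec D x = (\<Sum>i<n. pscale (u (?F i)) (?F i))" .
        define a where "a i = u (?F i)" for i
        \<comment> \<open>The factor of degree \<open>D - e i\<close> moves the leading coefficient
          of \<open>b i\<close> to degree \<open>D\<close>.\<close>
        define y where "y i = (\<lambda>l. monom (a i) (D - e i) * b i l)" for i
        define z where "z = (\<Sum>i<n. y i)"
        have y: "y i \<in> syl_ker (Suc D)" if "i < n" for i
        proof -
          have "b i \<in> bounded_vecs (m + n) (\<lambda>_. Suc (e i))" "mat_app M (b i) = 0"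
            using b that by (auto simp: syl_ker_def)
          then show ?thesis
            using monom_mult_bounded[of "b i" "m + n" "\<lambda>_. Suc (e i)" "a i" "D - e i"] eD[of i]
            by (simp add: y_def syl_ker_def mat_app_mult zero_fun_def)
        qed
        then have z: "z \<in> syl_ker (Suc D)"
          unfolding z_def by (intro pv.subspace_sum[OF subspace_syl_ker]) auto
        have cz: "coeff (z l) D = coeff (x l) D" for l
        proof -
          have "coeff (y i l) D = a i * coeff (b i l) (e i)" for i
            using eD[of i] by (simp add: y_def coeff_monom_mult)
          then have "coeff (z l) D = (\<Sum>i<n. a i * coeff (b i l) (e i))"
            by (simp add: z_def sum_fun_apply coeff_sum)
          also have "\<dots> = coeff ((\<Sum>i<n. pscale (u (?F i)) (?F i)) l) 0"
            by (simp add: sum_fun_apply coeff_sum pscale_def coeff_vec_def a_def)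
          also have "\<dots> = coeff (x l) D" unfolding top[symmetric] by (simp add: coeff_vec_def)
          finally show ?thesis .
        qed
        have xz: "x - z \<in> syl_ker (Suc D)" by (rule pv.subspace_diff[OF subspace_syl_ker x z])
        then have "coeff ((x - z) l) j = 0" if "l \<ge> m + n \<or> j \<ge> D" for l j
          using cz[of l] that by (cases "j = D") (auto simp: syl_ker_def bounded_vecs_def)
        then have "x - z \<in> syl_ker D" using xz unfolding syl_ker_def bounded_vecs_def by blast
        then obtain c where c: "\<And>l. (x - z) l = (\<Sum>i<n. c i * b i l)" using Suc.IH by blast
        have "x l = (\<Sum>i<n. (c i + monom (a i) (D - e i)) * b i l)" for l
        proof -
          have "x l = (x - z) l + z l" by simp
          also have "z l = (\<Sum>i<n. monom (a i) (D - e i) * b i l)" by (simp add: z_def y_def sum_fun_apply)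
          finally show ?thesis by (simp only: c sum.distrib distrib_right)
        qed
        then show ?thesis by (intro exI[of _ "\<lambda>i. c i + monom (a i) (D - e i)"] allI)
      qed
    qed
  qed
  with b ind show ?thesis by (intro exI[of _ b] conjI allI impI ballI) simp_all
qed

end

subsection \<open>Minimal indices and minimal bases\<close>

lemma submodule_mat_kernel:
  fixes A :: "'a::field mat"
  assumes A: "A \<in> carrier_mat nr nc"
  shows "submodule class_ring (mat_kernel A) (module_vec TYPE('a) nc)"
proof -
  interpret vec_space "TYPE('a)" nc .
  show ?thesis
    unfolding submodule_def
    using mult_add_distrib_mat_vec[OF A] mult_mat_vec[OF A] mat_kernel[OF A] module_axioms A
    by (auto simp: class_ring_simps module_vec_simps)
qed

lemma map_vec_to_fract_in_kernel_iff:
  fixes M :: "'a::field poly mat"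
  assumes M: "M \<in> carrier_mat nr nc" and v: "v \<in> carrier_vec nc"
  shows "map_vec to_fract v \<in> mat_kernel (map_mat to_fract M) \<longleftrightarrow> M *\<^sub>v v = 0\<^sub>v nr"
proof -
  interpret inj_comm_ring_hom "to_fract :: 'a poly \<Rightarrow> _" by unfold_locales auto
  have "map_vec to_fract v \<in> mat_kernel (map_mat to_fract M) \<longleftrightarrow> map_vec to_fract (M *\<^sub>v v) = 0\<^sub>v nr"
    unfolding mult_mat_vec_hom[OF M v] using M v by (simp add: mat_kernel_def)
  also have "\<dots> \<longleftrightarrow> M *\<^sub>v v = 0\<^sub>v nr" using M by (auto simp: vec_eq_iff)
  finally show ?thesis .
qed

lemma submodule_row_space:
  fixes A :: "'a::field mat"
  assumes A: "A \<in> carrier_mat nr nc"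
  shows "submodule class_ring (vec_space.row_space nc A) (module_vec TYPE('a) nc)"
proof -
  interpret vec_space "TYPE('a)" nc .
  have "set (rows A) \<subseteq> carrier_vec nc" using A by (auto simp: rows_def)
  then show ?thesis unfolding row_space_def by (rule span_is_submodule)
qed

text \<open>\<open>k \<ge> 1\<close> keeps \<open>k - 1\<close> and \<open>k\<close> apart, so that
  the two counts do not mix.\<close>

lemma sort_two_valued_counts:
  fixes k t n :: nat
  assumes "k \<ge> 1" "t \<le> n"
  defines "xs \<equiv> sort (map (\<lambda>i. if i < t then k - 1 else k) [0..<n])"
  shows "length xs = n" "count_list xs (k - 1) = t" "count_list xs k = n - t"
proof -
  have "count_list xs c = card {i. i < n \<and> (if i < t then k - 1 else k) = c}" for c
  proof -
    have "count_list xs c = count (mset xs) c" by (simp add: count_mset)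
    also have "\<dots> = count (mset (map (\<lambda>i. if i < t then k - 1 else k) [0..<n])) c" by (simp add: xs_def)
    also have "\<dots> = count_list (map (\<lambda>i. if i < t then k - 1 else k) [0..<n]) c" by (rule count_mset)
    also have "\<dots> = card {i. i < n \<and> (if i < t then k - 1 else k) = c}"
      unfolding count_list_eq_length_filter filter_map length_map
      by (simp add: length_filter_conv_card comp_def cong: conj_cong) (rule arg_cong[of _ _ card], auto)
    finally show ?thesis .
  qed
  moreover have "{i. i < n \<and> (if i < t then k - 1 else k) = k - 1} = {..<t}" using assms(1,2) by auto
  moreover have "{i. i < n \<and> (if i < t then k - 1 else k) = k} = {t..<n}" using assms(1,2) by auto
  ultimately show "count_list xs (k - 1) = t" "count_list xs k = n - t" by simp_all
  show "length xs = n" by (simp add: xs_def)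
qed

section \<open>Application to the kernel and the row space of \<open>M\<close>\<close>

context row_bounded
begin

lemma mat_app_eq_mult_vec:
  assumes "v \<in> carrier_vec (m + n)" "i < m"
  shows "mat_app M (\<lambda>l. if l < m + n then v $ l else 0) i = (M *\<^sub>v v) $ i"
  using assms dims by (simp add: mat_app_def scalar_prod_def lessThan_atLeast0)

theorem right_minimal_indices_eq:
  assumes m: "m > 0" and surj: "syl_surj k" and k: "k \<ge> 1" and inj: "syl_inj (k - 1)"
    and t: "n * k = sum_list d + t" "t < n"
  shows "right_minimal_indices M = sort (map (\<lambda>i. if i < t then k - 1 else k) [0..<n])"
proof -
  let ?q = "m + n"
  define e where "e = (\<lambda>i. if i < t then k - 1 else k)"
  have Mc: "M \<in> carrier_mat m ?q" using dims by auto
  obtain b where b: "\<forall>i<n. b i \<in> syl_ker (Suc (e i))"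
    and lead: "\<forall>a. (\<Sum>i<n. pscale (a i) (coeff_vec (e i) (b i))) = 0 \<longrightarrow> (\<forall>i<n. a i = 0)"
    and gen: "\<forall>D. \<forall>x\<in>syl_ker D. \<exists>c. \<forall>l. x l = (\<Sum>i<n. c i * b i l)"
    using right_minimal_generators[OF surj k inj t] unfolding e_def by blast
  have bB: "b i \<in> bounded_vecs ?q (\<lambda>_. Suc (e i))" "mat_app M (b i) = 0" if "i < n" for i
    using b that by (auto simp: syl_ker_def)
  define bs where "bs = map (\<lambda>i. vec ?q (b i)) [0..<n]"
  have N: "length bs = n" by (simp add: bs_def)
  have bsi: "bs ! i $ l = b i l" if "i < n" "l < ?q" for i l using that by (simp add: bs_def)
  have ext: "(\<lambda>l. if l < ?q then vec ?q (b i) $ l else 0) = b i" if "i < n" for i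
  proof (intro ext poly_eqI)
    fix l j show "coeff (if l < ?q then vec ?q (b i) $ l else 0) j = coeff (b i l) j"
      using bB(1)[OF that] by (auto simp: bounded_vecs_def)
  qed
  have "minimal_indices ?q (mat_kernel (map_mat to_fract M)) = sort (map e [0..<length bs])"
  proof (rule reduced_generators_minimal(2))
    show "submodule class_ring (mat_kernel (map_mat to_fract M)) (module_vec TYPE('a poly fract) ?q)"
      by (rule submodule_mat_kernel[of _ m]) (use Mc in simp)
    show "?q > 0" using m by simp
    show "set bs \<subseteq> carrier_vec ?q" by (auto simp: bs_def)
    show "map_vec to_fract ` set bs \<subseteq> mat_kernel (map_mat to_fract M)"
    proof clarify
      fix v assume "v \<in> set bs"
      then obtain i where i: "i < n" "v = vec ?q (b i)" by (auto simp: bs_def)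
      have v: "v \<in> carrier_vec ?q" using i by simp
      have "M *\<^sub>v v = 0\<^sub>v m"
      proof (rule eq_vecI)
        fix r assume "r < dim_vec (0\<^sub>v m :: 'a poly vec)"
        then have r: "r < m" by simp
        have "(M *\<^sub>v v) $ r = mat_app M (b i) r"
          using mat_app_eq_mult_vec[OF v r, symmetric] unfolding i(2) ext[OF i(1)] .
        then show "(M *\<^sub>v v) $ r = 0\<^sub>v m $ r" using bB(2)[OF i(1)] r by simp
      qed (use dims in simp)
      then show "map_vec to_fract v \<in> mat_kernel (map_mat to_fract M)"
        using map_vec_to_fract_in_kernel_iff[OF Mc v] by simp
    qed
    show "degree (bs ! i $ l) \<le> e i" if "i < length bs" "l < ?q" for i l
    proof (rule degree_le, intro allI impI)
      fix j assume "e i < j"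
      then show "coeff (bs ! i $ l) j = 0"
        using bB(1)[of i] that bsi[of i l] N by (simp add: bounded_vecs_def)
    qed
    show "\<forall>i<length bs. a i = 0"
      if a: "\<And>l. l < ?q \<Longrightarrow> (\<Sum>i<length bs. a i * coeff (bs ! i $ l) (e i)) = 0" for a
    proof -
      have "(\<Sum>i<n. pscale (a i) (coeff_vec (e i) (b i))) = 0"
      proof
        fix l
        have "(\<Sum>i<n. pscale (a i) (coeff_vec (e i) (b i))) l = (\<Sum>i<n. [:a i * coeff (b i l) (e i):])"
          by (simp add: sum_fun_apply pscale_def coeff_vec_def)
        also have "\<dots> = [:\<Sum>i<n. a i * coeff (b i l) (e i):]"
          by (intro poly_eqI) (auto simp: coeff_sum coeff_pCons split: nat.splits)
        also have "(\<Sum>i<n. a i * coeff (b i l) (e i)) = 0"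
        proof (cases "l < ?q")
          case True
          then show ?thesis using a[OF True] unfolding N by (simp add: bsi)
        next
          case False
          then have "coeff (b i l) (e i) = 0" if "i < n" for i
            using bB(1)[OF that] by (simp add: bounded_vecs_def)
          then show ?thesis by simp
        qed
        finally show "(\<Sum>i<n. pscale (a i) (coeff_vec (e i) (b i))) l = 0 l" by simp
      qed
      then show ?thesis using lead unfolding N by simp
    qed
    show "\<exists>c. \<forall>l<?q. v $ l = (\<Sum>i<length bs. c i * bs ! i $ l)"
      if v: "v \<in> carrier_vec ?q" and ker: "map_vec to_fract v \<in> mat_kernel (map_mat to_fract M)" for v
    proof -
      let ?x = "\<lambda>l. if l < ?q then v $ l else 0"
      \<comment> \<open>Any bound above all the degrees will do; it places the vector in some
        \<open>syl_ker D\<close>, to which \<open>gen\<close> applies.\<close>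
      define D where "D = Suc (\<Sum>l<?q. degree (v $ l))"
      have "coeff (v $ l) j = 0" if "l < ?q" "D \<le> j" for l j
      proof (rule coeff_eq_0)
        show "degree (v $ l) < j"
          using member_le_sum[of l "{..<?q}" "\<lambda>l. degree (v $ l)"] that by (simp add: D_def)
      qed
      then have "?x \<in> bounded_vecs ?q (\<lambda>_. D)"
        unfolding bounded_vecs_def by auto
      moreover have "mat_app M ?x = 0"
      proof
        fix i show "mat_app M ?x i = 0 i"
        proof (cases "i < m")
          case True
          have "M *\<^sub>v v = 0\<^sub>v m" using map_vec_to_fract_in_kernel_iff[OF Mc v] ker by simp
          then show ?thesis using mat_app_eq_mult_vec[OF v True] True by simp
        qed (simp add: mat_app_def dims)
      qed
      ultimately have xD: "?x \<in> syl_ker D" by (simp add: syl_ker_def)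
      from gen[rule_format, OF xD] obtain c where c: "\<forall>l. ?x l = (\<Sum>i<n. c i * b i l)" by (elim exE)
      have "v $ l = (\<Sum>i<length bs. c i * bs ! i $ l)" if "l < ?q" for l
        using c[rule_format, of l] that unfolding N by (simp add: bsi)
      then show ?thesis by blast
    qed
  qed
  then show ?thesis unfolding right_minimal_indices_def dims N e_def .
qed

text \<open>Surjectivity of \<open>lead_mat\<close> gives a \<open>c\<close> mapped to the
  \<open>i\<close>th unit vector; pairing the relation with it isolates \<open>a i\<close>.\<close>

lemma lead_rows_independent:
  assumes surj: "syl_surj k" "k \<ge> 1"
    and a: "\<And>l. l < m + n \<Longrightarrow> (\<Sum>i<m. a i * coeff (M $$ (i, l)) (d ! i)) = 0"
  shows "\<forall>i<m. a i = 0"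
proof (intro allI impI)
  fix i assume i: "i < m"
  have "monom_vec i 0 \<in> bounded_vecs m (\<lambda>_. 1)" using i by (intro monom_vec_bounded) auto
  from lead_mat_surj[OF surj this] obtain c
    where c: "mat_app lead_mat c = monom_vec i 0" by blast
  have lc: "(\<Sum>l<m + n. coeff (M $$ (r, l)) (d ! r) * coeff (c l) 0) = (if r = i then 1 else 0)" if "r < m" for r
  proof -
    have "coeff (mat_app lead_mat c r) 0 = (\<Sum>l<m + n. coeff (M $$ (r, l)) (d ! r) * coeff (c l) 0)"
      using that by (simp add: lead_mat_app coeff_sum)
    moreover have "coeff (monom_vec i 0 r :: 'a poly) 0 = (if r = i then 1 else 0)" by (simp add: monom_vec_def)
    ultimately show ?thesis unfolding c by (simp only:)
  qed
  have "a i = (\<Sum>r<m. a r * (if r = i then 1 else 0))"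
    using i by (simp add: if_distrib[of "\<lambda>x. _ * x"] cong: if_cong)
  also have "\<dots> = (\<Sum>r<m. a r * (\<Sum>l<m + n. coeff (M $$ (r, l)) (d ! r) * coeff (c l) 0))"
    by (intro sum.cong refl) (simp only: lc lessThan_iff)
  also have "\<dots> = (\<Sum>l<m + n. (\<Sum>r<m. a r * coeff (M $$ (r, l)) (d ! r)) * coeff (c l) 0)"
    unfolding sum_distrib_left sum_distrib_right by (subst sum.swap) (simp add: mult.assoc)
  also have "\<dots> = 0" using a by simp
  finally show "a i = 0" .
qed

text \<open>The constant unit vectors lie in the target because \<open>k \<ge> 1\<close>; their
  preimages are the columns of a polynomial right inverse of \<open>M\<close>.\<close>

lemma right_inverse_vecs:
  assumes "syl_surj k" "k \<ge> 1" "i < m"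
  shows "\<exists>x. \<forall>j<m. (\<Sum>l<m + n. M $$ (j, l) * x l) = (if j = i then 1 else 0)"
proof -
  have "monom_vec i 0 \<in> bounded_vecs m (\<lambda>i. k + d ! i)" using assms by (intro monom_vec_bounded) auto
  then obtain x where x: "mat_app M x = monom_vec i 0" using assms(1) unfolding syl_surj_def by blast
  have "(\<Sum>l<m + n. M $$ (j, l) * x l) = (if j = i then 1 else 0)" if "j < m" for j
    using fun_cong[OF x, of j] that by (simp add: mat_app_def dims monom_vec_def)
  then show ?thesis by blast
qed

text \<open>The right inverse serves to remove denominators: if \<open>s\<close> times
  \<open>v\<close> is the combination of the rows with coefficients \<open>c\<close>, applying the
  right inverse shows that \<open>c\<close> is \<open>s\<close> times a polynomial vector
  \<open>c'\<close>, and cancelling \<open>s\<close> gives \<open>v\<close> as the combination with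
  coefficients \<open>c'\<close>.\<close>

theorem rows_minimal_basis:
  assumes m: "m > 0" and surj: "syl_surj k" and k: "k \<ge> 1"
  shows "minimal_basis (m + n) (vec_space.row_space (m + n) (map_mat to_fract M)) (rows M)"
    and "\<And>i. i < m \<Longrightarrow> vec_degree (row M i) = d ! i"
proof -
  let ?q = "m + n" and ?V = "vec_space.row_space (m + n) (map_mat to_fract M)"
  have Mc: "M \<in> carrier_mat m ?q" using dims by auto
  have lrows: "length (rows M) = m" using dims by simp
  have ri: "rows M ! i = row M i" "row M i $ l = M $$ (i, l)" if "i < m" "l < ?q" for i l
    using that dims by simp_all
  have rc: "set (rows M) \<subseteq> carrier_vec ?q" using rows_carrier[of M] dims by simp
  obtain x where x: "\<And>i j. i < m \<Longrightarrow> j < m \<Longrightarrow> (\<Sum>l<?q. M $$ (j, l) * x i l) = (if j = i then 1 else 0)"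
    using right_inverse_vecs[OF surj k] by metis
  have dist: "distinct (rows M)"
  proof (rule ccontr)
    assume "\<not> distinct (rows M)"
    then obtain i j where ij: "i < m" "j < m" "i \<noteq> j" "row M i = row M j"
      using dims by (auto simp: distinct_conv_nth)
    have "M $$ (i, l) = M $$ (j, l)" if "l < ?q" for l
      unfolding ri(2)[OF ij(1) that, symmetric] ri(2)[OF ij(2) that, symmetric] ij(4) ..
    then have "(\<Sum>l<?q. M $$ (i, l) * x i l) = (\<Sum>l<?q. M $$ (j, l) * x i l)" by simp
    with x[OF ij(1,1)] x[OF ij(1,2)] ij(3) show False by simp
  qed
  have rows_fract: "set (rows (map_mat to_fract M)) = map_vec to_fract ` set (rows M)"
  proof -
    have "row (map_mat to_fract M) i = map_vec to_fract (row M i)" if "i < dim_row M" for i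
      using that by (intro eq_vecI) auto
    then show ?thesis unfolding rows_def by (auto simp: image_iff)
  qed
  have V: "?V = LinearCombinations.module.span class_ring (module_vec TYPE('a poly fract) ?q) (map_vec to_fract ` set (rows M))"
    by (simp add: vec_space.row_space_def rows_fract)
  have sub: "submodule class_ring ?V (module_vec TYPE('a poly fract) ?q)"
    by (rule submodule_row_space[of _ m]) (use Mc in simp)
  have incl: "map_vec to_fract ` set (rows M) \<subseteq> ?V"
  proof -
    interpret vec_space "TYPE('a poly fract)" ?q .
    have "map_vec to_fract ` set (rows M) \<subseteq> carrier_vec ?q" using rc by auto
    then show ?thesis unfolding V by (rule in_own_span)
  qed
  have deg: "degree (rows M ! i $ l) \<le> d ! i" if "i < length (rows M)" "l < ?q" for i l
    using that M lrows ri by (simp add: row_bounded_mats_def)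
  have lead: "\<forall>i<length (rows M). a i = 0"
    if a: "\<And>l. l < ?q \<Longrightarrow> (\<Sum>i<length (rows M). a i * coeff (rows M ! i $ l) (d ! i)) = 0" for a
    unfolding lrows
  proof (rule lead_rows_independent[OF surj k])
    fix l assume l: "l < ?q"
    show "(\<Sum>i<m. a i * coeff (M $$ (i, l)) (d ! i)) = 0"
      using a[OF l] l unfolding lrows by (simp add: ri)
  qed
  have gen: "\<exists>c. \<forall>l<?q. v $ l = (\<Sum>i<length (rows M). c i * rows M ! i $ l)"
    if v: "v \<in> carrier_vec ?q" "map_vec to_fract v \<in> ?V" for v
  proof -
    from polynomial_span_iff[OF dist rc, THEN iffD1, OF v(2)[unfolded V]]
    obtain s c where s: "s \<noteq> 0" "\<forall>l<?q. to_fract s * map_vec to_fract v $ l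
        = to_fract (\<Sum>j<length (rows M). c j * rows M ! j $ l)"
      by (elim conjE exE)
    have sv: "s * v $ l = (\<Sum>j<m. c j * M $$ (j, l))" if l: "l < ?q" for l
    proof -
      have "to_fract (s * v $ l) = to_fract (\<Sum>j<length (rows M). c j * rows M ! j $ l)"
        using s(2)[rule_format, OF l] v(1) l by (simp add: carrier_vecD[OF v(1)])
      then have "s * v $ l = (\<Sum>j<length (rows M). c j * rows M ! j $ l)" by (simp only: to_fract_eq_iff)
      also have "\<dots> = (\<Sum>j<m. c j * M $$ (j, l))" unfolding lrows using l by (simp add: ri)
      finally show ?thesis .
    qed
    define c' where "c' i = (\<Sum>l<?q. v $ l * x i l)" for i
    have sc: "s * c' i = c i" if i: "i < m" for i
    proof -
      have "s * c' i = (\<Sum>l<?q. (\<Sum>j<m. c j * M $$ (j, l)) * x i l)"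
        unfolding c'_def sum_distrib_left
        by (intro sum.cong refl) (simp only: sv[symmetric] lessThan_iff mult.assoc)
      also have "\<dots> = (\<Sum>j<m. c j * (\<Sum>l<?q. M $$ (j, l) * x i l))"
        unfolding sum_distrib_left sum_distrib_right by (subst sum.swap) (simp add: mult.assoc)
      also have "\<dots> = (\<Sum>j<m. c j * (if j = i then 1 else 0))"
        by (intro sum.cong refl) (simp only: x[OF i] lessThan_iff)
      also have "\<dots> = c i" using i by (simp add: if_distrib[of "\<lambda>x. _ * x"] cong: if_cong)
      finally show ?thesis .
    qed
    have "v $ l = (\<Sum>i<length (rows M). c' i * rows M ! i $ l)" if l: "l < ?q" for l
    proof -
      have "s * (\<Sum>i<m. c' i * M $$ (i, l)) = (\<Sum>i<m. c i * M $$ (i, l))"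
        unfolding sum_distrib_left by (intro sum.cong refl) (simp only: sc[symmetric] lessThan_iff mult.assoc)
      also have "\<dots> = s * v $ l" using sv[OF l] by (rule sym)
      finally have "(\<Sum>i<m. c' i * M $$ (i, l)) = v $ l" using s(1) unfolding mult_cancel_left by blast
      then show ?thesis unfolding lrows using l by (simp add: ri)
    qed
    then show ?thesis by blast
  qed
  show "minimal_basis ?q ?V (rows M)"
    by (rule reduced_generators_minimal(1)[OF sub _ rc incl deg lead gen]) (use m in auto)
  show "vec_degree (row M i) = d ! i" if "i < m" for i
  proof -
    have "vec_degree (rows M ! i) = d ! i"
      by (rule reduced_generators_minimal(3)[OF sub _ rc incl deg lead gen]) (use m that lrows in auto)
    then show ?thesis using that dims by simp
  qed
qed

lemma rank_leading_row_coeff_mat: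
  assumes "syl_surj k" "k \<ge> 1"
  shows "mat_rank (leading_row_coeff_mat d M) = m"
proof -
  let ?L = "leading_row_coeff_mat d M"
  have L: "?L \<in> carrier_mat m (m + n)" by (simp add: leading_row_coeff_mat_def dims)
  have "\<exists>v\<in>carrier_vec (m + n). ?L *\<^sub>v v = y" if y: "y \<in> carrier_vec m" for y
  proof -
    define Y where "Y i = (if i < m then [:y $ i:] else 0)" for i
    have "Y \<in> bounded_vecs m (\<lambda>_. 1)"
      by (auto simp: bounded_vecs_def Y_def coeff_pCons split: nat.splits)
    from lead_mat_surj[OF assms this] obtain c where c: "mat_app lead_mat c = Y" by blast
    have "?L *\<^sub>v vec (m + n) (\<lambda>l. coeff (c l) 0) = y"
    proof (rule eq_vecI)
      fix i assume "i < dim_vec y"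
      then have i: "i < m" using y by simp
      have "(?L *\<^sub>v vec (m + n) (\<lambda>l. coeff (c l) 0)) $ i = coeff (mat_app lead_mat c i) 0"
        using i by (simp add: lead_mat_app coeff_sum leading_row_coeff_mat_def dims scalar_prod_def lessThan_atLeast0)
      also have "\<dots> = y $ i" using i by (simp add: c Y_def)
      finally show "(?L *\<^sub>v vec (m + n) (\<lambda>l. coeff (c l) 0)) $ i = y $ i" .
    qed (use L y in simp)
    then show ?thesis by (intro bexI[of _ "vec (m + n) (\<lambda>l. coeff (c l) 0)"]) simp_all
  qed
  then show ?thesis using mat_rank_eq_dim_row_iff[of ?L] L by simp
qed

end

subsection \<open>A matrix of full trimmed Sylvester rank\<close>

lemma sum_lessThan_add:
  fixes f :: "nat \<Rightarrow> 'b::comm_monoid_add"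
  shows "(\<Sum>i<a + b. f i) = (\<Sum>i<a. f i) + (\<Sum>j<b. f (a + j))"
  by (induction b) (simp_all add: add.assoc)

lemma breakpoints_locate:
  fixes s :: "nat \<Rightarrow> nat"
  assumes "m > 0" "s 0 \<le> p" "p \<le> s m"
  shows "\<exists>i<m. s i \<le> p \<and> p \<le> s (Suc i)"
  using assms
proof (induction m)
  case (Suc m)
  show ?case
  proof (cases "p \<le> s m \<and> m > 0")
    case True
    then show ?thesis using Suc by (meson less_SucI)
  next
    case False
    then have "s m \<le> p" using Suc.prems(2) by (cases "m = 0") auto
    then show ?thesis using Suc.prems(3) by blast
  qed
qed simp

text \<open>There are \<open>Suc m\<close> rows here. Row \<open>i\<close> occupies the piece of
  length \<open>d ! i\<close> on the line from 0 to \<open>sum_list d\<close>, the pieces in order;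
  the points \<open>\<epsilon> j\<close> subdivide the same line, and \<open>\<rho> j\<close> is a
  row whose piece contains \<open>\<epsilon> j\<close>. \<open>gap_le\<close> serves surjectivity of
  order \<open>k\<close>, \<open>gap_ge\<close> injectivity of order \<open>k - 1\<close>.\<close>

locale zigzag =
  fixes m n :: nat and d :: "nat list" and \<epsilon> \<rho> :: "nat \<Rightarrow> nat" and k :: nat
  assumes len: "length d = Suc m"
    and \<epsilon>0: "\<epsilon> 0 = 0" and \<epsilon>n: "\<epsilon> n = sum_list d"
    and gap_le: "\<And>j. j < n \<Longrightarrow> \<epsilon> (Suc j) \<le> \<epsilon> j + k"
    and gap_ge: "\<And>j. j < n \<Longrightarrow> \<epsilon> j + (k - 1) \<le> \<epsilon> (Suc j)"
    and \<rho>_less: "\<And>j. j \<le> n \<Longrightarrow> \<rho> j < Suc m"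
    and \<rho>_lower: "\<And>j. j \<le> n \<Longrightarrow> (\<Sum>l<\<rho> j. d ! l) \<le> \<epsilon> j"
    and \<rho>_upper: "\<And>j. j \<le> n \<Longrightarrow> \<epsilon> j \<le> (\<Sum>l<Suc (\<rho> j). d ! l)"
begin

definition s :: "nat \<Rightarrow> nat" where "s i = (\<Sum>l<i. d ! l)"

lemma s_Suc: "s (Suc i) = s i + d ! i" by (simp add: s_def)

lemma s_mono: "i \<le> j \<Longrightarrow> s i \<le> s j"
  unfolding s_def by (rule sum_mono2) auto

lemma s_total: "s (Suc m) = sum_list d"
  using len by (simp add: s_def sum_list_sum_nth lessThan_atLeast0)

lemma \<epsilon>_lower: "j \<le> n \<Longrightarrow> s (\<rho> j) \<le> \<epsilon> j" using \<rho>_lower by (simp add: s_def)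

lemma \<epsilon>_upper: "j \<le> n \<Longrightarrow> \<epsilon> j \<le> s (\<rho> j) + d ! \<rho> j" using \<rho>_upper by (simp add: s_def)

lemma \<epsilon>_gaps:
  assumes "i < j" "j \<le> n"
  shows "\<epsilon> i + (k - 1) \<le> \<epsilon> j"
  using assms
proof (induction j)
  case (Suc j)
  show ?case
  proof (cases "i = j")
    case True
    then show ?thesis using gap_ge[of j] Suc.prems by simp
  next
    case False
    then have "\<epsilon> i + (k - 1) \<le> \<epsilon> j" using Suc by simp
    also have "\<epsilon> j \<le> \<epsilon> (Suc j)" using gap_ge[of j] Suc.prems by simp
    finally show ?thesis .
  qed
qed simp

text \<open>Column \<open>c < m\<close> links rows \<open>c\<close> and \<open>c + 1\<close>; column \<open>m + j\<close> has a single nonzero entry, a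
  monomial which, after multiplying row \<open>i\<close> by \<open>x ^ s i\<close>, becomes \<open>x ^ \<epsilon> j\<close>. After this
  multiplication the rows sum up to zero in every linking column.\<close>

definition Z :: "'a::comm_ring_1 poly mat" where
  "Z = mat (Suc m) (Suc m + n) (\<lambda>(i, c).
     if c < m then (if i = c then monom 1 (d ! i) else if i = Suc c then - 1 else 0)
     else if i = \<rho> (c - m) then monom 1 (\<epsilon> (c - m) - s i) else 0)"

lemma Z_bounded: "(Z :: 'b::comm_ring_1 poly mat) \<in> row_bounded_mats (Suc m) n d"
proof -
  have "degree (Z $$ (i, c) :: 'b poly) \<le> d ! i" if "i < Suc m" "c < Suc m + n" for i c
  proof -
    have "\<epsilon> (c - m) - s (\<rho> (c - m)) \<le> d ! \<rho> (c - m)"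
    proof -
      have "c - m \<le> n" using that by linarith
      from \<epsilon>_upper[OF this] show ?thesis by linarith
    qed
    then have "degree (monom (1 :: 'b) (\<epsilon> (c - m) - s (\<rho> (c - m)))) \<le> d ! \<rho> (c - m)"
      by (rule order_trans[OF degree_monom_le])
    then show ?thesis using that by (auto simp: Z_def degree_monom_le)
  qed
  then show ?thesis by (simp add: row_bounded_mats_def Z_def)
qed

lemma dim_Z: "dim_row Z = Suc m" "dim_col Z = Suc m + n"
  by (simp_all add: Z_def)

lemma Z_app:
  assumes "i < Suc m"
  shows "mat_app Z x i = (if i < m then monom 1 (d ! i) * x i else 0) - (if i > 0 then x (i - 1) else 0)
    + (\<Sum>j<Suc n. if i = \<rho> j then monom 1 (\<epsilon> j - s i) * x (m + j) else 0)"
proof -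
  have "mat_app Z x i = (\<Sum>l<m + Suc n. Z $$ (i, l) * x l)"
    using assms by (simp add: mat_app_def Z_def)
  also have "\<dots> = (\<Sum>l<m. Z $$ (i, l) * x l) + (\<Sum>j<Suc n. Z $$ (i, m + j) * x (m + j))"
    by (rule sum_lessThan_add)
  also have "(\<Sum>j<Suc n. Z $$ (i, m + j) * x (m + j))
      = (\<Sum>j<Suc n. if i = \<rho> j then monom 1 (\<epsilon> j - s i) * x (m + j) else 0)"
    using assms by (intro sum.cong refl) (simp add: Z_def)
  also have "(\<Sum>l<m. Z $$ (i, l) * x l) = (\<Sum>l<m. (if l = i then monom 1 (d ! i) * x i else 0))
      + (\<Sum>l<m. if Suc l = i then - x l else 0)"
    unfolding sum.distrib[symmetric] using assms by (intro sum.cong refl) (auto simp: Z_def)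
  also have "(\<Sum>l<m. if Suc l = i then - x l else 0) = - (if i > 0 then x (i - 1) else 0)"
    using assms by (cases i) simp_all
  finally show ?thesis by simp
qed

lemma weighted_sum_Z_app:
  "(\<Sum>i<Suc m. monom 1 (s i) * mat_app Z x i) = (\<Sum>j<Suc n. monom 1 (\<epsilon> j) * x (m + j))"
proof -
  have "(\<Sum>i<Suc m. monom 1 (s i) * mat_app Z x i) =
      (\<Sum>i<Suc m. if i < m then monom 1 (s (Suc i)) * x i else 0)
      - (\<Sum>i<Suc m. if i > 0 then monom 1 (s i) * x (i - 1) else 0)
      + (\<Sum>i<Suc m. \<Sum>j<Suc n. if i = \<rho> j then monom 1 (\<epsilon> j) * x (m + j) else 0)"
    unfolding sum_subtractf[symmetric] sum.distrib[symmetric]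
  proof (rule sum.cong[OF refl])
    fix i assume i: "i \<in> {..<Suc m}"
    have C: "monom 1 (s i) * (\<Sum>j<Suc n. if i = \<rho> j then monom 1 (\<epsilon> j - s i) * x (m + j) else 0)
      = (\<Sum>j<Suc n. if i = \<rho> j then monom 1 (\<epsilon> j) * x (m + j) else 0)"
      unfolding sum_distrib_left
      by (intro sum.cong refl) (use \<epsilon>_lower in \<open>auto simp: mult.assoc[symmetric] mult_monom\<close>)
    show "monom 1 (s i) * mat_app Z x i = (if i < m then monom 1 (s (Suc i)) * x i else 0)
      - (if i > 0 then monom 1 (s i) * x (i - 1) else 0)
      + (\<Sum>j<Suc n. if i = \<rho> j then monom 1 (\<epsilon> j) * x (m + j) else 0)"
      using i unfolding Z_app[OF i[simplified]] distrib_left right_diff_distrib C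
      by (simp add: mult.assoc[symmetric] mult_monom s_Suc)
  qed
  also have "(\<Sum>i<Suc m. if i < m then monom 1 (s (Suc i)) * x i else 0) = (\<Sum>i<m. monom 1 (s (Suc i)) * x i)"
    by simp
  also have "(\<Sum>i<Suc m. if i > 0 then monom 1 (s i) * x (i - 1) else 0) = (\<Sum>i<m. monom 1 (s (Suc i)) * x i)"
    unfolding sum.lessThan_Suc_shift by simp
  also have "(\<Sum>i<Suc m. \<Sum>j<Suc n. if i = \<rho> j then monom 1 (\<epsilon> j) * x (m + j) else 0)
      = (\<Sum>j<Suc n. \<Sum>i<Suc m. if i = \<rho> j then monom 1 (\<epsilon> j) * x (m + j) else 0)"
    by (rule sum.swap)
  also have "\<dots> = (\<Sum>j<Suc n. monom 1 (\<epsilon> j) * x (m + j))"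
    using \<rho>_less by (intro sum.cong refl) (simp add: less_Suc_eq_le del: sum.lessThan_Suc)
  finally show ?thesis by simp
qed

text \<open>In the weighted sum of the rows the components \<open>x (m + j)\<close>, of degree below
  \<open>k - 1\<close>, appear shifted by \<open>\<epsilon> j\<close>. These shifts are at least
  \<open>k - 1\<close> apart, so no two summands share a degree and each of them vanishes. The
  linking components then vanish one after the other, starting in row 0.\<close>

lemma Z_inj:
  assumes x: "x \<in> bounded_vecs (Suc m + n) (\<lambda>_. k - 1)" and Zx: "mat_app Z x = (0 :: nat \<Rightarrow> 'a::field poly)"
  shows "x = 0"
proof -
  have col: "x (m + j) = 0" if j: "j < Suc n" for j
  proof (rule poly_eqI)
    fix b show "coeff (x (m + j)) b = coeff 0 b"
    proof (cases "b < k - 1")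
      case True
      have "0 = (\<Sum>i<Suc m. monom 1 (s i) * mat_app Z x i)" unfolding Zx by simp
      also have "\<dots> = (\<Sum>j<Suc n. monom 1 (\<epsilon> j) * x (m + j))" by (rule weighted_sum_Z_app)
      finally have "0 = coeff (\<Sum>j<Suc n. monom 1 (\<epsilon> j) * x (m + j)) (\<epsilon> j + b)" by simp
      also have "\<dots> = (\<Sum>i<Suc n. if i = j then coeff (x (m + j)) b else 0)"
        unfolding coeff_sum
      proof (rule sum.cong[OF refl])
        fix i assume i: "i \<in> {..<Suc n}"
        consider "i < j" | "i = j" | "j < i" by linarith
        then show "coeff (monom 1 (\<epsilon> i) * x (m + i)) (\<epsilon> j + b) = (if i = j then coeff (x (m + j)) b else 0)"
        proof cases
          case 1
          then have "\<epsilon> i + (k - 1) \<le> \<epsilon> j" using j by (intro \<epsilon>_gaps) auto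
          then have "coeff (x (m + i)) (\<epsilon> j + b - \<epsilon> i) = 0"
            using x unfolding bounded_vecs_def by auto
          then show ?thesis using 1 by (simp add: coeff_monom_mult)
        next
          case 3
          then have "\<epsilon> j + (k - 1) \<le> \<epsilon> i" using i by (intro \<epsilon>_gaps) auto
          then have "\<not> \<epsilon> i \<le> \<epsilon> j + b" using True by linarith
          then show ?thesis using 3 by (simp add: coeff_monom_mult)
        qed (simp add: coeff_monom_mult)
      qed
      also have "\<dots> = coeff (x (m + j)) b" using j by (simp del: sum.lessThan_Suc)
      finally show ?thesis by simp
    next
      case False
      then show ?thesis using x unfolding bounded_vecs_def by auto
    qed
  qed
  have z: "(\<Sum>j<Suc n. if i = \<rho> j then monom 1 (\<epsilon> j - s i) * x (m + j) else 0) = 0" for i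
    using col by (intro sum.neutral) simp
  have low: "x i = 0" if "i < m" for i
    using that
  proof (induction i)
    case 0
    then have "mat_app Z x 0 = monom 1 (d ! 0) * x 0"
      by (subst Z_app) (simp_all only: z, simp_all)
    then show ?case using Zx by simp
  next
    case (Suc i)
    then have "mat_app Z x (Suc i) = monom 1 (d ! Suc i) * x (Suc i)"
      by (subst Z_app) (simp_all only: z, simp_all)
    then show ?case using Zx by simp
  qed
  show ?thesis
  proof
    fix l
    consider "l < m" | "m \<le> l" "l < Suc m + n" | "l \<ge> Suc m + n" by linarith
    then show "x l = 0 l"
    proof cases
      case 2
      then have "l - m < Suc n" by linarith
      from col[OF this] show ?thesis using 2(1) by simp
    next
      case 3
      then show ?thesis using x by (intro poly_eqI) (simp add: bounded_vecs_def)
    qed (simp add: low)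
  qed
qed

definition img :: "(nat \<Rightarrow> 'a::field poly) set" where
  "img = mat_app Z ` bounded_vecs (Suc m + n) (\<lambda>_. k)"

lemma subspace_img: "pv.subspace img"
  unfolding img_def by (rule pvp.linear_subspace_image[OF linear_mat_app subspace_bounded_vecs])

lemma mat_app_monom_vec:
  assumes "c < Suc m + n"
  shows "mat_app Z (monom_vec c a) i = (if i < Suc m then Z $$ (i, c) * monom 1 a else 0)"
proof -
  have "(\<Sum>l<Suc m + n. Z $$ (i, l) * monom_vec c a l) = (\<Sum>l<Suc m + n. if l = c then Z $$ (i, c) * monom 1 a else 0)"
    by (intro sum.cong refl) (auto simp: monom_vec_def)
  also have "\<dots> = Z $$ (i, c) * monom 1 a" using assms by (simp del: sum.lessThan_Suc add_Suc)
  finally have sum: "(\<Sum>l<Suc m + n. Z $$ (i, l) * monom_vec c a l) = Z $$ (i, c) * monom 1 a" .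
  show ?thesis by (simp only: mat_app_def dim_Z sum)
qed

text \<open>\<open>p\<close> is a weighted degree, in which \<open>monom_vec i a\<close> counts as
  \<open>s i + a\<close>. Column \<open>m + j\<close> reaches the \<open>k\<close> consecutive
  weighted degrees from \<open>\<epsilon> j\<close> on, all in row \<open>\<rho> j\<close>.\<close>

lemma monom_in_img:
  assumes "j \<le> n" "\<epsilon> j \<le> p" "p < \<epsilon> j + k"
  shows "monom_vec (\<rho> j) (p - s (\<rho> j)) \<in> img"
proof -
  have "mat_app Z (monom_vec (m + j) (p - \<epsilon> j)) = monom_vec (\<rho> j) (p - s (\<rho> j))"
  proof
    fix i
    have "\<epsilon> j - s (\<rho> j) + (p - \<epsilon> j) = p - s (\<rho> j)" using \<epsilon>_lower[OF assms(1)] assms(2) by simp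
    then show "mat_app Z (monom_vec (m + j) (p - \<epsilon> j)) i = monom_vec (\<rho> j) (p - s (\<rho> j)) i"
      using \<rho>_less[OF assms(1)] assms(1) by (subst mat_app_monom_vec) (auto simp: Z_def monom_vec_def mult_monom)
  qed
  moreover have "monom_vec (m + j) (p - \<epsilon> j) \<in> bounded_vecs (Suc m + n) (\<lambda>_. k)"
    using assms by (intro monom_vec_bounded) auto
  ultimately show ?thesis unfolding img_def by (metis image_eqI)
qed

lemma link_in_img:
  assumes "l < m" "s (Suc l) \<le> p" "p < s (Suc l) + k"
  shows "monom_vec l (p - s l) - monom_vec (Suc l) (p - s (Suc l)) \<in> img"
proof -
  have "mat_app Z (monom_vec l (p - s (Suc l))) = monom_vec l (p - s l) - monom_vec (Suc l) (p - s (Suc l))"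
  proof
    fix i
    have "d ! l + (p - s (Suc l)) = p - s l" using assms(2) by (simp add: s_Suc)
    then show "mat_app Z (monom_vec l (p - s (Suc l))) i
        = (monom_vec l (p - s l) - monom_vec (Suc l) (p - s (Suc l))) i"
      using assms(1) by (subst mat_app_monom_vec) (auto simp: Z_def monom_vec_def mult_monom)
  qed
  moreover have "monom_vec l (p - s (Suc l)) \<in> bounded_vecs (Suc m + n) (\<lambda>_. k)"
    using assms by (intro monom_vec_bounded) auto
  ultimately show ?thesis unfolding img_def by (metis image_eqI)
qed

text \<open>Linking columns move a monomial to the neighbouring row at constant weighted degree. As
  \<open>s\<close> is monotone, the strictest upper bound on \<open>p\<close> comes from the first
  link and the strictest lower bound from the last.\<close>

lemma chain_in_img:
  assumes "i \<le> i'" "i' < Suc m" "s i' \<le> p" "p < s (Suc i) + k"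
  shows "(monom_vec i (p - s i) :: nat \<Rightarrow> 'b::field poly) - monom_vec i' (p - s i') \<in> img"
  using assms
proof (induction i' rule: dec_induct)
  case base
  show ?case unfolding diff_self by (rule pv.subspace_0[OF subspace_img])
next
  case (step l)
  have "s l \<le> p" using s_mono[of l "Suc l"] step.prems(2) by simp
  then have 1: "(monom_vec i (p - s i) :: nat \<Rightarrow> 'b poly) - monom_vec l (p - s l) \<in> img"
    using step.prems by (intro step.IH) auto
  have "p < s (Suc l) + k" using s_mono[of "Suc i" "Suc l"] step by simp
  then have 2: "(monom_vec l (p - s l) :: nat \<Rightarrow> 'b poly) - monom_vec (Suc l) (p - s (Suc l)) \<in> img"
    using step.prems by (intro link_in_img) auto
  from pv.subspace_add[OF subspace_img 1 2] show ?case by (simp only: add_diff_eq diff_add_cancel)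
qed

text \<open>A start \<open>\<epsilon> j \<le> p\<close> whose successor exceeds \<open>p\<close> is
  less than \<open>k\<close> away from \<open>p\<close>, because gaps are at most \<open>k\<close>;
  beyond the last start \<open>\<epsilon> n = sum_list d\<close> the assumption on \<open>p\<close>
  takes over.\<close>

lemma covered:
  assumes "p < sum_list d + k"
  shows "\<exists>j\<le>n. \<epsilon> j \<le> p \<and> p < \<epsilon> j + k"
proof -
  have "\<exists>j\<le>N. \<epsilon> j \<le> p \<and> (j = N \<or> p < \<epsilon> (Suc j))" for N
  proof (induction N)
    case (Suc N)
    then obtain j where j: "j \<le> N" "\<epsilon> j \<le> p" "j = N \<or> p < \<epsilon> (Suc j)" by blast
    show ?case
    proof (cases "\<epsilon> (Suc N) \<le> p")
      case True
      then show ?thesis by blast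
    next
      case False
      then show ?thesis using j by (metis le_SucI not_le)
    qed
  qed (simp add: \<epsilon>0)
  then obtain j where j: "j \<le> n" "\<epsilon> j \<le> p" "j = n \<or> p < \<epsilon> (Suc j)" by blast
  have "p < \<epsilon> j + k"
    using j gap_le[of j] assms \<epsilon>n by (cases "j = n") auto
  with j show ?thesis by blast
qed

text \<open>Each monomial has a weighted degree that some column \<open>m + j\<close> reaches, and
  links connect row \<open>\<rho> j\<close> with the row wanted. Chains are oriented by increasing
  row index, hence one case adds the chain and the other subtracts it.\<close>

lemma Z_surj: "(bounded_vecs (Suc m) (\<lambda>i. k + d ! i) :: (nat \<Rightarrow> 'b::field poly) set) \<subseteq> img"
proof -
  have "(monom_vec i a :: nat \<Rightarrow> 'b poly) \<in> img" if i: "i < Suc m" and a: "a < k + d ! i" for i a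
  proof -
    define p where "p = s i + a"
    have p: "s i \<le> p" "p < s (Suc i) + k" using a by (auto simp: p_def s_Suc)
    have "p < sum_list d + k" using p(2) s_mono[of "Suc i" "Suc m"] i s_total by simp
    then obtain j where j: "j \<le> n" "\<epsilon> j \<le> p" "p < \<epsilon> j + k" using covered by blast
    let ?r = "\<rho> j"
    have r: "?r < Suc m" by (rule \<rho>_less[OF j(1)])
    have sr: "s ?r \<le> p" using \<epsilon>_lower[OF j(1)] j(2) by simp
    have hit: "(monom_vec ?r (p - s ?r) :: nat \<Rightarrow> 'b poly) \<in> img" by (rule monom_in_img[OF j])
    have "(monom_vec i (p - s i) :: nat \<Rightarrow> 'b poly) \<in> img"
    proof (cases "i \<le> ?r")
      case True
      from pv.subspace_add[OF subspace_img chain_in_img[OF True r sr p(2)] hit] show ?thesis by (simp only: diff_add_cancel)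
    next
      case False
      have "p < s (Suc ?r) + k" using \<epsilon>_upper[OF j(1)] j(3) by (simp add: s_Suc)
      then have "(monom_vec ?r (p - s ?r) :: nat \<Rightarrow> 'b poly) - monom_vec i (p - s i) \<in> img"
        using False i p(1) by (intro chain_in_img) auto
      from pv.subspace_diff[OF subspace_img hit this] show ?thesis by (simp only: diff_diff_eq2 add_diff_cancel_left')
    qed
    then show ?thesis by (simp add: p_def)
  qed
  then show ?thesis
    unfolding bounded_vecs_basis(3) by (intro pv.span_minimal[OF _ subspace_img]) auto
qed

end

theorem full_trimmed_sylvester_exists:
  assumes "m > 0" "length d = m" "k \<ge> 1" "n * k = sum_list d + t" "t < n"
  shows "\<exists>M :: 'a::field poly mat. row_bounded m n d M \<and>
    row_bounded.syl_surj m n d M k \<and> row_bounded.syl_inj m n M (k - 1)"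
proof -
  obtain m' where m': "m = Suc m'" using assms(1) by (cases m) auto
  \<comment> \<open>The first \<open>t\<close> gaps are \<open>k - 1\<close> and the others
    \<open>k\<close>, the minimal indices to be realised; the last point is
    \<open>n * k - t = sum_list d\<close>. By \<open>le\<close> below, the subtraction does not
    truncate.\<close>
  define \<epsilon> where "\<epsilon> j = j * k - min j t" for j
  have le: "min j t \<le> j * k" for j using assms(3) by (cases k) auto
  have step: "\<epsilon> (Suc j) = \<epsilon> j + (if j < t then k - 1 else k)" for j
    using le[of j] assms(3) by (auto simp: \<epsilon>_def min_def)
  have \<epsilon>n: "\<epsilon> n = sum_list d" using assms(4,5) by (simp add: \<epsilon>_def)
  have mono: "\<epsilon> j \<le> \<epsilon> n" if "j \<le> n" for j
    using that by (induction rule: inc_induct) (auto simp: step)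
  have total: "(\<Sum>l<m. d ! l) = sum_list d"
    using assms(2) by (simp add: sum_list_sum_nth lessThan_atLeast0)
  have "\<exists>i<m. (\<Sum>l<i. d ! l) \<le> \<epsilon> j \<and> \<epsilon> j \<le> (\<Sum>l<Suc i. d ! l)" if "j \<le> n" for j
    using breakpoints_locate[of m "\<lambda>i. \<Sum>l<i. d ! l" "\<epsilon> j"] assms(1) mono[OF that] \<epsilon>n total by simp
  then obtain \<rho> where \<rho>: "\<And>j. j \<le> n \<Longrightarrow> \<rho> j < m \<and> (\<Sum>l<\<rho> j. d ! l) \<le> \<epsilon> j \<and> \<epsilon> j \<le> (\<Sum>l<Suc (\<rho> j). d ! l)"
    by metis
  interpret zigzag m' n d \<epsilon> \<rho> k
    by unfold_locales (use assms(2,3) \<rho> \<epsilon>n in \<open>auto simp: m' step \<epsilon>_def[of 0]\<close>)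
  interpret Z: row_bounded m n d "Z :: 'a poly mat"
    by unfold_locales (use Z_bounded assms(2) in \<open>auto simp: m'\<close>)
  have "Z.syl_surj k"
    unfolding Z.syl_surj_def
  proof
    fix y :: "nat \<Rightarrow> 'a poly" assume "y \<in> bounded_vecs m (\<lambda>i. k + d ! i)"
    then have "y \<in> img" using Z_surj by (auto simp: m')
    then show "\<exists>x\<in>bounded_vecs (m + n) (\<lambda>_. k). mat_app Z x = y" by (auto simp: img_def m')
  qed
  moreover have "Z.syl_inj (k - 1)"
    unfolding Z.syl_inj_def
  proof (intro ballI impI)
    fix x :: "nat \<Rightarrow> 'a poly" assume "x \<in> bounded_vecs (m + n) (\<lambda>_. k - 1)" "mat_app Z x = 0"
    then show "x = 0" unfolding m' by (rule Z_inj)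
  qed
  ultimately show ?thesis using Z.row_bounded_axioms by blast
qed

subsection \<open>Perturbation\<close>

lemma tendsto_det:
  fixes A :: "'i \<Rightarrow> 'a::real_normed_field mat"
  assumes A: "\<And>x. A x \<in> carrier_mat n n" "B \<in> carrier_mat n n"
    and lim: "\<And>i j. i < n \<Longrightarrow> j < n \<Longrightarrow> ((\<lambda>x. A x $$ (i, j)) \<longlongrightarrow> B $$ (i, j)) F"
  shows "((\<lambda>x. det (A x)) \<longlongrightarrow> det B) F"
proof -
  have "p i < n" if "p permutes {0..<n}" "i < n" for p i
    using permutes_in_image[OF that(1), of i] that(2) by simp
  then have "((\<lambda>x. \<Sum>p | p permutes {0..<n}. signof p * (\<Prod>i = 0..<n. A x $$ (i, p i))) \<longlongrightarrow>
      (\<Sum>p | p permutes {0..<n}. signof p * (\<Prod>i = 0..<n. B $$ (i, p i)))) F"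
    by (intro tendsto_sum tendsto_mult tendsto_const tendsto_prod lim) auto
  then show ?thesis by (simp only: det_def'[OF A(1)] det_def'[OF A(2)])
qed

lemma mult_mat_index_sum:
  assumes "A \<in> carrier_mat nr n" "B \<in> carrier_mat n nc" "i < nr" "j < nc"
  shows "(A * B) $$ (i, j) = (\<Sum>l<n. A $$ (i, l) * B $$ (l, j))"
  using assms by (simp add: scalar_prod_def lessThan_atLeast0)

lemma sum_affine_left:
  fixes s :: "'a::comm_ring_1"
  shows "(\<Sum>l\<in>I. (a l + s * (b l - a l)) * c l) = (\<Sum>l\<in>I. a l * c l) + s * ((\<Sum>l\<in>I. b l * c l) - (\<Sum>l\<in>I. a l * c l))"
  by (simp add: algebra_simps sum.distrib sum_subtractf sum_distrib_left)

lemma sum_affine_right: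
  fixes s :: "'a::comm_ring_1"
  shows "(\<Sum>l\<in>I. c l * (a l + s * (b l - a l))) = (\<Sum>l\<in>I. c l * a l) + s * ((\<Sum>l\<in>I. c l * b l) - (\<Sum>l\<in>I. c l * a l))"
  by (simp add: algebra_simps sum.distrib sum_subtractf sum_distrib_left)

lemma coeff_diff_le_dist:
  assumes "M \<in> row_bounded_mats m n d" "M' \<in> row_bounded_mats m n d" "i < m" "l < m + n"
  shows "norm (coeff (M $$ (i, l)) j - coeff (M' $$ (i, l)) j) \<le> poly_mat_dist d M M'"
proof (cases "j \<le> d ! i")
  case True
  have dims: "dim_row M = m" "dim_col M = m + n" using assms(1) by (auto simp: row_bounded_mats_def)
  define f where "f = (\<lambda>i j l. norm (coeff (M $$ (i, l)) j - coeff (M' $$ (i, l)) j))"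
  have "f i j l \<le> L2_set (f i j) {..<m + n}"
    by (rule member_le_L2_set) (use assms(4) in auto)
  then have "(f i j l)\<^sup>2 \<le> (L2_set (f i j) {..<m + n})\<^sup>2" by (rule power_mono) (simp add: f_def)
  also have "\<dots> \<le> (\<Sum>j\<le>d ! i. (L2_set (f i j) {..<m + n})\<^sup>2)"
    by (rule member_le_sum[of j]) (use True in auto)
  also have "\<dots> \<le> (\<Sum>i<m. \<Sum>j\<le>d ! i. (L2_set (f i j) {..<m + n})\<^sup>2)"
    by (rule member_le_sum[of i]) (use assms(3) in \<open>auto intro: sum_nonneg\<close>)
  finally have "f i j l \<le> sqrt (\<Sum>i<m. \<Sum>j\<le>d ! i. (L2_set (f i j) {..<m + n})\<^sup>2)"
    by (rule real_le_rsqrt)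
  then show ?thesis by (simp add: poly_mat_dist_def dims f_def)
next
  case False
  have "degree (M $$ (i, l)) \<le> d ! i" "degree (M' $$ (i, l)) \<le> d ! i"
    using assms by (auto simp: row_bounded_mats_def)
  then have "coeff (M $$ (i, l)) j = 0" "coeff (M' $$ (i, l)) j = 0"
    using False by (auto intro!: coeff_eq_0)
  then show ?thesis by (simp add: poly_mat_dist_def sum_nonneg)
qed

lemma poly_mat_dist_scale:
  fixes M M' :: "'a::real_normed_field poly mat"
  assumes M: "M \<in> carrier_mat m q" "M' \<in> carrier_mat m q"
  defines "N \<equiv> \<lambda>s. mat m q (\<lambda>(i, l). M $$ (i, l) + Polynomial.smult s (M' $$ (i, l) - M $$ (i, l)))"
  shows "poly_mat_dist d M (N s) = norm s * poly_mat_dist d M M'"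
proof -
  have "coeff (M $$ (i, l)) j - coeff (N s $$ (i, l)) j = s * (coeff (M $$ (i, l)) j - coeff (M' $$ (i, l)) j)"
    if "i < m" "l < q" for i j l
    using that by (simp add: N_def algebra_simps)
  then have "L2_set (\<lambda>l. norm (coeff (M $$ (i, l)) j - coeff (N s $$ (i, l)) j)) {..<q} =
      norm s * L2_set (\<lambda>l. norm (coeff (M $$ (i, l)) j - coeff (M' $$ (i, l)) j)) {..<q}" if "i < m" for i j
    unfolding L2_set_right_distrib[OF norm_ge_zero] using that
    by (intro L2_set_cong refl) (simp add: norm_mult)
  then have "(\<Sum>i<m. \<Sum>j\<le>d ! i. (L2_set (\<lambda>l. norm (coeff (M $$ (i, l)) j - coeff (N s $$ (i, l)) j)) {..<q})\<^sup>2) =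
      (norm s)\<^sup>2 * (\<Sum>i<m. \<Sum>j\<le>d ! i. (L2_set (\<lambda>l. norm (coeff (M $$ (i, l)) j - coeff (M' $$ (i, l)) j)) {..<q})\<^sup>2)"
    unfolding sum_distrib_left by (intro sum.cong refl) (simp add: power_mult_distrib)
  then show ?thesis using M by (simp add: poly_mat_dist_def real_sqrt_mult)
qed

context row_bounded
begin

lemma trimmed_sylvester_carrier:
  assumes "m > 0"
  shows "trimmed_sylvester_mat d k M \<in> carrier_mat (k * m + sum_list d) (k * (m + n))"
  using dim_trimmed_sylvester_mat[OF assms] card_rows_kept[OF assms] by auto

text \<open>Full rank is certified by a one-sided inverse of each of the two critical matrices: a nearby
  matrix has full trimmed Sylvester rank if its products with these inverses are nonsingular.\<close>

lemma full_rank_certificate: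
  assumes "m > 0" "k \<ge> 1" "n * k = sum_list d + t" "t < n" and full: "full_trimmed_sylvester_rank d M"
  shows "\<exists>B\<in>carrier_mat (k * (m + n)) (k * m + sum_list d). \<exists>C\<in>carrier_mat ((k - 1) * (m + n)) ((k - 1) * m + sum_list d).
    trimmed_sylvester_mat d k M * B = 1\<^sub>m (k * m + sum_list d) \<and>
    C * trimmed_sylvester_mat d (k - 1) M = 1\<^sub>m ((k - 1) * (m + n))"
proof -
  note T = trimmed_sylvester_carrier[OF assms(1)]
  have crit: "syl_surj k" "syl_inj (k - 1)"
    using full full_trimmed_sylvester_rank_iff_critical[OF assms(1-4)] by auto
  have "mat_rank (trimmed_sylvester_mat d k M) = dim_row (trimmed_sylvester_mat d k M)"
    using crit(1) rank_trimmed_sylvester_row_iff[OF assms(1)] T[of k] by simp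
  then have "\<exists>B\<in>carrier_mat (k * (m + n)) (k * m + sum_list d). trimmed_sylvester_mat d k M * B = 1\<^sub>m (k * m + sum_list d)"
    unfolding mat_rank_eq_dim_row_iff using T[of k] by (intro right_inverse_exists) auto
  moreover have "mat_rank (trimmed_sylvester_mat d (k - 1) M) = dim_col (trimmed_sylvester_mat d (k - 1) M)"
    using crit(2) rank_trimmed_sylvester_col_iff[OF assms(1)] T[of "k - 1"] by simp
  then have "\<exists>C\<in>carrier_mat ((k - 1) * (m + n)) ((k - 1) * m + sum_list d).
      C * trimmed_sylvester_mat d (k - 1) M = 1\<^sub>m ((k - 1) * (m + n))"
    unfolding mat_rank_eq_dim_col_iff using T[of "k - 1"] by (intro left_inverse_exists) auto
  ultimately show ?thesis by blast
qed

lemma full_rankI: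
  assumes "m > 0" "k \<ge> 1" "n * k = sum_list d + t" "t < n"
    and B: "B \<in> carrier_mat (k * (m + n)) (k * m + sum_list d)" "det (trimmed_sylvester_mat d k M * B) \<noteq> 0"
    and C: "C \<in> carrier_mat ((k - 1) * (m + n)) ((k - 1) * m + sum_list d)" "det (C * trimmed_sylvester_mat d (k - 1) M) \<noteq> 0"
  shows "full_trimmed_sylvester_rank d M"
  unfolding full_trimmed_sylvester_rank_iff_critical[OF assms(1-4)]
    rank_trimmed_sylvester_row_iff[OF assms(1), symmetric] rank_trimmed_sylvester_col_iff[OF assms(1), symmetric]
  using mat_rank_eq_dim_rowI[OF trimmed_sylvester_carrier[OF assms(1)] B]
    mat_rank_eq_dim_colI[OF trimmed_sylvester_carrier[OF assms(1)] C] by blast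

end

lemma tendsto_trimmed_sylvester:
  fixes X :: "'i \<Rightarrow> 'a::real_normed_field poly mat"
  assumes "\<And>x. row_bounded m n d (X x)" "row_bounded m n d M" "m > 0"
    and lim: "\<And>i l j. i < m \<Longrightarrow> l < m + n \<Longrightarrow> ((\<lambda>x. coeff (X x $$ (i, l)) j) \<longlongrightarrow> coeff (M $$ (i, l)) j) F"
    and p: "p < k * m + sum_list d" "c < k * (m + n)"
  shows "((\<lambda>x. trimmed_sylvester_mat d k (X x) $$ (p, c)) \<longlongrightarrow> trimmed_sylvester_mat d k M $$ (p, c)) F"
proof -
  let ?R = "row_bounded.rows_kept m d k"
  have pc: "p < card ?R" using p row_bounded.card_rows_kept[OF assms(2,3)] by simp
  have "c mod (m + n) < m + n" "pick ?R p mod m < m" using assms(3) by simp_all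
  then show ?thesis
    using pc p(2) lim
    by (cases "c div (m + n) \<le> pick ?R p div m \<and> pick ?R p div m - c div (m + n) \<le> Max (set d)")
      (simp_all only: row_bounded.trimmed_sylvester_mat_eq[OF assms(1,3)]
        row_bounded.trimmed_sylvester_mat_eq[OF assms(2,3)] Let_def index_mat split if_True if_False tendsto_const simp_thms)
qed

text \<open>The one-sided inverses \<open>B\<close> and \<open>C\<close> of the critical matrices of
  the limit \<open>M\<close> stay fixed. The determinants of the products with them tend to 1, hence
  are eventually nonzero.\<close>

lemma eventually_full_rank:
  fixes X :: "'i \<Rightarrow> 'a::real_normed_field poly mat"
  assumes X: "\<And>x. row_bounded m n d (X x)" and M: "row_bounded m n d M" and m: "m > 0"
    and k: "k \<ge> 1" "n * k = sum_list d + t" "t < n"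
    and lim: "\<And>i l j. i < m \<Longrightarrow> l < m + n \<Longrightarrow> ((\<lambda>x. coeff (X x $$ (i, l)) j) \<longlongrightarrow> coeff (M $$ (i, l)) j) F"
    and full: "full_trimmed_sylvester_rank d M"
  shows "eventually (\<lambda>x. full_trimmed_sylvester_rank d (X x)) F"
proof -
  let ?T = "trimmed_sylvester_mat d"
  note TM = row_bounded.trimmed_sylvester_carrier[OF M m]
  note TX = row_bounded.trimmed_sylvester_carrier[OF X m]
  obtain B C where B: "B \<in> carrier_mat (k * (m + n)) (k * m + sum_list d)" "?T k M * B = 1\<^sub>m (k * m + sum_list d)"
    and C: "C \<in> carrier_mat ((k - 1) * (m + n)) ((k - 1) * m + sum_list d)"
      "C * ?T (k - 1) M = 1\<^sub>m ((k - 1) * (m + n))"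
    using row_bounded.full_rank_certificate[OF M m k full] by blast
  have "((\<lambda>x. det (?T k (X x) * B)) \<longlongrightarrow> det (?T k M * B)) F"
  proof (rule tendsto_det)
    fix i j assume ij: "i < k * m + sum_list d" "j < k * m + sum_list d"
    have "((\<lambda>x. \<Sum>l = 0..<k * (m + n). ?T k (X x) $$ (i, l) * B $$ (l, j)) \<longlongrightarrow>
        (\<Sum>l = 0..<k * (m + n). ?T k M $$ (i, l) * B $$ (l, j))) F"
      using ij by (intro tendsto_sum tendsto_mult tendsto_const tendsto_trimmed_sylvester[OF X M m lim]) auto
    then show "((\<lambda>x. (?T k (X x) * B) $$ (i, j)) \<longlongrightarrow> (?T k M * B) $$ (i, j)) F"
      using ij B(1) by (simp add: scalar_prod_def carrier_matD[OF TM] carrier_matD[OF TX])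
  qed (rule mult_carrier_mat[OF TX B(1)] mult_carrier_mat[OF TM B(1)])+
  then have 1: "eventually (\<lambda>x. det (?T k (X x) * B) \<noteq> 0) F"
    unfolding B(2) by (intro tendsto_imp_eventually_ne[where c = 1]) simp_all
  have "((\<lambda>x. det (C * ?T (k - 1) (X x))) \<longlongrightarrow> det (C * ?T (k - 1) M)) F"
  proof (rule tendsto_det)
    fix i j assume ij: "i < (k - 1) * (m + n)" "j < (k - 1) * (m + n)"
    have "((\<lambda>x. \<Sum>l = 0..<(k - 1) * m + sum_list d. C $$ (i, l) * ?T (k - 1) (X x) $$ (l, j)) \<longlongrightarrow>
        (\<Sum>l = 0..<(k - 1) * m + sum_list d. C $$ (i, l) * ?T (k - 1) M $$ (l, j))) F"
      using ij by (intro tendsto_sum tendsto_mult tendsto_const tendsto_trimmed_sylvester[OF X M m lim]) auto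
    then show "((\<lambda>x. (C * ?T (k - 1) (X x)) $$ (i, j)) \<longlongrightarrow> (C * ?T (k - 1) M) $$ (i, j)) F"
      using ij C(1) by (simp add: scalar_prod_def carrier_matD[OF TM] carrier_matD[OF TX])
  qed (rule mult_carrier_mat[OF C(1) TX] mult_carrier_mat[OF C(1) TM])+
  then have 2: "eventually (\<lambda>x. det (C * ?T (k - 1) (X x)) \<noteq> 0) F"
    unfolding C(2) by (intro tendsto_imp_eventually_ne[where c = 1]) simp_all
  from 1 2 show ?thesis
    by eventually_elim (rule row_bounded.full_rankI[OF X m k B(1) _ C(1)])
qed

text \<open>Failure for every radius yields matrices without full rank at distance below
  \<open>1 / real (Suc j)\<close> from \<open>M\<close>. They converge to \<open>M\<close>
  coefficientwise, against \<open>eventually_full_rank\<close>.\<close>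

lemma full_rank_open:
  fixes M :: "'a::real_normed_field poly mat"
  assumes m: "m > 0" "length d = m" and k: "k \<ge> 1" "n * k = sum_list d + t" "t < n"
    and M: "M \<in> row_bounded_mats m n d" and full: "full_trimmed_sylvester_rank d M"
  shows "\<exists>\<epsilon>>0. \<forall>M'\<in>row_bounded_mats m n d. poly_mat_dist d M' M < \<epsilon> \<longrightarrow> full_trimmed_sylvester_rank d M'"
proof (rule ccontr)
  assume neg: "\<not> ?thesis"
  have "\<exists>M'. M' \<in> row_bounded_mats m n d \<and> poly_mat_dist d M' M < 1 / real (Suc j) \<and>
      \<not> full_trimmed_sylvester_rank d M'" for j
    using neg by (metis of_nat_0_less_iff zero_less_Suc zero_less_divide_1_iff)
  then obtain X where X: "\<And>j. X j \<in> row_bounded_mats m n d" "\<And>j. poly_mat_dist d (X j) M < 1 / real (Suc j)"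
    "\<And>j. \<not> full_trimmed_sylvester_rank d (X j)" by metis
  have rX: "row_bounded m n d (X j)" for j using X(1) m by unfold_locales auto
  have rM: "row_bounded m n d M" using M m by unfold_locales auto
  have "(\<lambda>x. coeff (X x $$ (i, l)) j) \<longlonglongrightarrow> coeff (M $$ (i, l)) j" if il: "i < m" "l < m + n" for i l j
  proof (rule LIM_zero_cancel, rule tendsto_0_le[OF LIMSEQ_inverse_real_of_nat, where K = 1])
    have "norm (coeff (X x $$ (i, l)) j - coeff (M $$ (i, l)) j) \<le> inverse (real (Suc x))" for x
      using coeff_diff_le_dist[OF X(1) M il, of x j] X(2)[of x] by (simp add: inverse_eq_divide)
    then show "eventually (\<lambda>x. norm (coeff (X x $$ (i, l)) j - coeff (M $$ (i, l)) j) \<le> norm (inverse (real (Suc x))) * 1) sequentially"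
      by simp
  qed
  from eventually_full_rank[OF rX rM m(1) k this full]
  have "eventually (\<lambda>j. False) sequentially" using X(3) by simp
  then show False by simp
qed

text \<open>Along the line \<open>N s\<close> from \<open>M\<close> to a matrix \<open>M0\<close> of
  full rank, the two determinants formed with the one-sided inverses for \<open>M0\<close> are
  polynomials in \<open>s\<close> with value 1 at \<open>s = 1\<close>. Their product has finitely
  many zeros, so arbitrarily small \<open>s\<close> avoid them.\<close>

lemma full_rank_dense:
  fixes M :: "'a::real_normed_field poly mat"
  assumes m: "m > 0" "length d = m" and k: "k \<ge> 1" "n * k = sum_list d + t" "t < n"
    and M: "M \<in> row_bounded_mats m n d" and \<epsilon>: "\<epsilon> > 0"
  shows "\<exists>M'\<in>row_bounded_mats m n d. poly_mat_dist d M M' < \<epsilon> \<and> full_trimmed_sylvester_rank d M'"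
proof -
  let ?q = "m + n" and ?T = "trimmed_sylvester_mat d"
  obtain M0 :: "'a poly mat" where M0: "row_bounded m n d M0"
    "row_bounded.syl_surj m n d M0 k" "row_bounded.syl_inj m n M0 (k - 1)"
    using full_trimmed_sylvester_exists[OF m k] by blast
  have full0: "full_trimmed_sylvester_rank d M0"
    using M0(2,3) row_bounded.full_trimmed_sylvester_rank_iff_critical[OF M0(1) m(1) k] by simp
  have M0b: "M0 \<in> row_bounded_mats m n d" using M0(1) by (simp add: row_bounded_def)
  define N where "N s = mat m ?q (\<lambda>(i, l). M $$ (i, l) + Polynomial.smult s (M0 $$ (i, l) - M $$ (i, l)))" for s
  have Nb: "N s \<in> row_bounded_mats m n d" for s
    using M M0b unfolding row_bounded_mats_def N_def
    by (auto intro!: degree_add_le order_trans[OF degree_smult_le] degree_diff_le)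
  have rN: "row_bounded m n d (N s)" for s using Nb m by unfold_locales auto
  have rM: "row_bounded m n d M" using M m by unfold_locales auto
  have N1: "N 1 = M0" using M0b by (intro eq_matI) (auto simp: N_def row_bounded_mats_def)
  note TM = row_bounded.trimmed_sylvester_carrier[OF rM m(1)]
  note T0 = row_bounded.trimmed_sylvester_carrier[OF M0(1) m(1)]
  note TN = row_bounded.trimmed_sylvester_carrier[OF rN m(1)]
  have affine: "?T k (N s) $$ (p, c) = ?T k M $$ (p, c) + s * (?T k M0 $$ (p, c) - ?T k M $$ (p, c))"
    if pc: "p < k * m + sum_list d" "c < k * ?q" for k s p c
  proof -
    have "p < card (row_bounded.rows_kept m d k)"
      using pc row_bounded.card_rows_kept[OF rM m(1)] by simp
    moreover have "c mod ?q < ?q" "pick (row_bounded.rows_kept m d k) p mod m < m" using m(1) by simp_all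
    moreover have "coeff (N s $$ (i, l)) j = coeff (M $$ (i, l)) j + s * (coeff (M0 $$ (i, l)) j - coeff (M $$ (i, l)) j)"
      if "i < m" "l < ?q" for i l j using that by (simp add: N_def)
    ultimately show ?thesis
      using pc(2) by (simp add: row_bounded.trimmed_sylvester_mat_eq[OF rN m(1)]
        row_bounded.trimmed_sylvester_mat_eq[OF rM m(1)] row_bounded.trimmed_sylvester_mat_eq[OF M0(1) m(1)]
        Let_def)
  qed
  from row_bounded.full_rank_certificate[OF M0(1) m(1) k full0]
  obtain B C where B: "B \<in> carrier_mat (k * ?q) (k * m + sum_list d)" "?T k M0 * B = 1\<^sub>m (k * m + sum_list d)"
    and C: "C \<in> carrier_mat ((k - 1) * ?q) ((k - 1) * m + sum_list d)"
      "C * ?T (k - 1) M0 = 1\<^sub>m ((k - 1) * ?q)"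
    by (elim bexE conjE)
  \<comment> \<open>The variable here is the parameter \<open>s\<close>, not that of
    \<open>M\<close>: the entries of the Sylvester matrices of \<open>N s\<close> are affine in
    \<open>s\<close>, and \<open>P\<close> and \<open>Q\<close> collect the resulting products with
    \<open>B\<close> and \<open>C\<close>.\<close>
  define P where "P = mat (k * m + sum_list d) (k * m + sum_list d) (\<lambda>(i, j).
    [:(?T k M * B) $$ (i, j), (?T k M0 * B) $$ (i, j) - (?T k M * B) $$ (i, j):])"
  define Q where "Q = mat ((k - 1) * ?q) ((k - 1) * ?q) (\<lambda>(i, j).
    [:(C * ?T (k - 1) M) $$ (i, j), (C * ?T (k - 1) M0) $$ (i, j) - (C * ?T (k - 1) M) $$ (i, j):])"
  have P: "poly (det P) s = det (?T k (N s) * B)" for s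
  proof -
    interpret comm_ring_hom "\<lambda>p. poly p s" by unfold_locales auto
    have "map_mat (\<lambda>p. poly p s) P = ?T k (N s) * B"
    proof (rule eq_matI)
      fix i j assume "i < dim_row (?T k (N s) * B)" "j < dim_col (?T k (N s) * B)"
      then have ij: "i < k * m + sum_list d" "j < k * m + sum_list d" using TN[of k s] B by auto
      then show "map_mat (\<lambda>p. poly p s) P $$ (i, j) = (?T k (N s) * B) $$ (i, j)"
        unfolding mult_mat_index_sum[OF TN B(1) ij] using ij
        by (simp add: P_def mult_mat_index_sum[OF TM B(1) ij] mult_mat_index_sum[OF T0 B(1) ij] affine sum_affine_left)
    qed (use B in \<open>auto simp: P_def carrier_matD[OF TN]\<close>)
    then show ?thesis using hom_det[of P] by simp
  qed
  have Q: "poly (det Q) s = det (C * ?T (k - 1) (N s))" for s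
  proof -
    interpret comm_ring_hom "\<lambda>p. poly p s" by unfold_locales auto
    have "map_mat (\<lambda>p. poly p s) Q = C * ?T (k - 1) (N s)"
    proof (rule eq_matI)
      fix i j assume "i < dim_row (C * ?T (k - 1) (N s))" "j < dim_col (C * ?T (k - 1) (N s))"
      then have ij: "i < (k - 1) * ?q" "j < (k - 1) * ?q" using TN[of "k - 1" s] C by auto
      then show "map_mat (\<lambda>p. poly p s) Q $$ (i, j) = (C * ?T (k - 1) (N s)) $$ (i, j)"
        unfolding mult_mat_index_sum[OF C(1) TN ij] using ij
        by (simp add: Q_def mult_mat_index_sum[OF C(1) TM ij] mult_mat_index_sum[OF C(1) T0 ij] affine sum_affine_right
            del: One_nat_def)
    qed (use C in \<open>auto simp: Q_def carrier_matD[OF TN]\<close>)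
    then show ?thesis using hom_det[of Q] by simp
  qed
  have "poly (det P * det Q) 1 = 1" by (simp add: P Q N1 B(2) C(2) del: One_nat_def)
  then have "det P * det Q \<noteq> 0" by force
  then have fin: "finite {s. poly (det P * det Q) s = 0}" by (rule poly_roots_finite)
  \<comment> \<open>The summand 1 keeps the denominator positive even if the distance is 0.\<close>
  define \<delta> where "\<delta> = \<epsilon> / (poly_mat_dist d M M0 + 1)"
  have dist0: "poly_mat_dist d M M0 \<ge> 0" by (simp add: poly_mat_dist_def sum_nonneg)
  have \<delta>: "\<delta> > 0" using \<epsilon> dist0 by (simp add: \<delta>_def)
  \<comment> \<open>Embedded real parameters are available in every field considered, and infinitely
    many of them have norm below \<delta>.\<close>
  have "infinite ((of_real :: real \<Rightarrow> 'a) ` {0<..<\<delta>})"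
    using \<delta> by (simp add: finite_image_iff inj_on_def)
  then obtain s where s: "s \<in> of_real ` {0<..<\<delta>}" "poly (det P * det Q) s \<noteq> 0"
    using fin by (metis (mono_tags, lifting) finite_subset mem_Collect_eq subsetI)
  have "norm s < \<delta>" using s(1) by auto
  then have "norm s * (poly_mat_dist d M M0 + 1) < \<epsilon>"
    using dist0 by (simp add: \<delta>_def pos_less_divide_eq)
  moreover have "poly_mat_dist d M (N s) = norm s * poly_mat_dist d M M0"
    unfolding N_def by (rule poly_mat_dist_scale) (use M M0b in \<open>auto simp: row_bounded_mats_def\<close>)
  ultimately have "poly_mat_dist d M (N s) < \<epsilon>"
    using norm_ge_zero[of s] unfolding distrib_left by linarith
  moreover have "full_trimmed_sylvester_rank d (N s)"
    by (rule row_bounded.full_rankI[OF rN m(1) k B(1) _ C(1)]) (use s(2) P Q in auto)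
  ultimately show ?thesis using Nb by blast
qed

text \<open>Only a norm and the embedded reals are asked of the field, so that one proof covers the
  real and the complex numbers.\<close>

lemma TSyl_generic:
  fixes m n k' t :: nat and d :: "nat list"
  assumes "m > 0" and "n > 0" and "length d = m" and "Max (set d) > 0"
    and "n * k' = sum_list d + t" and "t < n"
  shows "(\<forall>M \<in> (row_bounded_mats m n d :: 'a::real_normed_field poly mat set). \<forall>\<epsilon>>0.
            \<exists>M' \<in> TSyl m n d. poly_mat_dist d M M' < \<epsilon> \<and>
              is_minimal_basis_mat M' \<and>
              mat_rank (leading_row_coeff_mat d M') = m \<and>
              (\<forall>i<m. vec_degree (row M' i) = d ! i) \<and>
              length (right_minimal_indices M') = n \<and>
              count_list (right_minimal_indices M') (k' - 1) = t \<and>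
              count_list (right_minimal_indices M') k' = n - t) \<and>
         (\<forall>M' \<in> (TSyl m n d :: 'a poly mat set). \<exists>\<epsilon>>0.
            \<forall>M \<in> row_bounded_mats m n d. poly_mat_dist d M M' < \<epsilon> \<longrightarrow>
              full_trimmed_sylvester_rank d M)"
proof (intro conjI ballI allI impI)
  \<comment> \<open>Positivity of \<open>Max (set d)\<close> gives \<open>sum_list d > 0\<close> and
    hence \<open>k' \<ge> 1\<close>, so that \<open>k' - 1\<close> is a genuine difference.\<close>
  have "d \<noteq> []" using assms(1,3) by auto
  then have "Max (set d) \<in> set d" by (intro Max_in) auto
  then have "Max (set d) \<le> sum_list d" by (intro member_le_sum_list) simp_all
  then have "n * k' > 0" using assms(4,5) by linarith
  then have k: "k' \<ge> 1" by (cases k') auto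
  {
    fix M :: "'a poly mat" and \<epsilon> :: real
    assume M: "M \<in> row_bounded_mats m n d" and \<epsilon>: "\<epsilon> > 0"
    obtain M' where M': "M' \<in> row_bounded_mats m n d" "poly_mat_dist d M M' < \<epsilon>" "full_trimmed_sylvester_rank d M'"
      using full_rank_dense[OF assms(1,3) k assms(5,6) M \<epsilon>] by blast
    interpret row_bounded m n d M' using M'(1) assms(3) by unfold_locales auto
    have crit: "syl_surj k'" "syl_inj (k' - 1)"
      using M'(3) full_trimmed_sylvester_rank_iff_critical[OF assms(1) k assms(5,6)] by auto
    have idx: "right_minimal_indices M' = sort (map (\<lambda>i. if i < t then k' - 1 else k') [0..<n])"
      by (rule right_minimal_indices_eq[OF assms(1) crit(1) k crit(2) assms(5,6)])
    have "is_minimal_basis_mat M'"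
      unfolding is_minimal_basis_mat_def dims
      using rows_minimal_basis(1)[OF assms(1) crit(1) k] assms(2) by simp
    then show "\<exists>M' \<in> TSyl m n d. poly_mat_dist d M M' < \<epsilon> \<and>
              is_minimal_basis_mat M' \<and>
              mat_rank (leading_row_coeff_mat d M') = m \<and>
              (\<forall>i<m. vec_degree (row M' i) = d ! i) \<and>
              length (right_minimal_indices M') = n \<and>
              count_list (right_minimal_indices M') (k' - 1) = t \<and>
              count_list (right_minimal_indices M') k' = n - t"
      using M' rank_leading_row_coeff_mat[OF crit(1) k] rows_minimal_basis(2)[OF assms(1) crit(1) k]
        sort_two_valued_counts[OF k less_imp_le[OF assms(6)]]
      by (intro bexI[of _ M'] conjI) (simp_all add: idx TSyl_def)
  next
    fix M' :: "'a poly mat" assume "M' \<in> TSyl m n d"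
    then have M': "M' \<in> row_bounded_mats m n d" "full_trimmed_sylvester_rank d M'"
      by (auto simp: TSyl_def)
    show "\<exists>\<epsilon>>0. \<forall>M \<in> row_bounded_mats m n d. poly_mat_dist d M M' < \<epsilon> \<longrightarrow>
        full_trimmed_sylvester_rank d M"
      by (rule full_rank_open[OF assms(1,3) k assms(5,6) M'])
  }
qed

theorem corollary6p3:
  fixes m n k' t :: nat and d :: "nat list"
  assumes "m > 0" and "n > 0" and "length d = m" and "Max (set d) > 0"
    and "k' = nat \<lceil>real (sum_list d) / real n\<rceil>"
    and "n * k' = sum_list d + t" and "t < n"
  shows "((\<forall>M \<in> (row_bounded_mats m n d :: real poly mat set). \<forall>\<epsilon>>0.
            \<exists>M' \<in> TSyl m n d. poly_mat_dist d M M' < \<epsilon> \<and>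
              is_minimal_basis_mat M' \<and>
              mat_rank (leading_row_coeff_mat d M') = m \<and>
              (\<forall>i<m. vec_degree (row M' i) = d ! i) \<and>
              length (right_minimal_indices M') = n \<and>
              count_list (right_minimal_indices M') (k' - 1) = t \<and>
              count_list (right_minimal_indices M') k' = n - t) \<and>
         (\<forall>M' \<in> (TSyl m n d :: real poly mat set). \<exists>\<epsilon>>0.
            \<forall>M \<in> row_bounded_mats m n d. poly_mat_dist d M M' < \<epsilon> \<longrightarrow>
              full_trimmed_sylvester_rank d M)) \<and>
        ((\<forall>M \<in> (row_bounded_mats m n d :: complex poly mat set). \<forall>\<epsilon>>0.
            \<exists>M' \<in> TSyl m n d. poly_mat_dist d M M' < \<epsilon> \<and>
              is_minimal_basis_mat M' \<and>
              mat_rank (leading_row_coeff_mat d M') = m \<and>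
              (\<forall>i<m. vec_degree (row M' i) = d ! i) \<and>
              length (right_minimal_indices M') = n \<and>
              count_list (right_minimal_indices M') (k' - 1) = t \<and>
              count_list (right_minimal_indices M') k' = n - t) \<and>
         (\<forall>M' \<in> (TSyl m n d :: complex poly mat set). \<exists>\<epsilon>>0.
            \<forall>M \<in> row_bounded_mats m n d. poly_mat_dist d M M' < \<epsilon> \<longrightarrow>
              full_trimmed_sylvester_rank d M))"
  by (rule conjI; rule TSyl_generic[OF assms(1-4,6,7)])

end
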